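(* Let $c_L\in\mathbb{C}$, $c_{L,I}\in\mathbb{C}\setminus\{0\}$, $r,s\in\mathbb{C}$, and put $h=\Delta_{r,s}=\frac12r^2-\frac12s^2-\lambda r+\mu s$, $h_I=r-s$. Assume that $\frac{h_I}{c_{L,I}}-1=-p$ with $p\in\mathbb{Z}_{>0}$. Then, as an $L^{\mathcal H}(c_L,c_{L,I})$-module, $\mathcal F_{r,s}$ is generated by $e^{r\alpha+s\beta}$ and a family of cosingular vectors $\{v_{n,p}:n\ge1\}\subset\mathcal F_{r,s}$ such that $$Q^nv_{n,p}=e^{r\alpha+s\beta-n\frac{\alpha+\beta}{c_{L,I}}}\qquad(n\ge1).$$ In particular, the irreducible highest weight module is realized as the submodule $$L^{\mathcal H}(c_L,0,c_{L,I},h,h_I)\cong\mathrm{Ker}_{\mathcal F_{r,s}}Q .$$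
   Context: The twisted Heisenberg-Virasoro algebra $\mathcal H$ is the complex Lie algebra with basis $\{L(n),I(n):n\in\mathbb{Z}\}\cup\{C_L,C_{LI},C_I\}$ and brackets $[L(n),L(m)]=(n-m)L(n+m)+\delta_{n,-m}\frac{n^3-n}{12}C_L$, $[L(n),I(m)]=-mI(n+m)-\delta_{n,-m}(n^2+n)C_{LI}$, $[I(n),I(m)]=n\delta_{n,-m}C_I$, with $C_L,C_{LI},C_I$ central. $L^{\mathcal H}(c_L,0,c_{L,I},h,h_I)$ is the irreducible highest weight $\mathcal H$-module on which $C_L,C_I,C_{LI}$ act as $c_L,0,c_{L,I}$ and whose highest weight vector (annihilated by $L(n),I(n)$, $n>0$) has $L(0),I(0)$-eigenvalues $h,h_I$. $L^{\mathcal H}(c_L,c_{L,I})$ denotes $L^{\mathcal H}(c_L,0,c_{L,I},0,0)$ with its structure of simple vertex algebra generated by $I(z)=\sum I(n)z^{-n-1}$ and $L(z)=\sum L(n)z^{-n-2}$. A singular vector in an $\mathcal H$-module is a nonzero vector annihilated by $L(n),I(n)$, $n>0$, that is an eigenvector of $L(0)$ and $I(0)$. A vector $v$ in an $\mathcal H$-module $M$ is cosingular if there is a submodule $N\subset M$ such that $v+N$ is a singular vector in $M/N$. Free field realization. Put $\lambda=\frac{2-c_L}{24c_{L,I}}+\frac12c_{L,I}$, $\mu=\frac{2-c_L}{24c_{L,I}}-\frac12c_{L,I}$. Let $\mathfrak h=\mathbb{C}\alpha\oplus\mathbb{C}\beta$ with $\langle\alpha,\alpha\rangle=-\langle\beta,\beta\rangle=1$,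 $\langle\alpha,\beta\rangle=0$, and $\widehat{\mathfrak h}=\mathbb{C}[t,t^{-1}]\otimes\mathfrak h\oplus\mathbb{C}c$ its affinization, $\delta(n)=t^n\otimes\delta$. For $\gamma\in\mathfrak h$, $M(1,\gamma)$ is the $\widehat{\mathfrak h}$-module induced from the one-dimensional module spanned by $e^\gamma$ on which $\delta(n)$ acts as $0$ for $n>0$, $\delta(0)$ acts as $\langle\delta,\gamma\rangle$, and $c$ acts as $1$. $M(1)=M(1,0)$ is the Heisenberg vertex algebra and $\mathcal F_{r,s}:=M(1,r\alpha+s\beta)$ is an $M(1)$-module. The vectors $I=\alpha(-1)+\beta(-1)$ and $\omega=\frac12\alpha(-1)^2-\frac12\beta(-1)^2+\lambda\alpha(-2)+\mu\beta(-2)$ generate a vertex subalgebra of $M(1)$ isomorphic to $L^{\mathcal H}(c_L,c_{L,I})$, via $Y(I,z)=\sum_nI(n)z^{-n-1}$, $Y(\omega,z)=\sum_nL(n)z^{-n-2}$; so each $\mathcal F_{r,s}$ is an $L^{\mathcal H}(c_L,c_{L,I})$-module and an $\mathcal H$-module. Screening operator. Let $\phi=-\frac{\alpha+\beta}{c_{L,I}}$ and $D=\mathbb{Z}\phi$. For $\gamma\in\mathfrak h$ with $\langle\gamma,\alpha+\beta\rangle\in c_{L,I}\mathbb{Z}$ the operator $Q=\mathrm{Res}_zY(e^\phi,z)$ acts on $\bigoplus_{n\in\mathbb{Z}}M(1,\gamma+n\phi)$ (mapping $M(1,\gamma)$ to $M(1,\gamma+\phi)$), where $Y(e^\phi,z)=\exp\left(\sum_{n\ge1}\frac{\phi(-n)}{n}z^n\right)\exp\left(-\sum_{n\ge1}\frac{\phi(n)}{n}z^{-n}\right)e^\phi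 z^{\phi(0)}$ and $e^\phi$ is the shift $e^\delta\mapsto e^{\delta+\phi}$ commuting with all $\delta'(n)$, $n\ne0$. $Q$ commutes with the action of $\mathcal H$. *)

theory Defs
  imports
    Complex_Main
    "HOL-Library.Multiset"
    "HOL-Library.Poly_Mapping"
    "HOL-Library.Product_Plus"
begin

section \<open>The twisted Heisenberg-Virasoro algebra and its modules\<close>

datatype hv_gen = L_gen int | I_gen int | CL | CLI | CI

text \<open>The Lie bracket on basis elements; the algebra itself is the space
  \<^typ>\<open>hv_gen \<Rightarrow>\<^sub>0 complex\<close>.\<close>

fun hv_bracket :: "hv_gen \<Rightarrow> hv_gen \<Rightarrow> (hv_gen \<Rightarrow>\<^sub>0 complex)" where
  "hv_bracket (L_gen n) (L_gen m) = Poly_Mapping.single (L_gen (n + m)) (of_int (n - m))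
     + (if n = - m then Poly_Mapping.single CL (of_int (n ^ 3 - n) / 12) else 0)"
| "hv_bracket (L_gen n) (I_gen m) = Poly_Mapping.single (I_gen (n + m)) (- of_int m)
     - (if n = - m then Poly_Mapping.single CLI (of_int (n ^ 2 + n)) else 0)"
| "hv_bracket (I_gen m) (L_gen n) = Poly_Mapping.single (I_gen (n + m)) (of_int m)
     + (if n = - m then Poly_Mapping.single CLI (of_int (n ^ 2 + n)) else 0)"
| "hv_bracket (I_gen n) (I_gen m) = (if n = - m then Poly_Mapping.single CI (of_int n) else 0)"
| "hv_bracket _ _ = 0"

text \<open>A module is a subspace \<open>V\<close> of an ambient complex vector space (a type with scalar
  multiplication \<open>sc\<close>) together with the action of the basis elements on \<open>V\<close>; the behaviour
  of \<open>act\<close> outside \<open>V\<close> is irrelevant.\<close>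

locale hv_module = vector_space sc
  for sc :: "complex \<Rightarrow> 'v \<Rightarrow> 'v::ab_group_add" +
  fixes V :: "'v set" and act :: "hv_gen \<Rightarrow> 'v \<Rightarrow> 'v"
  assumes carrier_subspace: "subspace V"
    and act_closed: "v \<in> V \<Longrightarrow> act x v \<in> V"
    and act_add: "v \<in> V \<Longrightarrow> w \<in> V \<Longrightarrow> act x (v + w) = act x v + act x w"
    and act_scale: "v \<in> V \<Longrightarrow> act x (sc a v) = sc a (act x v)"
    and act_bracket: "v \<in> V \<Longrightarrow> act x (act y v) - act y (act x v) =
      (\<Sum>z\<in>Poly_Mapping.keys (hv_bracket x y). sc (Poly_Mapping.lookup (hv_bracket x y) z) (act z v))"

definition hv_submodule ::
  "(complex \<Rightarrow> 'v \<Rightarrow> 'v) \<Rightarrow> 'v::ab_group_add set \<Rightarrow> (hv_gen \<Rightarrow> 'v \<Rightarrow> 'v) \<Rightarrow> 'v set \<Rightarrow> bool" where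
  "hv_submodule sc V act N \<longleftrightarrow>
     N \<subseteq> V \<and> module.subspace sc N \<and> (\<forall>x. \<forall>v\<in>N. act x v \<in> N)"

definition hv_generated ::
  "(complex \<Rightarrow> 'v \<Rightarrow> 'v) \<Rightarrow> 'v::ab_group_add set \<Rightarrow> (hv_gen \<Rightarrow> 'v \<Rightarrow> 'v) \<Rightarrow> 'v set \<Rightarrow> 'v set" where
  "hv_generated sc V act S = \<Inter>{N. hv_submodule sc V act N \<and> S \<subseteq> N}"

definition hv_irreducible ::
  "(complex \<Rightarrow> 'v \<Rightarrow> 'v) \<Rightarrow> 'v::ab_group_add set \<Rightarrow> (hv_gen \<Rightarrow> 'v \<Rightarrow> 'v) \<Rightarrow> bool" where
  "hv_irreducible sc V act \<longleftrightarrow>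
     V \<noteq> {0} \<and> (\<forall>N. hv_submodule sc V act N \<longrightarrow> N = {0} \<or> N = V)"

definition hv_isomorphic ::
  "(complex \<Rightarrow> 'v \<Rightarrow> 'v) \<Rightarrow> 'v::ab_group_add set \<Rightarrow> (hv_gen \<Rightarrow> 'v \<Rightarrow> 'v) \<Rightarrow>
   (complex \<Rightarrow> 'w \<Rightarrow> 'w) \<Rightarrow> 'w::ab_group_add set \<Rightarrow> (hv_gen \<Rightarrow> 'w \<Rightarrow> 'w) \<Rightarrow> bool" where
  "hv_isomorphic sc V act sc' W act' \<longleftrightarrow> (\<exists>f. bij_betw f V W
     \<and> (\<forall>u\<in>V. \<forall>v\<in>V. f (u + v) = f u + f v)
     \<and> (\<forall>a. \<forall>v\<in>V. f (sc a v) = sc' a (f v))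
     \<and> (\<forall>x. \<forall>v\<in>V. f (act x v) = act' x (f v)))"

text \<open>The property characterising, up to isomorphism, the irreducible highest weight module
  $L^{\mathcal H}(c_L, c_I, c_{L,I}, h, h_I)$.\<close>

definition is_irreducible_hw_module ::
  "complex \<Rightarrow> complex \<Rightarrow> complex \<Rightarrow> complex \<Rightarrow> complex \<Rightarrow>
   (complex \<Rightarrow> 'v \<Rightarrow> 'v) \<Rightarrow> 'v::ab_group_add set \<Rightarrow> (hv_gen \<Rightarrow> 'v \<Rightarrow> 'v) \<Rightarrow> bool" where
  "is_irreducible_hw_module cL cI cLI h hI sc V act \<longleftrightarrow>
     hv_module sc V act \<and> hv_irreducible sc V act
     \<and> (\<forall>v\<in>V. act CL v = sc cL v \<and> act CI v = sc cI v \<and> act CLI v = sc cLI v)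
     \<and> (\<exists>v\<in>V. v \<noteq> 0
          \<and> (\<forall>n>0. act (L_gen n) v = 0 \<and> act (I_gen n) v = 0)
          \<and> act (L_gen 0) v = sc h v \<and> act (I_gen 0) v = sc hI v
          \<and> hv_generated sc V act {v} = V)"

text \<open>The zero vector is a parameter, so that the notion also applies to quotient modules,
  whose elements are cosets.\<close>

definition hv_singular ::
  "(complex \<Rightarrow> 'v \<Rightarrow> 'v) \<Rightarrow> 'v \<Rightarrow> 'v set \<Rightarrow> (hv_gen \<Rightarrow> 'v \<Rightarrow> 'v) \<Rightarrow> 'v \<Rightarrow> bool" where
  "hv_singular sc zero V act v \<longleftrightarrow> v \<in> V \<and> v \<noteq> zero
     \<and> (\<forall>n>0. act (L_gen n) v = zero \<and> act (I_gen n) v = zero)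
     \<and> (\<exists>a b. act (L_gen 0) v = sc a v \<and> act (I_gen 0) v = sc b v)"

definition coset :: "'v::ab_group_add set \<Rightarrow> 'v \<Rightarrow> 'v set" where
  "coset N v = (+) v ` N"

text \<open>The operation on \<open>V / N\<close> induced by an operation on \<open>V\<close> that preserves \<open>N\<close>
  (the union is over one and the same coset).\<close>

definition coset_lift :: "'v::ab_group_add set \<Rightarrow> ('v \<Rightarrow> 'v) \<Rightarrow> 'v set \<Rightarrow> 'v set" where
  "coset_lift N f X = (\<Union>w\<in>X. coset N (f w))"

definition hv_cosingular ::
  "(complex \<Rightarrow> 'v \<Rightarrow> 'v) \<Rightarrow> 'v::ab_group_add set \<Rightarrow> (hv_gen \<Rightarrow> 'v \<Rightarrow> 'v) \<Rightarrow> 'v \<Rightarrow> bool" where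
  "hv_cosingular sc V act v \<longleftrightarrow> v \<in> V \<and> (\<exists>N. hv_submodule sc V act N
     \<and> hv_singular (\<lambda>a. coset_lift N (sc a)) N (coset N ` V) (\<lambda>x. coset_lift N (act x)) (coset N v))"


section \<open>Fock spaces\<close>

text \<open>The pair \<open>(a, b)\<close> stands for $a\alpha + b\beta \in \mathfrak h$.\<close>

type_synonym cartan = "complex \<times> complex"

definition hform :: "cartan \<Rightarrow> cartan \<Rightarrow> complex" where
  "hform \<gamma> \<delta> = fst \<gamma> * fst \<delta> - snd \<gamma> * snd \<delta>"

datatype heis_gen = Alpha | Beta

fun gen_vec :: "heis_gen \<Rightarrow> cartan" where
  "gen_vec Alpha = (1, 0)"
| "gen_vec Beta = (0, 1)"

text \<open>\<open>fock\<close> is the direct sum of all $M(1,\gamma)$, $\gamma \in \mathfrak h$, in its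
  Poincare-Birkhoff-Witt basis. The basis element \<open>(M, \<gamma>)\<close> is the vector
  $\prod_{(g,k) \in M} g(-k-1)\, e^\gamma$: the pair \<open>(g, k)\<close> encodes the creation operator
  $g(-(k+1))$, so that \<open>k\<close> ranges over all natural numbers.\<close>

type_synonym fock = "((heis_gen \<times> nat) multiset \<times> cartan) \<Rightarrow>\<^sub>0 complex"

definition scl :: "complex \<Rightarrow> fock \<Rightarrow> fock" where
  "scl a = Poly_Mapping.map ((*) a)"

definition lin_ext :: "((heis_gen \<times> nat) multiset \<times> cartan \<Rightarrow> fock) \<Rightarrow> fock \<Rightarrow> fock" where
  "lin_ext f v = (\<Sum>b\<in>Poly_Mapping.keys v. scl (Poly_Mapping.lookup v b) (f b))"

definition fexp :: "cartan \<Rightarrow> fock" where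
  "fexp \<gamma> = Poly_Mapping.single ({#}, \<gamma>) 1"

definition Fock_module :: "cartan \<Rightarrow> fock set" where
  "Fock_module \<gamma> = {v. \<forall>b\<in>Poly_Mapping.keys v. snd b = \<gamma>}"

text \<open>The action of $\delta(n)$, with the central element acting as 1.\<close>

definition heis :: "cartan \<Rightarrow> int \<Rightarrow> fock \<Rightarrow> fock" where
  "heis \<delta> n = lin_ext (\<lambda>(M, \<gamma>).
     if n < 0 then
       Poly_Mapping.single (add_mset (Alpha, nat (- n) - 1) M, \<gamma>) (fst \<delta>)
       + Poly_Mapping.single (add_mset (Beta, nat (- n) - 1) M, \<gamma>) (snd \<delta>)
     else if n = 0 then Poly_Mapping.single (M, \<gamma>) (hform \<delta> \<gamma>)
     else (\<Sum>g\<in>{Alpha, Beta}. Poly_Mapping.single (M - {#(g, nat n - 1)#}, \<gamma>)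
            (of_int n * hform \<delta> (gen_vec g) * of_nat (count M (g, nat n - 1)))))"


subsection \<open>Universal property of the Fock modules\<close>

text \<open>The operators \<open>heis \<delta> n\<close> satisfy the relations of $\widehat{\mathfrak h}$ with \<open>c\<close> acting as 1, and
  \<open>Fock_module \<gamma>\<close> with the vector \<open>fexp \<gamma>\<close> has the universal property of the module induced from
  the one-dimensional module on which $\delta(n)$, $n > 0$, acts as 0 and $\delta(0)$ as
  $\langle\delta,\gamma\rangle$ (theorems \<open>heis_comm\<close>, \<open>heis_Fock_module\<close>, \<open>heis_fexp\<close>,
  \<open>Fock_module_universal\<close>).\<close>

lemma lookup_scl [simp]: "Poly_Mapping.lookup (scl a v) b = a * Poly_Mapping.lookup v b"
  by (simp add: scl_def map.rep_eq when_def)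

lemma keys_scl: "Poly_Mapping.keys (scl a v) \<subseteq> Poly_Mapping.keys v"
  by (auto simp: in_keys_iff)

lemma vector_space_scl: "vector_space scl"
  by unfold_locales (auto intro!: poly_mapping_eqI simp: lookup_add algebra_simps)

interpretation fock: vector_space scl
  by (rule vector_space_scl)

lemma scl_single [simp]: "scl a (Poly_Mapping.single b x) = Poly_Mapping.single b (a * x)"
  by (rule poly_mapping_eqI) (simp add: lookup_single when_def)

lemma fock_additive_eqI:
  fixes f g :: "fock \<Rightarrow> 'v::ab_group_add"
  assumes add1: "\<And>u v. f (u + v) = f u + f v" and add2: "\<And>u v. g (u + v) = g u + g v"
    and "\<And>M \<gamma> x. (M, \<gamma>) \<in> Poly_Mapping.keys v \<Longrightarrow>
           f (Poly_Mapping.single (M, \<gamma>) x) = g (Poly_Mapping.single (M, \<gamma>) x)"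
  shows "f v = g v"
proof -
  have z: "f 0 = 0" "g 0 = 0" using add1[of 0 0] add2[of 0 0] by simp_all
  have s: "f (\<Sum>b\<in>A. h b) = (\<Sum>b\<in>A. f (h b))" "g (\<Sum>b\<in>A. h b) = (\<Sum>b\<in>A. g (h b))"
    if "finite A" for A :: "((heis_gen \<times> nat) multiset \<times> cartan) set" and h
    using that by (induction A rule: finite_induct) (auto simp: z add1 add2)
  have v: "v = (\<Sum>b\<in>Poly_Mapping.keys v. Poly_Mapping.single b (Poly_Mapping.lookup v b))"
    by (rule poly_mapping_eqI)
       (simp add: lookup_sum lookup_single when_def in_keys_iff)
  have "f v = (\<Sum>b\<in>Poly_Mapping.keys v. f (Poly_Mapping.single b (Poly_Mapping.lookup v b)))"
    by (subst v) (rule s, simp)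
  also have "\<dots> = (\<Sum>b\<in>Poly_Mapping.keys v. g (Poly_Mapping.single b (Poly_Mapping.lookup v b)))"
    by (rule sum.cong) (use assms(3) in auto)
  also have "\<dots> = g v"
    by (subst (2) v) (rule s(2)[symmetric], simp)
  finally show ?thesis .
qed

context
  fixes sc :: "complex \<Rightarrow> 'v \<Rightarrow> 'v::ab_group_add" and f :: "(heis_gen \<times> nat) multiset \<times> cartan \<Rightarrow> 'v"
  assumes vs: "vector_space sc"
begin

interpretation vector_space sc by (rule vs)

abbreviation (input) "ext_sum v \<equiv> (\<Sum>b\<in>Poly_Mapping.keys v. sc (Poly_Mapping.lookup v b) (f b))"

lemma ext_superset:
  assumes "finite A" "Poly_Mapping.keys v \<subseteq> A"
  shows "ext_sum v = (\<Sum>b\<in>A. sc (Poly_Mapping.lookup v b) (f b))"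
  by (rule sum.mono_neutral_left) (use assms in \<open>auto simp: in_keys_iff\<close>)

lemma ext_add: "ext_sum (u + v) = ext_sum u + ext_sum v"
proof -
  let ?A = "Poly_Mapping.keys u \<union> Poly_Mapping.keys v"
  have "ext_sum (u + v) = (\<Sum>b\<in>?A. sc (Poly_Mapping.lookup (u + v) b) (f b))"
    by (rule ext_superset) (simp_all add: keys_add)
  also have "\<dots> = ext_sum u + ext_sum v"
    by (simp add: ext_superset[of ?A] lookup_add scale_left_distrib sum.distrib)
  finally show ?thesis .
qed

lemma ext_single: "ext_sum (Poly_Mapping.single b x) = sc x (f b)"
  by (subst ext_superset[of "{b}"]) auto

lemma ext_scl: "ext_sum (scl a v) = sc a (ext_sum v)"
  by (subst ext_superset[of "Poly_Mapping.keys v"])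
     (auto simp: keys_scl[THEN subsetD] scale_sum_right)

end

lemma lin_ext_add [simp]: "lin_ext f (u + v) = lin_ext f u + lin_ext f v"
  and lin_ext_scl [simp]: "lin_ext f (scl a v) = scl a (lin_ext f v)"
  and lin_ext_single [simp]: "lin_ext f (Poly_Mapping.single b x) = scl x (f b)"
  unfolding lin_ext_def
  by (rule ext_add[OF vector_space_scl] ext_scl[OF vector_space_scl] ext_single[OF vector_space_scl])+

lemma lin_ext_zero [simp]: "lin_ext f 0 = 0"
  by (simp add: lin_ext_def)

lemma heis_add: "heis \<delta> n (u + v) = heis \<delta> n u + heis \<delta> n v"
  and heis_scl: "heis \<delta> n (scl a v) = scl a (heis \<delta> n v)"
  and heis_zero [simp]: "heis \<delta> n 0 = 0"
  by (simp_all add: heis_def)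

lemma heis_gen_single: "heis (gen_vec g) n (Poly_Mapping.single (M, \<gamma>) x) =
  (if n < 0 then Poly_Mapping.single (add_mset (g, nat (- n) - 1) M, \<gamma>) x
   else if n = 0 then Poly_Mapping.single (M, \<gamma>) (x * hform (gen_vec g) \<gamma>)
   else Poly_Mapping.single (M - {#(g, nat n - 1)#}, \<gamma>)
     (x * of_int n * hform (gen_vec g) (gen_vec g) * of_nat (count M (g, nat n - 1))))"
  by (cases g) (auto simp: heis_def hform_def fock.scale_right_distrib algebra_simps single_uminus)

lemma heis_eq_gen:
  "heis \<delta> n v = scl (fst \<delta>) (heis (gen_vec Alpha) n v) + scl (snd \<delta>) (heis (gen_vec Beta) n v)"
proof (rule fock_additive_eqI[where v = v])
  fix M \<gamma> x
  show "heis \<delta> n (Poly_Mapping.single (M, \<gamma>) x) =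
    scl (fst \<delta>) (heis (gen_vec Alpha) n (Poly_Mapping.single (M, \<gamma>) x)) +
    scl (snd \<delta>) (heis (gen_vec Beta) n (Poly_Mapping.single (M, \<gamma>) x))"
    unfolding heis_gen_single
    by (auto simp: heis_def hform_def fock.scale_right_distrib algebra_simps simp flip: single_add)
qed (simp_all add: heis_add fock.scale_right_distrib algebra_simps)

lemma hform_gen: "g \<noteq> g' \<Longrightarrow> hform (gen_vec g) (gen_vec g') = 0"
  by (cases g; cases g') (auto simp: hform_def)

lemma heis_gen_comm:
  "heis (gen_vec g) m (heis (gen_vec g') n v) = heis (gen_vec g') n (heis (gen_vec g) m v) +
     (if m + n = 0 then scl (of_int m * hform (gen_vec g) (gen_vec g')) v else 0)"
proof (rule fock_additive_eqI[where v = v])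
  fix M \<gamma> x
  have n: "nat a - 1 = nat b - 1 \<longleftrightarrow> a = b" if "a > 0" "b > 0" for a b using that by auto
  show "heis (gen_vec g) m (heis (gen_vec g') n (Poly_Mapping.single (M, \<gamma>) x)) =
     heis (gen_vec g') n (heis (gen_vec g) m (Poly_Mapping.single (M, \<gamma>) x)) +
     (if m + n = 0 then scl (of_int m * hform (gen_vec g) (gen_vec g')) (Poly_Mapping.single (M, \<gamma>) x) else 0)"
    (is ?G)
  proof -
    consider "m < 0 \<and> n < 0 \<or> m = 0 \<or> n = 0" | "m > 0" "n > 0" | "m > 0" "n < 0" | "m < 0" "n > 0"
      by linarith
    then show ?G
    proof cases
      case 1
      then show ?thesis
        by (elim disjE conjE)
           (simp_all add: heis_gen_single add_mset_commute mult_ac)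
    next
      case 2
      then show ?thesis
        by (cases "(g, nat m - 1) = (g', nat n - 1)")
           (auto simp: heis_gen_single n mult_ac add_mset_commute)
    next
      case 3
      show ?thesis
      proof (cases "(g, nat m - 1) = (g', nat (-n) - 1)")
        case True
        with 3 n[of m "-n"] have n: "n = - m" "g' = g" by auto
        show ?thesis
          using 3 unfolding n
          by (cases "(g, nat m - 1) \<in># M")
             (simp_all add: heis_gen_single distrib_left mult_ac add_ac not_in_iff flip: single_add)
      next
        case False
        with 3 n[of m "-n"] have "m + n = 0 \<Longrightarrow> hform (gen_vec g) (gen_vec g') = 0"
          by (auto intro: hform_gen)
        with False False[symmetric] 3 show ?thesis
          by (cases "g = g'"; cases "(g, nat m - 1) \<in># M")
             (simp_all add: heis_gen_single mult_ac not_in_iff)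
      qed
    next
      case 4
      show ?thesis
      proof (cases "(g', nat n - 1) = (g, nat (-m) - 1)")
        case True
        with 4 n[of n "-m"] have m: "m = - n" "g' = g" by auto
        show ?thesis
          using 4 unfolding m
          by (cases "(g, nat n - 1) \<in># M")
             (simp_all add: heis_gen_single distrib_left mult_ac add_ac not_in_iff flip: single_add)
      next
        case False
        with 4 n[of n "-m"] have "m + n = 0 \<Longrightarrow> hform (gen_vec g) (gen_vec g') = 0"
          by (auto intro: hform_gen)
        with False False[symmetric] 4 show ?thesis
          by (cases "g = g'"; cases "(g', nat n - 1) \<in># M")
             (simp_all add: heis_gen_single mult_ac not_in_iff)
      qed
    qed
  qed
qed (simp_all add: heis_add algebra_simps)

lemma hform_gen_expand: "hform \<delta> \<delta>' =
   (fst \<delta> * fst \<delta>') * hform (gen_vec Alpha) (gen_vec Alpha)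
   + (fst \<delta> * snd \<delta>') * hform (gen_vec Alpha) (gen_vec Beta)
   + (snd \<delta> * fst \<delta>') * hform (gen_vec Beta) (gen_vec Alpha)
   + (snd \<delta> * snd \<delta>') * hform (gen_vec Beta) (gen_vec Beta)"
  by (simp add: hform_def)

theorem heis_comm:
  "heis \<delta> m (heis \<delta>' n v) - heis \<delta>' n (heis \<delta> m v) =
     (if m + n = 0 then scl (of_int m * hform \<delta> \<delta>') v else 0)"
proof -
  note expand = heis_eq_gen[of \<delta>] heis_eq_gen[of \<delta>'] heis_add heis_scl heis_gen_comm[of _ m _ n]
  show ?thesis
  proof (cases "m + n = 0")
    case True
    show ?thesis
      unfolding expand hform_gen_expand[of \<delta> \<delta>'] if_P[OF True]
      by (rule poly_mapping_eqI) (simp add: lookup_add lookup_minus algebra_simps)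
  next
    case False
    show ?thesis
      unfolding expand if_not_P[OF False]
      by (rule poly_mapping_eqI) (simp add: lookup_add lookup_minus algebra_simps)
  qed
qed

lemma Fock_module_subspace: "fock.subspace (Fock_module \<gamma>)"
  unfolding fock.subspace_def Fock_module_def
  by (auto dest!: keys_add[THEN subsetD] keys_scl[THEN subsetD])

lemma heis_Fock_module:
  assumes "v \<in> Fock_module \<gamma>"
  shows "heis \<delta> n v \<in> Fock_module \<gamma>"
  unfolding heis_def lin_ext_def
proof (rule fock.subspace_sum[OF Fock_module_subspace], rule fock.subspace_scale[OF Fock_module_subspace])
  fix b assume "b \<in> Poly_Mapping.keys v"
  with assms have "b = (fst b, \<gamma>)"
    by (auto simp: Fock_module_def prod_eq_iff)
  then obtain M where b: "b = (M, \<gamma>)" ..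
  have s: "Poly_Mapping.single (N, \<gamma>) x \<in> Fock_module \<gamma>" for N x
    by (simp add: Fock_module_def)
  show "(case b of (M, \<gamma>) \<Rightarrow>
     if n < 0 then
       Poly_Mapping.single (add_mset (Alpha, nat (- n) - 1) M, \<gamma>) (fst \<delta>)
       + Poly_Mapping.single (add_mset (Beta, nat (- n) - 1) M, \<gamma>) (snd \<delta>)
     else if n = 0 then Poly_Mapping.single (M, \<gamma>) (hform \<delta> \<gamma>)
     else (\<Sum>g\<in>{Alpha, Beta}. Poly_Mapping.single (M - {#(g, nat n - 1)#}, \<gamma>)
            (of_int n * hform \<delta> (gen_vec g) * of_nat (count M (g, nat n - 1))))) \<in> Fock_module \<gamma>"
    unfolding b using s
    by (simp add: fock.subspace_add[OF Fock_module_subspace])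
qed

lemma heis_fexp:
  "n > 0 \<Longrightarrow> heis \<delta> n (fexp \<gamma>) = 0" "heis \<delta> 0 (fexp \<gamma>) = scl (hform \<delta> \<gamma>) (fexp \<gamma>)"
  by (simp_all add: heis_def fexp_def)

lemma Fock_module_additive_eqI:
  fixes f g :: "fock \<Rightarrow> 'v::ab_group_add"
  assumes "v \<in> Fock_module \<gamma>"
    and add1: "\<And>u v. u \<in> Fock_module \<gamma> \<Longrightarrow> v \<in> Fock_module \<gamma> \<Longrightarrow> f (u + v) = f u + f v"
    and add2: "\<And>u v. u \<in> Fock_module \<gamma> \<Longrightarrow> v \<in> Fock_module \<gamma> \<Longrightarrow> g (u + v) = g u + g v"
    and eq: "\<And>M x. f (Poly_Mapping.single (M, \<gamma>) x) = g (Poly_Mapping.single (M, \<gamma>) x)"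
  shows "f v = g v"
proof -
  let ?P = "\<lambda>b. Poly_Mapping.single b (Poly_Mapping.lookup v b)"
  have 0: "0 \<in> Fock_module \<gamma>" by (simp add: Fock_module_def)
  have z: "f 0 = 0" "g 0 = 0"
    using add1[OF 0 0] add2[OF 0 0] by simp_all
  have "(\<Sum>b\<in>A. ?P b) \<in> Fock_module \<gamma> \<and> f (\<Sum>b\<in>A. ?P b) = g (\<Sum>b\<in>A. ?P b)"
    if "finite A" "A \<subseteq> Poly_Mapping.keys v" for A
    using that
  proof (induction A rule: finite_induct)
    case empty
    then show ?case by (simp add: z Fock_module_def)
  next
    case (insert b A)
    have "b = (fst b, \<gamma>)"
      using insert.prems assms(1) by (auto simp: Fock_module_def prod_eq_iff)
    then obtain M where b: "b = (M, \<gamma>)" ..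
    have P: "?P b \<in> Fock_module \<gamma>" by (simp add: b Fock_module_def)
    have IH: "sum ?P A \<in> Fock_module \<gamma>" "f (sum ?P A) = g (sum ?P A)"
      using insert.IH insert.prems by blast+
    have i: "sum ?P (insert b A) = ?P b + sum ?P A"
      by (rule sum.insert) (rule insert.hyps)+
    have "f (?P b) = g (?P b)"
      unfolding b by (rule eq)
    then show ?case
      unfolding i add1[OF P IH(1)] add2[OF P IH(1)] IH(2)
      by (intro conjI fock.subspace_add[OF Fock_module_subspace P IH(1)]) (rule arg_cong2[where f = "(+)"], auto)
  qed
  from this[of "Poly_Mapping.keys v"]
  have "f (\<Sum>b\<in>Poly_Mapping.keys v. ?P b) = g (\<Sum>b\<in>Poly_Mapping.keys v. ?P b)" by simp
  also have "(\<Sum>b\<in>Poly_Mapping.keys v. ?P b) = v"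
    by (rule poly_mapping_eqI) (simp add: lookup_sum lookup_single when_def in_keys_iff)
  finally show ?thesis .
qed

theorem Fock_module_universal:
  fixes sc :: "complex \<Rightarrow> 'v \<Rightarrow> 'v::ab_group_add" and H :: "cartan \<Rightarrow> int \<Rightarrow> 'v \<Rightarrow> 'v"
  assumes vs: "vector_space sc"
    and H_add: "\<And>\<delta> n u v. H \<delta> n (u + v) = H \<delta> n u + H \<delta> n v"
    and H_sc: "\<And>\<delta> n a v. H \<delta> n (sc a v) = sc a (H \<delta> n v)"
    and H_lin: "\<And>a b n v. H (a, b) n v = sc a (H (1, 0) n v) + sc b (H (0, 1) n v)"
    and H_comm: "\<And>\<delta> \<delta>' m n v. H \<delta> m (H \<delta>' n v) - H \<delta>' n (H \<delta> m v) =
      (if m + n = 0 then sc (of_int m * hform \<delta> \<delta>') v else 0)"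
    and w: "\<And>\<delta> n. n > 0 \<Longrightarrow> H \<delta> n w = 0" "\<And>\<delta>. H \<delta> 0 w = sc (hform \<delta> \<gamma>) w"
  defines "morphism \<equiv> \<lambda>f. (\<forall>u\<in>Fock_module \<gamma>. \<forall>v\<in>Fock_module \<gamma>. f (u + v) = f u + f v)
      \<and> (\<forall>a. \<forall>v\<in>Fock_module \<gamma>. f (scl a v) = sc a (f v))
      \<and> (\<forall>\<delta> n. \<forall>v\<in>Fock_module \<gamma>. f (heis \<delta> n v) = H \<delta> n (f v))
      \<and> f (fexp \<gamma>) = w"
  shows "\<exists>f. morphism f" and "morphism f \<Longrightarrow> morphism g \<Longrightarrow> v \<in> Fock_module \<gamma> \<Longrightarrow> f v = g v"
proof -
  interpret vector_space sc by (rule vs)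
  have H_gen: "H \<delta> n v = sc (fst \<delta>) (H (gen_vec Alpha) n v) + sc (snd \<delta>) (H (gen_vec Beta) n v)"
    for \<delta> n v using H_lin[of "fst \<delta>" "snd \<delta>"] by simp
  have H_0 [simp]: "H \<delta> n 0 = 0" for \<delta> n using H_add[of \<delta> n 0 0] by simp
  define c where "c = (\<lambda>(g, k). H (gen_vec g) (- int k - 1))"
  have H_swap: "H \<delta> m (H \<delta>' n v) = H \<delta>' n (H \<delta> m v)
     + (if m + n = 0 then sc (of_int m * hform \<delta> \<delta>') v else 0)" for \<delta> \<delta>' m n v
    using H_comm[of \<delta> m \<delta>' n v] by (simp add: algebra_simps)
  interpret c: comp_fun_commute c
  proof
    fix x y :: "heis_gen \<times> nat"
    show "c y \<circ> c x = c x \<circ> c y"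
    proof
      fix v
      obtain g k g' k' where xy: "x = (g, k)" "y = (g', k')" by (cases x; cases y)
      have "(- int k' - 1) + (- int k - 1) \<noteq> 0" by linarith
      then show "(c y \<circ> c x) v = (c x \<circ> c y) v"
        using H_swap[of "gen_vec g'" "- int k' - 1" "gen_vec g" "- int k - 1" v]
        unfolding xy c_def by (simp only: o_apply prod.case if_False add_0_right)
    qed
  qed
  define F where "F = fold_mset c w"
  have F_add: "F (add_mset (g, k) M) = H (gen_vec g) (- int k - 1) (F M)" for g k M
    unfolding F_def c.fold_mset_add_mset by (simp add: c_def)
  have F_0: "H \<delta> 0 (F M) = sc (hform \<delta> \<gamma>) (F M)" for \<delta> M
  proof (induction M)
    case (add x M)
    then show ?case
      by (cases x) (simp add: F_add H_sc H_swap[of \<delta> 0])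
  qed (simp add: F_def w)
  have F_pos: "H (gen_vec g) (int n + 1) (F M) =
     sc ((of_nat n + 1) * hform (gen_vec g) (gen_vec g) * of_nat (count M (g, n))) (F (M - {#(g, n)#}))" for g n M
  proof (induction M)
    case (add x M)
    obtain g' k where x: "x = (g', k)" by (cases x)
    have M: "(g, n) \<in># M \<Longrightarrow> H (gen_vec g') (- int k - 1) (F (M - {#(g, n)#})) =
        F (add_mset (g', k) (M - {#(g, n)#}))"
      by (simp add: F_add)
    show ?case
    proof (cases "(g, n) = (g', k)")
      case True
      let ?a = "(of_nat n + 1) * hform (gen_vec g) (gen_vec g)"
      have "H (gen_vec g) (int n + 1) (F (add_mset x M)) =
          H (gen_vec g') (- int k - 1) (H (gen_vec g) (int n + 1) (F M)) + sc ?a (F M)"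
        unfolding x F_add using True by (subst H_swap) auto
      also have "H (gen_vec g') (- int k - 1) (H (gen_vec g) (int n + 1) (F M)) =
          sc (?a * of_nat (count M (g, n))) (F M)"
      proof (cases "(g, n) \<in># M")
        case in_M: True
        then show ?thesis unfolding add.IH H_sc M[OF in_M] using True by simp
      qed (simp add: add.IH not_in_iff)
      also have "\<dots> + sc ?a (F M) = sc (?a * (of_nat (count M (g, n)) + 1)) (F M)"
        by (simp only: distrib_left scale_left_distrib mult_1_right)
      finally show ?thesis using True x by (simp add: add.commute)
    next
      case False
      then have "n = k \<Longrightarrow> hform (gen_vec g) (gen_vec g') = 0" by (auto intro: hform_gen)
      then have "H (gen_vec g) (int n + 1) (F (add_mset x M)) =
          H (gen_vec g') (- int k - 1) (H (gen_vec g) (int n + 1) (F M))"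
        unfolding x F_add by (subst H_swap) auto
      with False False[symmetric] add M show ?thesis unfolding x
        by (cases "(g, n) \<in># M"; cases "g = g'") (simp_all add: H_sc not_in_iff)
    qed
  qed (simp add: F_def w)
  define f0 :: "fock \<Rightarrow> 'v" where "f0 = (\<lambda>v. \<Sum>b\<in>Poly_Mapping.keys v. sc (Poly_Mapping.lookup v b) (F (fst b)))"
  have f_add: "f0 (u + v) = f0 u + f0 v" for u v :: fock
    unfolding f0_def by (rule ext_add[OF vs])
  have f_scl: "f0 (scl a v) = sc a (f0 v)" for a and v :: fock
    unfolding f0_def by (rule ext_scl[OF vs])
  have f_single: "f0 (Poly_Mapping.single (M, \<epsilon>) x) = sc x (F M)" for M \<epsilon> x
    unfolding f0_def by (subst ext_single[OF vs]) simp
  have f_gen: "f0 (heis (gen_vec g) n (Poly_Mapping.single (M, \<gamma>) x)) =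
      H (gen_vec g) n (f0 (Poly_Mapping.single (M, \<gamma>) x))" for g n M x
  proof -
    consider "n < 0" | "n = 0" | "n > 0" by linarith
    then show ?thesis
    proof cases
      case 1
      then show ?thesis by (simp add: heis_gen_single f_single F_add H_sc)
    next
      case 2
      then show ?thesis by (simp add: heis_gen_single f_single F_0 H_sc)
    next
      case 3
      then obtain k where "n = int k + 1" by (metis add.commute zle_iff_zadd zless_imp_add1_zle add_0)
      then show ?thesis by (simp add: heis_gen_single f_single F_pos H_sc mult_ac nat_add_distrib)
    qed
  qed
  have "f0 (heis \<delta> n v) = H \<delta> n (f0 v)" if "v \<in> Fock_module \<gamma>" for \<delta> n v
  proof (rule Fock_module_additive_eqI[OF that])
    fix M x
    show "f0 (heis \<delta> n (Poly_Mapping.single (M, \<gamma>) x)) = H \<delta> n (f0 (Poly_Mapping.single (M, \<gamma>) x))"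
      unfolding heis_eq_gen[of \<delta>] H_gen[of \<delta>] f_add f_scl f_gen ..
  qed (simp_all add: heis_add f_add H_add)
  moreover have "f0 (fexp \<gamma>) = w"
    by (simp add: fexp_def f_single F_def)
  ultimately show "\<exists>f. morphism f"
    unfolding morphism_def by (intro exI[of _ f0]) (simp add: f_add f_scl)
  assume f: "morphism f" and g: "morphism g" and v: "v \<in> Fock_module \<gamma>"
  have mem: "Poly_Mapping.single (M, \<gamma>) x \<in> Fock_module \<gamma>" for M x
    by (simp add: Fock_module_def)
  have "f (Poly_Mapping.single (M, \<gamma>) x) = g (Poly_Mapping.single (M, \<gamma>) x)" for M x
  proof (induction M)
    case empty
    have "Poly_Mapping.single ({#}, \<gamma>) x = scl x (fexp \<gamma>)" by (simp add: fexp_def)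
    moreover have "fexp \<gamma> \<in> Fock_module \<gamma>" by (simp add: fexp_def mem)
    ultimately show ?case using f g by (simp add: morphism_def)
  next
    case (add y M)
    obtain h k where y: "y = (h, k)" by (cases y)
    have "Poly_Mapping.single (add_mset y M, \<gamma>) x =
        heis (gen_vec h) (- int k - 1) (Poly_Mapping.single (M, \<gamma>) x)"
      by (simp add: heis_gen_single y nat_add_distrib)
    moreover have "f (heis \<delta> n v) = H \<delta> n (f v)" "g (heis \<delta> n v) = H \<delta> n (g v)"
      if "v \<in> Fock_module \<gamma>" for \<delta> n v
      using f g that unfolding morphism_def by blast+
    ultimately show ?case using add mem by metis
  qed
  moreover have "f (u + v) = f u + f v" "g (u + v) = g u + g v"
    if "u \<in> Fock_module \<gamma>" "v \<in> Fock_module \<gamma>" for u v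
    using f g that unfolding morphism_def by blast+
  ultimately show "f v = g v"
    by (rule Fock_module_additive_eqI[OF v, rotated 2])
qed


section \<open>Vertex operators of the Heisenberg vertex algebra\<close>

text \<open>\<open>nop xs m\<close> is the coefficient of $z^{-m-1}$ in the normally ordered product of the fields
  $\partial^{(k)} g(z)$, \<open>(g, k)\<close> in \<open>xs\<close>, where $\partial^{(k)} = \partial^k/k!$ and
  $g(z) = \sum_n g(n) z^{-n-1}$. It uses
  $:a(z) b(z): = a(z)_- b(z) + b(z) a(z)_+$ with
  $(\partial^{(k)} g(z))_- = \sum_{j \ge 0} \binom{j}{k} g(-j-1) z^{j-k}$ and
  $(\partial^{(k)} g(z))_+ = \sum_{j \ge 0} \binom{-j-1}{k} g(j) z^{-j-1-k}$.
  On any given vector only finitely many summands are nonzero.\<close>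

fun nop :: "(heis_gen \<times> nat) list \<Rightarrow> int \<Rightarrow> fock \<Rightarrow> fock" where
  "nop [] m v = (if m = -1 then v else 0)"
| "nop ((g, k) # xs) m v =
     Sum_any (\<lambda>j::nat. scl (of_nat (j choose k))
       (heis (gen_vec g) (- int j - 1) (nop xs (m + int j - int k) v)))
   + Sum_any (\<lambda>j::nat. scl ((- of_nat j - 1) gchoose k)
       (nop xs (m - int j - 1 - int k) (heis (gen_vec g) (int j) v)))"

text \<open>\<open>vop u m\<close> is the coefficient $u_{(m)}$ of $z^{-m-1}$ in $Y(u,z)$, for $u \in M(1)$.
  Normally ordered products of Heisenberg fields do not depend on the order of the factors,
  so the choice of an enumeration of the multiset is immaterial.\<close>

definition vop :: "fock \<Rightarrow> int \<Rightarrow> fock \<Rightarrow> fock" where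
  "vop u m v = (\<Sum>b\<in>Poly_Mapping.keys u.
     scl (Poly_Mapping.lookup u b) (nop (SOME xs. mset xs = fst b) m v))"

inductive_set vertex_subalgebra :: "fock set \<Rightarrow> fock set" for S :: "fock set" where
  "fexp (0, 0) \<in> vertex_subalgebra S"
| "u \<in> S \<Longrightarrow> u \<in> vertex_subalgebra S"
| "u \<in> vertex_subalgebra S \<Longrightarrow> w \<in> vertex_subalgebra S \<Longrightarrow> u + w \<in> vertex_subalgebra S"
| "u \<in> vertex_subalgebra S \<Longrightarrow> scl a u \<in> vertex_subalgebra S"
| "u \<in> vertex_subalgebra S \<Longrightarrow> w \<in> vertex_subalgebra S \<Longrightarrow> vop u m w \<in> vertex_subalgebra S"


section \<open>The free field realization\<close>

definition lam :: "complex \<Rightarrow> complex \<Rightarrow> complex" where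
  "lam cL cLI = (2 - cL) / (24 * cLI) + cLI / 2"

definition mu :: "complex \<Rightarrow> complex \<Rightarrow> complex" where
  "mu cL cLI = (2 - cL) / (24 * cLI) - cLI / 2"

definition I_vec :: fock where
  "I_vec = heis (1, 0) (-1) (fexp (0, 0)) + heis (0, 1) (-1) (fexp (0, 0))"

definition omega_vec :: "complex \<Rightarrow> complex \<Rightarrow> fock" where
  "omega_vec cL cLI =
     scl (1/2) (heis (1, 0) (-1) (heis (1, 0) (-1) (fexp (0, 0))))
     - scl (1/2) (heis (0, 1) (-1) (heis (0, 1) (-1) (fexp (0, 0))))
     + scl (lam cL cLI) (heis (1, 0) (-2) (fexp (0, 0)))
     + scl (mu cL cLI) (heis (0, 1) (-2) (fexp (0, 0)))"

fun hv_act :: "complex \<Rightarrow> complex \<Rightarrow> hv_gen \<Rightarrow> fock \<Rightarrow> fock" where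
  "hv_act cL cLI (L_gen n) v = vop (omega_vec cL cLI) (n + 1) v"
| "hv_act cL cLI (I_gen n) v = vop I_vec n v"
| "hv_act cL cLI CL v = scl cL v"
| "hv_act cL cLI CLI v = scl cLI v"
| "hv_act cL cLI CI v = 0"

text \<open>The vertex algebra $L^{\mathcal H}(c_L, c_{L,I})$, as a vertex subalgebra of $M(1)$.\<close>

definition LH_alg :: "complex \<Rightarrow> complex \<Rightarrow> fock set" where
  "LH_alg cL cLI = vertex_subalgebra {I_vec, omega_vec cL cLI}"

definition LH_submodule :: "complex \<Rightarrow> complex \<Rightarrow> fock set \<Rightarrow> fock set \<Rightarrow> bool" where
  "LH_submodule cL cLI V N \<longleftrightarrow> N \<subseteq> V \<and> module.subspace scl N
     \<and> (\<forall>u\<in>LH_alg cL cLI. \<forall>m. \<forall>v\<in>N. vop u m v \<in> N)"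

definition LH_generated :: "complex \<Rightarrow> complex \<Rightarrow> fock set \<Rightarrow> fock set \<Rightarrow> fock set" where
  "LH_generated cL cLI V S = \<Inter>{N. LH_submodule cL cLI V N \<and> S \<subseteq> N}"

definition Delta :: "complex \<Rightarrow> complex \<Rightarrow> complex \<Rightarrow> complex \<Rightarrow> complex" where
  "Delta cL cLI r s = r\<^sup>2 / 2 - s\<^sup>2 / 2 - lam cL cLI * r + mu cL cLI * s"

abbreviation Frs :: "complex \<Rightarrow> complex \<Rightarrow> fock set" where
  "Frs r s \<equiv> Fock_module (r, s)"


section \<open>The screening operator\<close>

text \<open>Operator-valued formal power series \<open>A\<close>: \<open>A n\<close> is the coefficient of the \<open>n\<close>-th power
  of the variable ($z$ or $z^{-1}$).\<close>

type_synonym opseries = "nat \<Rightarrow> fock \<Rightarrow> fock"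

definition ops_mult :: "opseries \<Rightarrow> opseries \<Rightarrow> opseries" where
  "ops_mult A B n v = (\<Sum>k\<le>n. A k (B (n - k) v))"

fun ops_power :: "opseries \<Rightarrow> nat \<Rightarrow> opseries" where
  "ops_power A 0 = (\<lambda>n v. if n = 0 then v else 0)"
| "ops_power A (Suc m) = ops_mult A (ops_power A m)"

text \<open>The exponential of a series \<open>A\<close> with zero constant term, for which \<open>A\<^sup>m\<close> contributes to
  the \<open>n\<close>-th coefficient only if \<open>m \<le> n\<close>.\<close>

definition ops_exp :: "opseries \<Rightarrow> opseries" where
  "ops_exp A n v = (\<Sum>m\<le>n. scl (1 / fact m) (ops_power A m n v))"

definition phi :: "complex \<Rightarrow> cartan" where
  "phi cLI = (- 1 / cLI, - 1 / cLI)"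

definition creation_series :: "cartan \<Rightarrow> opseries" where
  "creation_series \<phi> n v = (if n = 0 then 0 else scl (1 / of_nat n) (heis \<phi> (- int n) v))"

definition annihilation_series :: "cartan \<Rightarrow> opseries" where
  "annihilation_series \<phi> n v = (if n = 0 then 0 else scl (- (1 / of_nat n)) (heis \<phi> (int n) v))"

definition exp_shift :: "cartan \<Rightarrow> fock \<Rightarrow> fock" where
  "exp_shift \<phi> = lin_ext (\<lambda>(M, \<gamma>). Poly_Mapping.single (M, \<gamma> + \<phi>) 1)"

text \<open>The coefficient of $z^m$ in $z^{\phi(0)}$, \<open>m\<close> an integer. Summands $M(1,\gamma)$ with
  non-integral $\langle\phi,\gamma\rangle$, where the screening operator is not defined,
  are sent to 0.\<close>

definition z_phi0 :: "cartan \<Rightarrow> int \<Rightarrow> fock \<Rightarrow> fock" where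
  "z_phi0 \<phi> m = lin_ext (\<lambda>(M, \<gamma>).
     if hform \<phi> \<gamma> = of_int m then Poly_Mapping.single (M, \<gamma>) 1 else 0)"

text \<open>The residue collects the terms $z^i z^{-j} z^m$ with $i - j + m = -1$; only finitely many
  are nonzero on a given vector.\<close>

definition screening :: "complex \<Rightarrow> fock \<Rightarrow> fock" where
  "screening cLI v = Sum_any (\<lambda>(i, j).
     ops_exp (creation_series (phi cLI)) i
       (ops_exp (annihilation_series (phi cLI)) j
         (exp_shift (phi cLI) (z_phi0 (phi cLI) (int j - int i - 1) v))))"

end

theory Submission
  imports Defs
begin

text \<open>Put $c = \alpha + \beta$ and $d = \alpha - \beta$, so that
  $\langle c, c\rangle = \langle d, d\rangle = 0$ and $\langle c, d\rangle = 2$; the fields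
  \<open>I(z)\<close> and $Y(e^\phi, z)$ involve only \<open>c\<close>. On a Fock module with
  $\langle\phi,\gamma\rangle = p - 1$ every term of \<open>Q\<close> contains some \<open>c(k)\<close> with \<open>k > 0\<close>,
  so \<open>Q\<close> lowers the degree in the variables \<open>d(-n)\<close>, and modulo lower degree
  \<open>[Q, d(-p)]\<close> is $2/c_{L,I}$ times the shift $e^\gamma \mapsto e^{\gamma+\phi}$. Hence
  $Q^n d(-p)^n e^\gamma = n!\,(2/c_{L,I})^n e^{\gamma + n\phi}$, which yields the vectors
  $v_{n,p}$; they are cosingular with respect to the submodule $\ker Q^n$ because \<open>Q\<close>
  commutes with $\mathcal H$.

  In highest degree \<open>L(-n)\<close> acts as $\frac12 c_{L,I}(n - p)\, d(-n)$ plus products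
  \<open>c(-k) d(k-n)\<close>. So modulo lower degree every vector is a combination of vectors
  $d(-p)^j g_j$ with $g_j \in U(\mathcal H) e^\gamma$, and applying powers of \<open>Q\<close> to an element
  of $\ker Q$ removes the terms with \<open>j > 0\<close>: $\ker Q$ is generated by $e^\gamma$. It is
  irreducible because the \<open>c(n)\<close>, \<open>n > 0\<close>, differentiate a nonzero vector to a nonzero
  polynomial in the \<open>c(-n)\<close>, and on polynomials in \<open>c(-1), ..., c(-n)\<close> the operator \<open>L(n)\<close> is
  a nonzero multiple of the derivation \<open>d(n)\<close>. Finally, induction along the chain of the
  $\ker Q^n$, which exhausts the Fock module, shows that it is generated by $e^\gamma$ and the
  $v_{n,p}$.\<close>

section \<open>Linear operators and weights on Fock space\<close>

text \<open>The factor \<open>n - p\<close> is what the hypothesis on h_I produces: among the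
  negative Virasoro modes exactly L(-p) loses its linear term, so d(-p) is the one creation mode
  that H does not supply, and Q detects it. For positive modes the matching factor is
  \<open>n + p\<close>, which never vanishes; hence every nonzero submodule reaches the vacuum.

  Q commutes with H because \<open>lam - mu = c_{L,I}\<close> gives e^\<phi> conformal weight 1,
  while \<open>\<langle>\<phi>,\<phi>\<rangle> = 0\<close> removes the quadratic corrections. Q
  alone is not closed under commutators with Heisenberg modes, since bracketing with \<delta>(k)
  moves the mode index by k; therefore it is studied inside the family \<open>vtx \<phi> q\<close>
  of all modes.

  Operator identities are reduced to the vacuum: the defect of an identity commutes with the
  Heisenberg modes, perhaps up to defects at other indices, so its value at e^\<gamma> is killed by
  the positive modes and is a multiple of a vacuum vector. It vanishes by weight except in a
  diagonal case, which is computed.\<close>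

abbreviation lin :: "(fock \<Rightarrow> fock) \<Rightarrow> bool" where
  "lin \<equiv> module_hom scl scl"

lemma linI:
  assumes "\<And>u v. f (u + v) = f u + f v" "\<And>a v. f (scl a v) = scl a (f v)"
  shows "lin f"
  by unfold_locales (use assms in auto)

lemmas lin_add = module_hom.add[of scl scl]
  and lin_scl = module_hom.scale[of scl scl]
  and lin_zero = module_hom.zero[of scl scl]
  and lin_diff = module_hom.diff[of scl scl]
  and lin_minus = module_hom.neg[of scl scl]
  and lin_sum = module_hom.sum[of scl scl]

lemma lin_comp:
  assumes "lin f" "lin g"
  shows "lin (\<lambda>v. f (g v))"
  by (rule linI) (simp_all add: assms[THEN lin_add] assms[THEN lin_scl])

lemma lin_plus:
  assumes "lin f" "lin g"
  shows "lin (\<lambda>v. f v + g v)"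
  by (rule linI)
     (simp_all add: assms[THEN lin_add] assms[THEN lin_scl] fock.scale_right_distrib)

lemma lin_minus_fun:
  assumes "lin f" "lin g"
  shows "lin (\<lambda>v. f v - g v)"
  by (rule linI)
     (simp_all add: assms[THEN lin_add] assms[THEN lin_scl] fock.scale_right_diff_distrib)

lemma lin_scl_fun:
  assumes "lin f"
  shows "lin (\<lambda>v. scl a (f v))"
  by (rule linI)
     (simp_all add: lin_add[OF assms] lin_scl[OF assms] fock.scale_right_distrib mult.commute)

lemma lin_sum_fun:
  assumes "\<And>i. i \<in> A \<Longrightarrow> lin (f i)"
  shows "lin (\<lambda>v. \<Sum>i\<in>A. f i v)"
  by (rule linI)
     (simp_all add: lin_add[OF assms] lin_scl[OF assms] fock.scale_sum_right sum.distrib)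

lemma lin_const_zero: "lin (\<lambda>v. 0)"
  by (rule linI) simp_all

lemma lin_id: "lin (\<lambda>v. v)"
  by (rule linI) simp_all

lemma lin_heis: "lin (heis \<delta> n)"
  by (rule linI) (simp_all add: heis_add heis_scl)

lemma lin_lin_ext: "lin (lin_ext f)"
  by (rule linI) simp_all

lemma lin_funpow: "lin f \<Longrightarrow> lin (f ^^ n)"
proof (induction n)
  case 0 show ?case by (rule linI) simp_all
next
  case (Suc n)
  note f = Suc.prems Suc.IH[OF Suc.prems]
  show ?case by (rule linI) (simp_all add: f[THEN lin_add] f[THEN lin_scl])
qed

lemmas lin_intros = lin_plus lin_minus_fun lin_scl_fun lin_sum_fun lin_const_zero lin_id lin_heis lin_lin_ext

lemma fock_expand: "v = (\<Sum>b\<in>Poly_Mapping.keys v. Poly_Mapping.single b (Poly_Mapping.lookup v b))"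
  for v :: fock
  by (rule poly_mapping_eqI) (simp add: lookup_sum lookup_single when_def in_keys_iff)

lemma lin_mem_subspaceI:
  assumes "lin f" "fock.subspace U"
    and "\<And>b x. b \<in> Poly_Mapping.keys v \<Longrightarrow> f (Poly_Mapping.single b x) \<in> U"
  shows "f v \<in> U"
proof -
  have "f v = (\<Sum>b\<in>Poly_Mapping.keys v. f (Poly_Mapping.single b (Poly_Mapping.lookup v b)))"
    by (subst fock_expand) (rule lin_sum[OF assms(1)])
  also have "\<dots> \<in> U"
    by (rule fock.subspace_sum[OF assms(2)]) (rule assms(3))
  finally show ?thesis .
qed

lemma heis_linear: "heis (\<delta> + \<delta>') n v = heis \<delta> n v + heis \<delta>' n v"
  and heis_linear_diff: "heis (\<delta> - \<delta>') n v = heis \<delta> n v - heis \<delta>' n v"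
  by (subst (1 2 3) heis_eq_gen, simp add: fock.scale_left_distrib fock.scale_left_diff_distrib algebra_simps)+

lemma heis_linear_scl: "heis (a * fst \<delta>, a * snd \<delta>) n v = scl a (heis \<delta> n v)"
  by (subst (1 2) heis_eq_gen) (simp add: fock.scale_right_distrib)

lemma heis_swap:
  "heis \<delta> m (heis \<delta>' n v) = heis \<delta>' n (heis \<delta> m v)
     + (if m + n = 0 then scl (of_int m * hform \<delta> \<delta>') v else 0)"
  using heis_comm[of \<delta> m \<delta>' n v] by (simp add: algebra_simps)

lemma heis_zero_mode:
  assumes "v \<in> Fock_module \<gamma>"
  shows "heis \<delta> 0 v = scl (hform \<delta> \<gamma>) v"
  by (rule Fock_module_additive_eqI[OF assms])
     (simp_all add: heis_add fock.scale_right_distrib, simp add: heis_def mult.commute)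

lemma fexp_in_Fock: "fexp \<gamma> \<in> Fock_module \<gamma>"
  by (simp add: fexp_def Fock_module_def)

lemma fexp_nonzero: "fexp \<gamma> \<noteq> 0"
  unfolding fexp_def by (metis lookup_single_eq lookup_zero one_neq_zero)

lemma Fock_add: "u \<in> Fock_module \<gamma> \<Longrightarrow> v \<in> Fock_module \<gamma> \<Longrightarrow> u + v \<in> Fock_module \<gamma>"
  and Fock_diff: "u \<in> Fock_module \<gamma> \<Longrightarrow> v \<in> Fock_module \<gamma> \<Longrightarrow> u - v \<in> Fock_module \<gamma>"
  and Fock_scl: "v \<in> Fock_module \<gamma> \<Longrightarrow> scl a v \<in> Fock_module \<gamma>"
  and Fock_zero: "0 \<in> Fock_module \<gamma>"
  and Fock_sum: "(\<And>i. i \<in> A \<Longrightarrow> f i \<in> Fock_module \<gamma>) \<Longrightarrow> (\<Sum>i\<in>A. f i) \<in> Fock_module \<gamma>"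
  by (simp_all add: fock.subspace_add fock.subspace_diff fock.subspace_scale fock.subspace_0
      fock.subspace_sum Fock_module_subspace)

lemmas Fock_intros = Fock_add Fock_diff Fock_scl Fock_zero Fock_sum heis_Fock_module fexp_in_Fock

text \<open>Monomials arise from e^\<gamma> by creation modes, so a linear identity that is stable
  under these modes only has to be checked on e^\<gamma>. The defect arguments for the Virasoro
  relations and for the screening operator are closed by this rule.\<close>

lemma Fock_module_induct [consumes 1, case_names vac add scl heis]:
  assumes v: "v \<in> Fock_module \<gamma>"
    and vac: "P (fexp \<gamma>)"
    and add: "\<And>u v. u \<in> Fock_module \<gamma> \<Longrightarrow> v \<in> Fock_module \<gamma> \<Longrightarrow> P u \<Longrightarrow> P v \<Longrightarrow> P (u + v)"
    and scl: "\<And>a v. v \<in> Fock_module \<gamma> \<Longrightarrow> P v \<Longrightarrow> P (scl a v)"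
    and heis: "\<And>\<delta> n v. n > 0 \<Longrightarrow> v \<in> Fock_module \<gamma> \<Longrightarrow> P v \<Longrightarrow> P (heis \<delta> (- int n) v)"
  shows "P v"
proof -
  have mem: "Poly_Mapping.single (M, \<gamma>) x \<in> Fock_module \<gamma>" for M x
    by (simp add: Fock_module_def)
  have s: "P (Poly_Mapping.single (M, \<gamma>) x)" for M x
  proof (induction M)
    case empty
    have "Poly_Mapping.single ({#}, \<gamma>) x = scl x (fexp \<gamma>)" by (simp add: fexp_def)
    then show ?case using scl[OF fexp_in_Fock vac] by metis
  next
    case (add y M)
    obtain h k where y: "y = (h, k)" by (cases y)
    have "Poly_Mapping.single (add_mset y M, \<gamma>) x =
        heis (gen_vec h) (- int (Suc k)) (Poly_Mapping.single (M, \<gamma>) x)"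
      by (simp add: heis_gen_single y nat_add_distrib)
    moreover have "P (heis (gen_vec h) (- int (Suc k)) (Poly_Mapping.single (M, \<gamma>) x))"
      by (rule heis[OF _ mem add.IH]) simp
    ultimately show ?case by simp
  qed
  have P0: "P 0" using scl[OF fexp_in_Fock vac, of 0] by simp
  have "P (\<Sum>b\<in>A. Poly_Mapping.single b (Poly_Mapping.lookup v b))
      \<and> (\<Sum>b\<in>A. Poly_Mapping.single b (Poly_Mapping.lookup v b)) \<in> Fock_module \<gamma>"
    if "finite A" "A \<subseteq> Poly_Mapping.keys v" for A
    using that
  proof (induction A rule: finite_induct)
    case empty
    then show ?case using P0 by (simp add: Fock_zero)
  next
    case (insert b A)
    have "b = (fst b, \<gamma>)"
      using insert.prems v by (auto simp: Fock_module_def prod_eq_iff)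
    then have "P (Poly_Mapping.single b x)" "Poly_Mapping.single b x \<in> Fock_module \<gamma>" for x
      using s mem by metis+
    then show ?case using insert by (simp add: add Fock_add)
  qed
  from this[of "Poly_Mapping.keys v"] show ?thesis by (simp flip: fock_expand)
qed

text \<open>In the variable that represents \<open>(g, k)\<close> the positive mode is a multiple of
  the partial derivative; reading off the coefficient of M therefore looks at the monomial with one
  more such factor, whence \<open>count M (g, k) + 1\<close>.\<close>

lemma lookup_heis_gen_pos:
  "Poly_Mapping.lookup (heis (gen_vec g) (int k + 1) v) (M, \<gamma>) =
     (of_nat k + 1) * hform (gen_vec g) (gen_vec g) * (of_nat (count M (g, k)) + 1)
       * Poly_Mapping.lookup v (add_mset (g, k) M, \<gamma>)"
proof (rule fock_additive_eqI[where v = v])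
  fix N \<delta> x
  have "N - {#(g, k)#} = M \<longleftrightarrow> N = add_mset (g, k) M" if "(g, k) \<in># N"
    using that by auto
  then show "Poly_Mapping.lookup (heis (gen_vec g) (int k + 1) (Poly_Mapping.single (N, \<delta>) x)) (M, \<gamma>) =
      (of_nat k + 1) * hform (gen_vec g) (gen_vec g) * (of_nat (count M (g, k)) + 1)
       * Poly_Mapping.lookup (Poly_Mapping.single (N, \<delta>) x) (add_mset (g, k) M, \<gamma>)"
    by (cases "(g, k) \<in># N")
       (auto simp: heis_gen_single lookup_single when_def nat_add_distrib not_in_iff algebra_simps)
qed (simp_all add: heis_add lookup_add algebra_simps)

lemma hform_gen_self: "hform (gen_vec g) (gen_vec g) \<noteq> 0"
  by (cases g) (simp_all add: hform_def)

text \<open>All partial derivatives of the polynomial v vanish, so in characteristic zero only its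
  constant term survives.\<close>

lemma Fock_vacuum:
  assumes v: "v \<in> Fock_module \<gamma>" and kill: "\<And>\<delta> n. n > 0 \<Longrightarrow> heis \<delta> n v = 0"
  shows "v = scl (Poly_Mapping.lookup v ({#}, \<gamma>)) (fexp \<gamma>)"
proof (rule poly_mapping_eqI)
  fix b :: "(heis_gen \<times> nat) multiset \<times> cartan"
  obtain M \<delta> where b: "b = (M, \<delta>)" by (cases b)
  show "Poly_Mapping.lookup v b = Poly_Mapping.lookup (scl (Poly_Mapping.lookup v ({#}, \<gamma>)) (fexp \<gamma>)) b"
  proof (cases "\<delta> = \<gamma> \<and> M \<noteq> {#}")
    case True
    then obtain g k N where M: "M = add_mset (g, k) N" by (metis multiset_cases surj_pair)
    have "Poly_Mapping.lookup (heis (gen_vec g) (int k + 1) v) (N, \<gamma>) = 0"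
      by (simp add: kill)
    then have "(of_nat k + 1 :: complex) * (of_nat (count N (g, k)) + 1) * Poly_Mapping.lookup v b = 0"
      using hform_gen_self True unfolding lookup_heis_gen_pos b M by simp
    then have "of_nat (Suc k * Suc (count N (g, k))) * Poly_Mapping.lookup v b = 0"
      by (simp add: algebra_simps)
    then have "Poly_Mapping.lookup v b = 0"
      by (simp only: mult_eq_0_iff of_nat_eq_0_iff) simp
    then show ?thesis using True b by (simp add: fexp_def lookup_single when_def)
  next
    case False
    have "Poly_Mapping.lookup v (N, \<delta>) = 0" if "\<delta> \<noteq> \<gamma>" for N
      using v that in_keys_iff[of "(N, \<delta>)" v] by (force simp: Fock_module_def)
    with False show ?thesis
      unfolding b by (cases "\<delta> = \<gamma>") (auto simp: fexp_def lookup_single when_def)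
  qed
qed

section \<open>The weight grading\<close>

definition wt :: "(heis_gen \<times> nat) multiset \<Rightarrow> int" where
  "wt M = (\<Sum>x\<in>#M. int (snd x) + 1)"

text \<open>The index $\gamma$ of the Fock module is ignored by this grading.\<close>

definition wts :: "int set \<Rightarrow> fock set" where
  "wts W = {v. \<forall>b\<in>Poly_Mapping.keys v. wt (fst b) \<in> W}"

lemma wt_simps [simp]: "wt {#} = 0" "wt (add_mset (g, k) M) = wt M + int k + 1"
  by (simp_all add: wt_def)

lemma wt_nonneg: "wt M \<ge> 0"
  unfolding wt_def by (induction M) auto

lemma wts_subspace: "fock.subspace (wts W)"
  unfolding fock.subspace_def wts_def
  by (auto dest!: keys_add[THEN subsetD] keys_scl[THEN subsetD])

lemma wts_add: "u \<in> wts W \<Longrightarrow> v \<in> wts W \<Longrightarrow> u + v \<in> wts W"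
  and wts_diff: "u \<in> wts W \<Longrightarrow> v \<in> wts W \<Longrightarrow> u - v \<in> wts W"
  and wts_scl: "v \<in> wts W \<Longrightarrow> scl a v \<in> wts W"
  and wts_zero: "0 \<in> wts W"
  and wts_sum: "(\<And>i. i \<in> A \<Longrightarrow> f i \<in> wts W) \<Longrightarrow> (\<Sum>i\<in>A. f i) \<in> wts W"
  by (simp_all add: fock.subspace_add fock.subspace_diff fock.subspace_scale fock.subspace_0
      fock.subspace_sum wts_subspace)

lemma wts_mono: "v \<in> wts W \<Longrightarrow> W \<subseteq> W' \<Longrightarrow> v \<in> wts W'"
  by (auto simp: wts_def)

lemma wts_neg: "v \<in> wts W \<Longrightarrow> W \<subseteq> {..<0} \<Longrightarrow> v = 0"
proof -
  assume "v \<in> wts W" "W \<subseteq> {..<0}"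
  then have "b \<notin> Poly_Mapping.keys v" for b
    using wt_nonneg[of "fst b"] by (auto simp: wts_def subset_iff not_less)
  then have "Poly_Mapping.keys v = {}" by blast
  then show ?thesis by simp
qed

lemma lookup_wts: "v \<in> wts W \<Longrightarrow> wt M \<notin> W \<Longrightarrow> Poly_Mapping.lookup v (M, \<gamma>) = 0"
  using in_keys_iff[of "(M, \<gamma>)" v] by (force simp: wts_def)

lemma fexp_wts: "fexp \<gamma> \<in> wts {0}"
  by (simp add: wts_def fexp_def)

text \<open>With weight sets instead of single weights, one rule covers homogeneous vectors, bounded
  vectors (\<open>{..N}\<close>) and vanishing: weights are nonnegative, so \<open>wts_neg\<close>
  applies as soon as the shifted set contains only negative integers.\<close>

lemma heis_wts:
  assumes "v \<in> wts W"
  shows "heis \<delta> n v \<in> wts {w. w + n \<in> W}"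
proof -
  have "heis (gen_vec g) n v \<in> wts {w. w + n \<in> W}" for g
  proof (rule lin_mem_subspaceI[OF lin_heis wts_subspace])
    fix b x assume "b \<in> Poly_Mapping.keys v"
    then have "wt (fst b) \<in> W" using assms by (simp add: wts_def)
    moreover obtain M \<gamma> where b: "b = (M, \<gamma>)" by (cases b)
    moreover have "wt (M - {#(g, k)#}) = wt M - int k - 1" if "(g, k) \<in># M" for k
      using that wt_simps(2)[of g k "M - {#(g, k)#}"] by simp
    ultimately show "heis (gen_vec g) n (Poly_Mapping.single b x) \<in> wts {w. w + n \<in> W}"
      by (cases "(g, nat n - 1) \<in># M")
         (auto simp: heis_gen_single wts_def not_in_iff add.commute)
  qed
  then show ?thesis
    by (subst heis_eq_gen) (intro wts_add wts_scl)
qed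

lemma wts_bounded: "\<exists>N. v \<in> wts {..N}"
proof (cases "v = 0")
  case False
  then show ?thesis
    by (intro exI[of _ "Max ((\<lambda>b. wt (fst b)) ` Poly_Mapping.keys v)"]) (simp add: wts_def)
qed (auto simp: wts_zero)

lemma heis_vanish: "v \<in> wts {..N} \<Longrightarrow> n > N \<Longrightarrow> heis \<delta> n v = 0"
  by (rule wts_neg[OF heis_wts]) auto

section \<open>Virasoro operators\<close>

lemma Sum_any_single_support:
  assumes "\<And>j. j \<noteq> i \<Longrightarrow> f j = 0"
  shows "Sum_any f = f i"
  by (subst Sum_any.expand_superset[of "{i}"]) (use assms in auto)

lemma nop_field: "nop [(g, 0)] m v = heis (gen_vec g) m v"
proof (cases "m < 0")
  case True
  have "Sum_any (\<lambda>j::nat. scl (of_nat (j choose 0))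
       (heis (gen_vec g) (- int j - 1) (nop [] (m + int j - int 0) v))) = heis (gen_vec g) m v"
    by (subst Sum_any_single_support[of "nat (- m - 1)"]) (use True in auto)
  moreover have "Sum_any (\<lambda>j::nat. scl ((- of_nat j - 1) gchoose 0)
       (nop [] (m - int j - 1 - int 0) (heis (gen_vec g) (int j) v))) = 0"
    using True by (subst Sum_any_single_support[of 0]) auto
  ultimately show ?thesis unfolding nop.simps by simp
next
  case False
  have "Sum_any (\<lambda>j::nat. scl (of_nat (j choose 0))
       (heis (gen_vec g) (- int j - 1) (nop [] (m + int j - int 0) v))) = 0"
    using False by (subst Sum_any_single_support[of 0]) auto
  moreover have "Sum_any (\<lambda>j::nat. scl ((- of_nat j - 1) gchoose 0)
       (nop [] (m - int j - 1 - int 0) (heis (gen_vec g) (int j) v))) = heis (gen_vec g) m v"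
    by (subst Sum_any_single_support[of "nat m"]) (use False in auto)
  ultimately show ?thesis unfolding nop.simps by simp
qed

lemma nop_deriv_field: "nop [(g, 1)] m v = scl (- of_int m) (heis (gen_vec g) (m - 1) v)"
proof (cases "m \<le> 0")
  case True
  have "Sum_any (\<lambda>j::nat. scl (of_nat (j choose 1))
       (heis (gen_vec g) (- int j - 1) (nop [] (m + int j - int 1) v)))
     = scl (- of_int m) (heis (gen_vec g) (m - 1) v)"
    by (subst Sum_any_single_support[of "nat (- m)"]) (use True in auto)
  moreover have "Sum_any (\<lambda>j::nat. scl ((- of_nat j - 1) gchoose 1)
       (nop [] (m - int j - 1 - int 1) (heis (gen_vec g) (int j) v))) = 0"
    using True by (subst Sum_any_single_support[of 0]) auto
  ultimately show ?thesis unfolding nop.simps by simp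
next
  case False
  have "Sum_any (\<lambda>j::nat. scl (of_nat (j choose 1))
       (heis (gen_vec g) (- int j - 1) (nop [] (m + int j - int 1) v))) = 0"
    using False by (subst Sum_any_single_support[of 0]) auto
  moreover have "Sum_any (\<lambda>j::nat. scl ((- of_nat j - 1) gchoose 1)
       (nop [] (m - int j - 1 - int 1) (heis (gen_vec g) (int j) v)))
     = scl (- of_int m) (heis (gen_vec g) (m - 1) v)"
    by (subst Sum_any_single_support[of "nat (m - 1)"]) (use False in auto)
  ultimately show ?thesis unfolding nop.simps by simp
qed

lemma nop_square: "nop [(g, 0), (g, 0)] m v =
     Sum_any (\<lambda>j::nat. heis (gen_vec g) (- int j - 1) (heis (gen_vec g) (m + int j) v))
   + Sum_any (\<lambda>j::nat. heis (gen_vec g) (m - int j - 1) (heis (gen_vec g) (int j) v))"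
  by (subst nop.simps(2)) (simp add: nop_field del: nop.simps)

lemma vop_add_left: "vop (u + w) m v = vop u m v + vop w m v"
  and vop_single: "vop (Poly_Mapping.single b x) m v = scl x (nop (SOME xs. mset xs = fst b) m v)"
  unfolding vop_def
  by (rule ext_add[OF vector_space_scl] ext_single[OF vector_space_scl])+

lemma vop_diff_left: "vop (u - w) m v = vop u m v - vop w m v"
  using vop_add_left[of "u - w" w m v] by simp

text \<open>\<open>I_vec\<close> and \<open>omega_vec\<close> contain only single modes and squares,
  whose enumeration is unique, so the choice made in \<open>vop\<close> is forced for them.\<close>

lemma some_mset_single: "(SOME xs. mset xs = {#a#}) = [a]"
  by (rule some_equality) auto

lemma some_mset_pair: "(SOME xs. mset xs = {#a, a#}) = [a, a]"
proof (rule some_equality)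
  fix xs assume "mset xs = {#a, a#}"
  then have "size (mset xs) = 2" "set_mset (mset xs) = {a}" by simp_all
  then have "length xs = 2" "set xs \<subseteq> {a}" by (simp_all only: size_mset set_mset_mset)
  then have "xs = replicate 2 a"
    by (metis replicate_length_same subset_singletonD singletonD empty_iff)
  then show "xs = [a, a]" by (simp add: numeral_2_eq_2)
qed simp

lemma heis_unit_gen: "heis (1, 0) = heis (gen_vec Alpha)" "heis (0, 1) = heis (gen_vec Beta)"
  by simp_all

lemma vop_I_vec: "vop I_vec n v = heis (1, 1) n v"
  unfolding I_vec_def heis_unit_gen fexp_def heis_gen_single
  by (simp add: vop_add_left vop_single some_mset_single nop_field del: nop.simps flip: heis_linear)

section \<open>Quadratic expressions and Virasoro modes\<close>

definition quad :: "int \<Rightarrow> int \<Rightarrow> fock \<Rightarrow> fock" where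
  "quad x y v = heis (1, 0) x (heis (1, 0) y v) - heis (0, 1) x (heis (0, 1) y v)"

lemma lin_quad: "lin (quad x y)"
  unfolding quad_def by (intro lin_minus_fun lin_comp[OF lin_heis lin_heis])

lemma quad_Fock: "v \<in> Fock_module \<gamma> \<Longrightarrow> quad x y v \<in> Fock_module \<gamma>"
  unfolding quad_def by (intro Fock_intros)

lemma quad_wts: "v \<in> wts W \<Longrightarrow> quad x y v \<in> wts {w. w + x + y \<in> W}"
  unfolding quad_def by (intro wts_diff) (drule heis_wts, drule heis_wts, simp)+

lemma quad_vanish: "v \<in> wts {..N} \<Longrightarrow> y > N \<Longrightarrow> quad x y v = 0"
  by (simp add: quad_def heis_vanish)

text \<open>\<open>quad\<close> contracts over a pair of dual bases, so it may be computed in any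
  basis; in the isotropic basis the dual of c is d/2.\<close>

lemma quad_light_dual: "quad x y v = scl (1/2) (heis (1, 1) x (heis (1, -1) y v) + heis (1, -1) x (heis (1, 1) y v))"
proof -
  have "heis (1, 1) n w = heis (1, 0) n w + heis (0, 1) n w"
    "heis (1, -1) n w = heis (1, 0) n w - heis (0, 1) n w" for n w
    by (simp_all flip: heis_linear heis_linear_diff)
  then show ?thesis
    unfolding quad_def
    by (intro poly_mapping_eqI, simp only: heis_add lin_diff[OF lin_heis] lookup_add lookup_minus lookup_scl)
       (simp add: algebra_simps)
qed

text \<open>Contracting dual bases against \<delta> returns \<delta>; hence whichever slot meets
  \<delta>(m) disappears, and \<delta> takes the place of the other one.\<close>

lemma quad_comm: "quad x y (heis \<delta> m v) = heis \<delta> m (quad x y v)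
   - (if x = - m then scl (of_int m) (heis \<delta> y v) else 0)
   - (if y = - m then scl (of_int m) (heis \<delta> x v) else 0)"
proof -
  have d: "heis \<delta> n v = scl (fst \<delta>) (heis (1, 0) n v) + scl (snd \<delta>) (heis (0, 1) n v)" for n
    using heis_eq_gen[of \<delta> n v] by simp
  have if_heis: "heis \<epsilon> k (if P then u else 0) = (if P then heis \<epsilon> k u else 0)" for \<epsilon> k P u
    by simp
  have x: "x + m = 0 \<longleftrightarrow> x = - m" and y: "y + m = 0 \<longleftrightarrow> y = - m" by auto
  have l: "Poly_Mapping.lookup (if P then u else 0) b = (if P then Poly_Mapping.lookup u b else 0)"
    for P and u :: fock and b by simp
  show ?thesis
    unfolding quad_def heis_swap[of _ y \<delta> m] heis_add heis_scl heis_swap[of _ x \<delta> m]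
      lin_diff[OF lin_heis] d[of x] d[of y] if_heis x y
    by (intro poly_mapping_eqI, simp only: lookup_add lookup_minus lookup_scl l)
       (auto simp: hform_def algebra_simps)
qed

text \<open>The two sums are the halves of the normal ordering, and \<open>- (n + 1)\<close> is the
  factor from differentiating the linear field. With \<rho> arbitrary it becomes visible that \<rho>
  enters the relations only through its pairings.\<close>

definition vir :: "cartan \<Rightarrow> int \<Rightarrow> fock \<Rightarrow> fock" where
  "vir \<rho> n v = scl (1/2) (Sum_any (\<lambda>j::nat. quad (- int j - 1) (n + 1 + int j) v)
       + Sum_any (\<lambda>j::nat. quad (n - int j) (int j) v))
     - scl (of_int n + 1) (heis \<rho> n v)"

lemma Sum_any_nat_bounded:
  assumes "\<And>j. j \<ge> K \<Longrightarrow> f j = 0"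
  shows "Sum_any f = (\<Sum>j<K. f (j::nat))"
  by (rule Sum_any.expand_superset) (use assms not_less in auto)

text \<open>K is any sufficiently large bound, so that several vectors in one identity can be
  truncated at a common place.\<close>

lemma vir_sum:
  assumes "v \<in> wts {..N}" "int K > N" "int K > N - n - 1"
  shows "vir \<rho> n v = scl (1/2) ((\<Sum>j<K. quad (- int j - 1) (n + 1 + int j) v)
       + (\<Sum>j<K. quad (n - int j) (int j) v)) - scl (of_int n + 1) (heis \<rho> n v)"
  unfolding vir_def
  by (subst (1 2) Sum_any_nat_bounded[of K]) (use assms in \<open>auto intro!: quad_vanish[OF assms(1)]\<close>)

lemma ex_nat_bound: "\<exists>K::nat. int K > a \<and> int K > b \<and> int K > c"
  by (rule exI[of _ "nat (max a (max b c)) + 1"]) auto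

lemma vop_omega: "vop (omega_vec cL cLI) (n + 1) v = vir (lam cL cLI, mu cL cLI) n v"
proof -
  obtain N where N: "v \<in> wts {..N}" using wts_bounded by blast
  obtain K where K: "int K > N" "int K > N - n - 1" using ex_nat_bound by blast
  have sq: "nop [(g, 0), (g, 0)] (n + 1) v =
     (\<Sum>j<K. heis (gen_vec g) (- int j - 1) (heis (gen_vec g) (n + 1 + int j) v))
   + (\<Sum>j<K. heis (gen_vec g) (n - int j) (heis (gen_vec g) (int j) v))" for g
    unfolding nop_square
    by (subst (1 2) Sum_any_nat_bounded[of K]) (use K in \<open>auto simp: heis_vanish[OF N]\<close>)
  have r: "heis (lam cL cLI, mu cL cLI) n v =
      scl (lam cL cLI) (heis (gen_vec Alpha) n v) + scl (mu cL cLI) (heis (gen_vec Beta) n v)"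
    by (subst heis_eq_gen) simp
  have "vop (omega_vec cL cLI) (n + 1) v =
      scl (1/2) (nop [(Alpha, 0), (Alpha, 0)] (n + 1) v) - scl (1/2) (nop [(Beta, 0), (Beta, 0)] (n + 1) v)
      + scl (lam cL cLI) (nop [(Alpha, 1)] (n + 1) v) + scl (mu cL cLI) (nop [(Beta, 1)] (n + 1) v)"
    unfolding omega_vec_def heis_unit_gen fexp_def heis_gen_single
    by (simp add: vop_add_left vop_diff_left vop_single some_mset_single some_mset_pair heis_gen_single
        del: nop.simps gen_vec.simps)
  also have "\<dots> = vir (lam cL cLI, mu cL cLI) n v"
    unfolding vir_sum[OF N K] r nop_deriv_field sq quad_def heis_unit_gen sum_subtractf
    by (intro poly_mapping_eqI, simp only: lookup_add lookup_minus lookup_scl)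
       (simp add: algebra_simps)
  finally show ?thesis .
qed

lemma lin_vir: "lin (vir \<rho> n)"
proof (rule linI)
  fix u v
  obtain N where N: "u \<in> wts {..N}" using wts_bounded by blast
  obtain N' where N': "v \<in> wts {..N'}" using wts_bounded by blast
  define M where "M = max N N'"
  have u: "u \<in> wts {..M}" and v: "v \<in> wts {..M}"
    by (auto simp: M_def intro: wts_mono[OF N] wts_mono[OF N'])
  obtain K where K: "int K > M" "int K > M - n - 1" using ex_nat_bound by blast
  show "vir \<rho> n (u + v) = vir \<rho> n u + vir \<rho> n v"
    unfolding vir_sum[OF u K] vir_sum[OF v K] vir_sum[OF wts_add[OF u v] K]
    by (simp add: lin_add[OF lin_quad] heis_add sum.distrib fock.scale_right_distrib)
next
  fix a v
  obtain N where v: "v \<in> wts {..N}" using wts_bounded by blast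
  obtain K where K: "int K > N" "int K > N - n - 1" using ex_nat_bound by blast
  show "vir \<rho> n (scl a v) = scl a (vir \<rho> n v)"
    unfolding vir_sum[OF v K] vir_sum[OF wts_scl[OF v] K]
    by (simp add: lin_scl[OF lin_quad] heis_scl fock.scale_sum_right fock.scale_right_distrib
        fock.scale_right_diff_distrib mult.commute)
qed

lemma vir_Fock:
  assumes "v \<in> Fock_module \<gamma>"
  shows "vir \<rho> n v \<in> Fock_module \<gamma>"
proof -
  obtain N where v: "v \<in> wts {..N}" using wts_bounded by blast
  obtain K where K: "int K > N" "int K > N - n - 1" using ex_nat_bound by blast
  show ?thesis
    unfolding vir_sum[OF v K] using assms by (intro Fock_intros quad_Fock)
qed

lemma vir_wts:
  assumes "v \<in> wts W"
  shows "vir \<rho> n v \<in> wts {w. w + n \<in> W}"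
proof -
  obtain N where v: "v \<in> wts {..N}" using wts_bounded by blast
  obtain K where K: "int K > N" "int K > N - n - 1" using ex_nat_bound by blast
  have "quad x y v \<in> wts {w. w + n \<in> W}" if "x + y = n" for x y
    using quad_wts[OF assms, of x y] that by (simp add: add.assoc)
  then show ?thesis
    unfolding vir_sum[OF v K] using assms by (intro wts_diff wts_scl wts_add wts_sum heis_wts) auto
qed

text \<open>Summed over all index pairs, the contraction in \<open>quad_comm\<close> happens twice,
  once in each slot, which cancels the factor 1/2. The scalar comes from the linear part of
  \<open>vir\<close> alone.\<close>

lemma vir_comm:
  "vir \<rho> n (heis \<delta> m v) = heis \<delta> m (vir \<rho> n v) - scl (of_int m) (heis \<delta> (n + m) v)
     - (if n = - m then scl (of_int (n ^ 2 + n) * hform \<rho> \<delta>) v else 0)"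
proof -
  obtain N where v: "v \<in> wts {..N}" using wts_bounded by blast
  have w: "heis \<delta> m v \<in> wts {..N - m}"
    by (rule wts_mono[OF heis_wts[OF v]]) auto
  define M where "M = N + \<bar>m\<bar>"
  obtain K where K: "int K > M" "int K > M - n - 1" "int K > \<bar>m\<bar> + \<bar>n\<bar>" using ex_nat_bound by blast
  have v: "v \<in> wts {..M}" and w: "heis \<delta> m v \<in> wts {..M}"
    by (auto simp: M_def intro: wts_mono[OF v] wts_mono[OF w])
  let ?h = "\<lambda>t x::int. if x = t then scl (of_int m) (heis \<delta> (n + m) v) else 0"
  \<comment> \<open>Together the indices \<open>- int j - 1\<close> and \<open>int j\<close> with
    \<open>j < K\<close> run once through the integers from -K to K - 1, so the contraction is found
    exactly once, wherever the normal ordering cuts the sum.\<close>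
  have count: "(\<Sum>j<K. ?h t (- int j - 1)) + (\<Sum>j<K. ?h t (int j)) = scl (of_int m) (heis \<delta> (n + m) v)"
    if "\<bar>t\<bar> < int K" for t
  proof (cases "t < 0")
    case True
    then have "(\<Sum>j<K. ?h t (- int j - 1)) = (\<Sum>j<K. if j = nat (- t - 1) then scl (of_int m) (heis \<delta> (n + m) v) else 0)"
      by (intro sum.cong) auto
    moreover have "(\<Sum>j<K. ?h t (int j)) = 0" using True by (intro sum.neutral) auto
    moreover have "nat (- t - 1) < K" using True that by linarith
    ultimately show ?thesis by simp
  next
    case False
    then have "(\<Sum>j<K. ?h t (int j)) = (\<Sum>j<K. if j = nat t then scl (of_int m) (heis \<delta> (n + m) v) else 0)"
      by (intro sum.cong) auto
    moreover have "(\<Sum>j<K. ?h t (- int j - 1)) = 0" using False by (intro sum.neutral) auto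
    moreover have "nat t < K" using False that by linarith
    ultimately show ?thesis by simp
  qed
  have q: "quad x y (heis \<delta> m v) = heis \<delta> m (quad x y v) - ?h (- m) x - ?h (n + m) x"
    "quad y x (heis \<delta> m v) = heis \<delta> m (quad y x v) - ?h (- m) x - ?h (n + m) x"
    if "x + y = n" for x y
  proof -
    have "y = n - x" using that by simp
    then show "quad x y (heis \<delta> m v) = heis \<delta> m (quad x y v) - ?h (- m) x - ?h (n + m) x"
      "quad y x (heis \<delta> m v) = heis \<delta> m (quad y x v) - ?h (- m) x - ?h (n + m) x"
      unfolding quad_comm by (auto simp: algebra_simps)
  qed
  have "(\<Sum>j<K. quad (- int j - 1) (n + 1 + int j) (heis \<delta> m v)) + (\<Sum>j<K. quad (n - int j) (int j) (heis \<delta> m v))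
     = (\<Sum>j<K. heis \<delta> m (quad (- int j - 1) (n + 1 + int j) v))
       + (\<Sum>j<K. heis \<delta> m (quad (n - int j) (int j) v))
       - ((\<Sum>j<K. ?h (- m) (- int j - 1)) + (\<Sum>j<K. ?h (- m) (int j)))
       - ((\<Sum>j<K. ?h (n + m) (- int j - 1)) + (\<Sum>j<K. ?h (n + m) (int j)))"
    by (subst q(1), simp, subst q(2), simp) (simp add: sum_subtractf sum.distrib algebra_simps)
  also have "\<dots> = heis \<delta> m ((\<Sum>j<K. quad (- int j - 1) (n + 1 + int j) v) + (\<Sum>j<K. quad (n - int j) (int j) v))
       - scl 2 (scl (of_int m) (heis \<delta> (n + m) v))"
    using K(3)
    by (subst (1 2) count, (auto)[2], intro poly_mapping_eqI,
        simp only: heis_add lin_sum[OF lin_heis] lookup_add lookup_minus lookup_scl lookup_sum)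
       (simp add: algebra_simps)
  finally have *: "(\<Sum>j<K. quad (- int j - 1) (n + 1 + int j) (heis \<delta> m v)) + (\<Sum>j<K. quad (n - int j) (int j) (heis \<delta> m v))
     = \<dots>" .
  have **: "n + m = 0 \<longleftrightarrow> n = - m" by auto
  show ?thesis
    unfolding vir_sum[OF v K(1,2)] vir_sum[OF w K(1,2)] heis_swap[of \<rho> n] * **
    by (cases "n = - m"; intro poly_mapping_eqI,
        simp only: if_True if_False heis_scl heis_add lin_diff[OF lin_heis]
           lookup_add lookup_minus lookup_scl lookup_zero)
       (simp_all add: lookup_add lookup_minus algebra_simps power2_eq_square)
qed

text \<open>The simplifier turns \<open>v + v\<close> into \<open>2 * v\<close>, with the ring structure of \<^typ>\<open>fock\<close>.\<close>

lemma lookup_double [simp]: "Poly_Mapping.lookup (2 * v) b = 2 * Poly_Mapping.lookup v b" for v :: fock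
  by (simp only: mult_2 lookup_add)

lemma lookup_if: "Poly_Mapping.lookup (if P then u else 0) b = (if P then Poly_Mapping.lookup u b else 0)"
  for u :: fock
  by simp

section \<open>Virasoro modes on the vacuum and the Virasoro relations\<close>

lemma vir_fexp_pos: "n > 0 \<Longrightarrow> vir \<rho> n (fexp \<gamma>) = 0"
  by (rule wts_neg[OF vir_wts[OF fexp_wts]]) auto

lemma quad_fexp_zero: "quad x 0 (fexp \<gamma>) = heis \<gamma> x (fexp \<gamma>)"
  unfolding quad_def heis_fexp heis_scl
  by (subst (3) heis_eq_gen) (simp add: hform_def fock.scale_minus_left)

lemma vir_fexp_zero: "vir \<rho> 0 (fexp \<gamma>) = scl (hform \<gamma> \<gamma> / 2 - hform \<rho> \<gamma>) (fexp \<gamma>)"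
proof -
  have "fexp \<gamma> \<in> wts {..0}" by (rule wts_mono[OF fexp_wts]) auto
  from vir_sum[OF this, of 1 0 \<rho>] show ?thesis
    by (simp add: quad_fexp_zero heis_fexp)
       (simp add: quad_def heis_fexp fock.scale_left_diff_distrib)
qed

text \<open>The pair containing the zero mode occurs in both halves of the normal ordering, at
  \<open>j = k\<close> and at \<open>j = 0\<close>; this compensates the factor 1/2 in front of
  \<gamma>.\<close>

lemma vir_fexp_neg:
  "vir \<rho> (- int (Suc k)) (fexp \<gamma>) =
     scl (1/2) (\<Sum>j<k. quad (- int j - 1) (int j - int k) (fexp \<gamma>))
     + heis \<gamma> (- int (Suc k)) (fexp \<gamma>) + scl (of_nat k) (heis \<rho> (- int (Suc k)) (fexp \<gamma>))"
proof -
  have e: "fexp \<gamma> \<in> wts {..0}" by (rule wts_mono[OF fexp_wts]) auto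
  have i: "- int (Suc k) + 1 + int j = int j - int k" "- int k - 1 = - int (Suc k)" for j by simp_all
  have 1: "(\<Sum>j<Suc k. quad (- int j - 1) (- int (Suc k) + 1 + int j) (fexp \<gamma>)) =
      (\<Sum>j<k. quad (- int j - 1) (int j - int k) (fexp \<gamma>)) + heis \<gamma> (- int (Suc k)) (fexp \<gamma>)"
    unfolding i(1) by (simp add: quad_fexp_zero i(2) del: of_nat_Suc)
  have 2: "(\<Sum>j<Suc k. quad (- int (Suc k) - int j) (int j) (fexp \<gamma>)) = heis \<gamma> (- int (Suc k)) (fexp \<gamma>)"
    unfolding sum.lessThan_Suc_shift by (simp add: quad_vanish[OF e] quad_fexp_zero)
  have "vir \<rho> (- int (Suc k)) (fexp \<gamma>) =
      scl (1/2) ((\<Sum>j<Suc k. quad (- int j - 1) (- int (Suc k) + 1 + int j) (fexp \<gamma>))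
        + (\<Sum>j<Suc k. quad (- int (Suc k) - int j) (int j) (fexp \<gamma>)))
      - scl (of_int (- int (Suc k)) + 1) (heis \<rho> (- int (Suc k)) (fexp \<gamma>))"
    by (rule vir_sum[OF e]) simp_all
  then show ?thesis
    unfolding 1 2
    by (intro poly_mapping_eqI) (simp add: lookup_add lookup_minus algebra_simps)
qed

lemma vir_pos_heis_fexp:
  assumes "n > 0"
  shows "vir \<rho> n (heis \<delta> (- n) (fexp \<gamma>)) =
    scl (of_int n * hform \<delta> \<gamma> - of_int (n ^ 2 + n) * hform \<rho> \<delta>) (fexp \<gamma>)"
  unfolding vir_comm
  by (simp add: vir_fexp_pos assms heis_fexp fock.scale_left_diff_distrib)

text \<open>The factor 2 is the rank of the Cartan space: the norms 1 and -1 enter with the signs 1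
  and -1. It becomes the 2 in the central charge.\<close>

lemma vir_pos_quad_fexp:
  assumes "x < 0" "y < 0" "x + y = - n"
  shows "vir \<rho> n (quad x y (fexp \<gamma>)) = scl (2 * of_int (x * y)) (fexp \<gamma>)"
proof -
  have n: "n > 0" "n \<noteq> - y" "n \<noteq> - x" "n + y > 0" "n + x = - y" using assms by auto
  have "vir \<rho> n (heis \<delta> x (heis \<delta> y (fexp \<gamma>))) = scl (of_int (x * y) * hform \<delta> \<delta>) (fexp \<gamma>)" for \<delta>
    unfolding vir_comm n(5) using n heis_swap[of \<delta> "- y" \<delta> y "fexp \<gamma>"] assms
    by (simp add: vir_fexp_pos heis_fexp fock.scale_minus_left)
  then show ?thesis
    unfolding quad_def lin_diff[OF lin_vir]
    by (intro poly_mapping_eqI) (simp add: lookup_minus hform_def)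
qed

text \<open>At \<open>x = m = n - 1\<close> this is \<open>(n^3 - n) / 6\<close>, the Virasoro
  cocycle of central charge 2. Keeping x independent of the range makes induction on m
  possible.\<close>

lemma sum_triangle: "(\<Sum>j<m. (of_nat j + 1) * (x - of_nat j)) =
    x * of_nat m * (of_nat m + 1) / 2 - (of_nat m - 1) * of_nat m * (of_nat m + 1) / (3 :: complex)"
  by (induction m) (simp_all add: field_simps)

text \<open>This operator commutes with the Heisenberg modes (\<open>vir_defect_heis\<close>), so it vanishes on a Fock
  module as soon as it kills the vacuum. The image of the vacuum is a multiple of the vacuum, whose
  weight is wrong unless \<open>n + m = 0\<close>.\<close>

definition vir_defect :: "cartan \<Rightarrow> int \<Rightarrow> int \<Rightarrow> fock \<Rightarrow> fock" where
  "vir_defect \<rho> n m v = vir \<rho> n (vir \<rho> m v) - vir \<rho> m (vir \<rho> n v) - scl (of_int (n - m)) (vir \<rho> (n + m) v)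
     - (if n = - m then scl (of_int (n ^ 3 - n) / 12 * (2 - 12 * hform \<rho> \<rho>)) v else 0)"

lemma vir_defect_heis: "vir_defect \<rho> n m (heis \<delta> k v) = heis \<delta> k (vir_defect \<rho> n m v)"
proof -
  have i: "heis \<delta> k (if P then u else 0) = (if P then heis \<delta> k u else 0)"
    "vir \<rho> x (if P then u else 0) = (if P then vir \<rho> x u else 0)" for P u x
    by (simp_all add: lin_zero[OF lin_vir])
  note expand = vir_defect_def vir_comm lin_diff[OF lin_vir] lin_diff[OF lin_heis]
    lin_scl[OF lin_vir] heis_scl i
  show ?thesis
  proof (cases "m = - k - n")
    case True
    show ?thesis
      unfolding True expand
      by (intro poly_mapping_eqI, simp only: lookup_minus lookup_scl lookup_if)
         (auto simp: algebra_simps power2_eq_square)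
  next
    case False
    then have "n + m \<noteq> - k" "n \<noteq> - (m + k)" "m \<noteq> - (n + k)" by auto
    then show ?thesis
      unfolding expand
      by (intro poly_mapping_eqI, simp only: lookup_minus lookup_scl lookup_if if_False)
         (auto simp: algebra_simps)
  qed
qed

text \<open>The central charge is computed here, by evaluating L(n) L(-n) e^\<gamma>: the quadratic
  part of L(-n) gives the 2, and its \<rho>-part gives
  \<open>- 12 * hform \<rho> \<rho>\<close>.\<close>

lemma vir_defect_fexp_opposite:
  assumes "n > 0"
  shows "vir_defect \<rho> n (- n) (fexp \<gamma>) = 0"
proof -
  define k where "k = nat (n - 1)"
  have n: "n = int (Suc k)" using assms by (simp add: k_def)
  have q: "vir \<rho> n (quad (- int j - 1) (int j - int k) (fexp \<gamma>)) =
      scl (2 * ((of_nat j + 1) * (of_nat k - of_nat j))) (fexp \<gamma>)" if "j < k" for j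
    by (subst vir_pos_quad_fexp) (use that in \<open>auto simp: n algebra_simps\<close>)
  have "vir \<rho> n (vir \<rho> (- n) (fexp \<gamma>)) =
     scl (\<Sum>j<k. (of_nat j + 1) * (of_nat k - of_nat j)) (fexp \<gamma>)
     + vir \<rho> n (heis \<gamma> (- n) (fexp \<gamma>)) + scl (of_nat k) (vir \<rho> n (heis \<rho> (- n) (fexp \<gamma>)))"
    unfolding vir_fexp_neg[of _ k, folded n] lin_add[OF lin_vir] lin_scl[OF lin_vir]
      lin_sum[OF lin_vir]
    by (simp add: q fock.scale_sum_left fock.scale_sum_right)
  also have "\<dots> = scl (of_int (2 * n) * (hform \<gamma> \<gamma> / 2 - hform \<rho> \<gamma>)
       + of_int (n ^ 3 - n) / 12 * (2 - 12 * hform \<rho> \<rho>)) (fexp \<gamma>)"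
    unfolding sum_triangle vir_pos_heis_fexp[OF assms] fock.scale_scale
      fock.scale_left_distrib[symmetric]
    by (rule arg_cong[where f = "\<lambda>x. scl x (fexp \<gamma>)"])
       (simp add: n hform_def field_simps power2_eq_square power3_eq_cube)
  finally show ?thesis
    unfolding vir_defect_def
    by (simp add: vir_fexp_pos assms lin_zero[OF lin_vir] vir_fexp_zero fock.scale_left_distrib)
qed

lemma vir_defect_anti: "vir_defect \<rho> m n v = - vir_defect \<rho> n m v"
proof -
  have "(m = - n) = (n = - m)" by auto
  moreover have "of_int (m ^ 3 - m) = - (of_int (n ^ 3 - n) :: complex)" if "n = - m"
    using that by simp
  ultimately show ?thesis
    unfolding vir_defect_def
    by (intro poly_mapping_eqI, simp only: lookup_minus lookup_uminus lookup_scl lookup_if add.commute[of m])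
       (auto simp: field_simps)
qed

lemma vir_defect_fexp: "vir_defect \<rho> n m (fexp \<gamma>) = 0"
proof (cases "n = - m")
  case True
  consider "n > 0" | "n = 0" | "m > 0" using True by linarith
  then show ?thesis
  proof cases
    case 1 then show ?thesis using vir_defect_fexp_opposite[of n] True by simp
  next
    case 2 then show ?thesis using True by (simp add: vir_defect_def)
  next
    case 3
    then show ?thesis
      using vir_defect_fexp_opposite[of m \<rho> \<gamma>] True by (subst vir_defect_anti) simp
  qed
next
  case False
  have "vir_defect \<rho> n m (fexp \<gamma>) \<in> Fock_module \<gamma>"
    unfolding vir_defect_def by (auto intro!: Fock_intros vir_Fock)
  moreover have "heis \<delta> k (vir_defect \<rho> n m (fexp \<gamma>)) = 0" if "k > 0" for \<delta> k
    by (subst vir_defect_heis[symmetric])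
       (simp add: heis_fexp that vir_defect_def lin_zero[OF lin_vir])
  ultimately have "vir_defect \<rho> n m (fexp \<gamma>) =
      scl (Poly_Mapping.lookup (vir_defect \<rho> n m (fexp \<gamma>)) ({#}, \<gamma>)) (fexp \<gamma>)"
    by (rule Fock_vacuum)
  moreover have "vir_defect \<rho> n m (fexp \<gamma>) \<in> wts {- n - m}"
    unfolding vir_defect_def using False
    by (auto intro!: wts_diff wts_scl wts_zero
        wts_mono[OF vir_wts[OF vir_wts[OF fexp_wts]]] wts_mono[OF vir_wts[OF fexp_wts]])
  then have "Poly_Mapping.lookup (vir_defect \<rho> n m (fexp \<gamma>)) ({#}, \<gamma>) = 0"
    by (rule lookup_wts) (use False in auto)
  ultimately show ?thesis by simp
qed

lemma vir_bracket:
  assumes "v \<in> Fock_module \<gamma>"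
  shows "vir \<rho> n (vir \<rho> m v) - vir \<rho> m (vir \<rho> n v) = scl (of_int (n - m)) (vir \<rho> (n + m) v)
     + (if n = - m then scl (of_int (n ^ 3 - n) / 12 * (2 - 12 * hform \<rho> \<rho>)) v else 0)"
proof -
  have l: "lin (vir_defect \<rho> n m)"
  proof -
    have "lin (\<lambda>v. if n = - m then scl (of_int (n ^ 3 - n) / 12 * (2 - 12 * hform \<rho> \<rho>)) v else 0)"
      by (cases "n = - m") (simp_all add: lin_intros)
    then show ?thesis
      unfolding vir_defect_def[abs_def] by (intro lin_intros lin_comp[OF lin_vir] lin_vir)
  qed
  have "vir_defect \<rho> n m v = 0"
    using assms
    by (induction rule: Fock_module_induct)
       (simp_all add: vir_defect_fexp vir_defect_heis lin_add[OF l] lin_scl[OF l])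
  then show ?thesis by (simp add: vir_defect_def algebra_simps)
qed

text \<open>This evaluates the right-hand side of \<open>act_bracket\<close>. It is stated for every
  vector space, because the abstract modules of the uniqueness argument use it as well.\<close>

lemma (in vector_space) ext_sum_add:
  "(\<Sum>z\<in>Poly_Mapping.keys (p + q). scale (Poly_Mapping.lookup (p + q) z) (f z)) =
     (\<Sum>z\<in>Poly_Mapping.keys p. scale (Poly_Mapping.lookup p z) (f z))
   + (\<Sum>z\<in>Poly_Mapping.keys q. scale (Poly_Mapping.lookup q z) (f z))"
proof -
  let ?A = "Poly_Mapping.keys p \<union> Poly_Mapping.keys q"
  have s: "(\<Sum>z\<in>Poly_Mapping.keys r. scale (Poly_Mapping.lookup r z) (f z)) =
      (\<Sum>z\<in>?A. scale (Poly_Mapping.lookup r z) (f z))" if "Poly_Mapping.keys r \<subseteq> ?A" for r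
    by (rule sum.mono_neutral_left) (use that in \<open>auto simp: in_keys_iff\<close>)
  show ?thesis
    by (subst (1 2 3) s) (auto simp: keys_add lookup_add scale_left_distrib sum.distrib)
qed

lemma (in vector_space) ext_sum_single:
  "(\<Sum>z\<in>Poly_Mapping.keys (Poly_Mapping.single b x). scale (Poly_Mapping.lookup (Poly_Mapping.single b x) z) (f z))
     = scale x (f b)"
  by (cases "x = 0") simp_all

lemma (in vector_space) ext_sum_diff:
  "(\<Sum>z\<in>Poly_Mapping.keys (p - q). scale (Poly_Mapping.lookup (p - q) z) (f z)) =
     (\<Sum>z\<in>Poly_Mapping.keys p. scale (Poly_Mapping.lookup p z) (f z))
   - (\<Sum>z\<in>Poly_Mapping.keys q. scale (Poly_Mapping.lookup q z) (f z))"
  using ext_sum_add[of "p - q" q f] by (simp add: algebra_simps)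

lemma (in vector_space) ext_sum_if:
  "(\<Sum>z\<in>Poly_Mapping.keys (if P then p else 0). scale (Poly_Mapping.lookup (if P then p else 0) z) (f z)) =
     (if P then (\<Sum>z\<in>Poly_Mapping.keys p. scale (Poly_Mapping.lookup p z) (f z)) else 0)"
  by simp

lemmas (in vector_space) ext_sum_simps = ext_sum_add ext_sum_single ext_sum_diff ext_sum_if

section \<open>Fock modules as modules over the twisted Heisenberg-Virasoro algebra\<close>

lemma hv_act_L: "hv_act cL cLI (L_gen n) = vir (lam cL cLI, mu cL cLI) n"
  and hv_act_I: "hv_act cL cLI (I_gen n) = heis (1, 1) n"
  by (rule ext, simp add: vop_omega vop_I_vec)+

lemma hform_rho_light: "hform (lam cL cLI, mu cL cLI) (1, 1) = cLI"
  by (simp add: hform_def lam_def mu_def)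

text \<open>This is the origin of \<open>lam\<close> and \<open>mu\<close>:
  \<open>\<langle>\<rho>,\<rho>\<rangle> = (lam - mu) * (lam + mu)\<close>, where the difference is
  \<open>c_{L,I}\<close> and the sum is \<open>(2 - c_L) / (12 * c_{L,I})\<close>.\<close>

lemma central_charge:
  assumes "cLI \<noteq> 0"
  shows "2 - 12 * hform (lam cL cLI, mu cL cLI) (lam cL cLI, mu cL cLI) = cL"
  using assms by (simp add: hform_def lam_def mu_def field_simps)

lemma lin_hv_act: "lin (hv_act cL cLI x)"
proof (cases x)
  case (L_gen n)
  then show ?thesis by (simp only: hv_act_L lin_vir)
next
  case (I_gen n)
  then show ?thesis by (simp only: hv_act_I lin_heis)
qed (rule linI, simp_all add: fock.scale_right_distrib mult.commute)+

lemma hv_act_Fock: "v \<in> Fock_module \<gamma> \<Longrightarrow> hv_act cL cLI x v \<in> Fock_module \<gamma>"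
  by (cases x) (simp_all add: hv_act_L hv_act_I vir_Fock Fock_intros del: hv_act.simps(1,2))

lemma hv_act_bracket:
  assumes cLI: "cLI \<noteq> 0" and v: "v \<in> Fock_module \<gamma>"
  shows "hv_act cL cLI x (hv_act cL cLI y v) - hv_act cL cLI y (hv_act cL cLI x v) =
      (\<Sum>z\<in>Poly_Mapping.keys (hv_bracket x y). scl (Poly_Mapping.lookup (hv_bracket x y) z) (hv_act cL cLI z v))"
proof -
  note [simp] = hv_act_L hv_act_I vir_bracket[OF v] central_charge[OF cLI] hform_rho_light
    lin_scl[OF lin_vir] lin_zero[OF lin_vir]
  note [simp del] = hv_act.simps(1,2)
  have 1: ?thesis if xy: "x = L_gen n" "y = L_gen m" for n m
    unfolding xy hv_bracket.simps fock.ext_sum_simps by simp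
  have 2: ?thesis if xy: "x = L_gen n" "y = I_gen m" for n m
    unfolding xy hv_bracket.simps fock.ext_sum_simps hv_act_L hv_act_I vir_comm
    by (simp add: fock.scale_minus_left mult.commute)
  have 3: ?thesis if xy: "x = I_gen m" "y = L_gen n" for n m
    unfolding xy hv_bracket.simps fock.ext_sum_simps hv_act_L hv_act_I vir_comm
    by (simp add: fock.scale_minus_left mult.commute)
  have 4: ?thesis if xy: "x = I_gen m" "y = I_gen n" for n m
    unfolding xy hv_bracket.simps fock.ext_sum_simps hv_act_L hv_act_I heis_comm
    by (simp add: hform_def)
  show ?thesis
    using 1 2 3 4 by (cases x; cases y) (simp_all add: heis_scl)
qed

lemma hv_module_subspace:
  assumes "cLI \<noteq> 0" "V \<subseteq> Fock_module \<gamma>" "fock.subspace V" "\<And>x v. v \<in> V \<Longrightarrow> hv_act cL cLI x v \<in> V"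
  shows "hv_module scl V (hv_act cL cLI)"
  by unfold_locales
     (use assms in \<open>auto simp: lin_add[OF lin_hv_act] lin_scl[OF lin_hv_act] simp del: hv_act.simps
       intro!: hv_act_bracket\<close>)

section \<open>Modes of the vertex operator\<close>

lemma lin_ops_power:
  assumes "\<And>n. lin (A n)"
  shows "lin (ops_power A m n)"
proof (induction m arbitrary: n)
  case 0
  show ?case by (cases "n = 0") (simp_all add: lin_intros)
next
  case (Suc m)
  show ?case
    unfolding ops_power.simps ops_mult_def[abs_def] by (intro lin_sum_fun lin_comp[OF assms] Suc)
qed

lemma lin_ops_exp:
  assumes "\<And>n. lin (A n)"
  shows "lin (ops_exp A n)"
  unfolding ops_exp_def[abs_def] by (intro lin_sum_fun lin_scl_fun lin_ops_power assms)

lemma ops_exp_zero [simp]: "ops_exp A 0 v = v"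
  by (simp add: ops_exp_def)

lemma ops_power_low:
  assumes lin: "\<And>n. lin (A n)" and "\<And>v. A 0 v = 0" and "n < m"
  shows "ops_power A m n v = 0"
  using assms(3)
proof (induction m arbitrary: n)
  case (Suc m)
  have "A k (ops_power A m (n - k) v) = 0" if "k \<le> n" for k
    using that Suc assms(2) by (cases "k = 0") (auto simp: lin_zero[OF lin])
  then show ?case by (simp add: ops_mult_def)
qed simp

text \<open>If [X, A(z)] is the scalar series a z^k, it can be pulled out of any place in a product;
  so [X, A(z)^m] = m a z^k A(z)^(m-1).\<close>

lemma ops_power_comm:
  assumes lin: "\<And>n. lin (A n)" and X: "lin X"
    and comm: "\<And>j v. X (A j v) = A j (X v) + (if j = k then scl a v else 0)"
  shows "X (ops_power A m n v) = ops_power A m n (X v)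
     + (if k \<le> n \<and> m > 0 then scl (of_nat m * a) (ops_power A (m - 1) (n - k) v) else 0)"
proof (induction m arbitrary: n)
  case 0
  show ?case by (simp add: lin_zero[OF X])
next
  case (Suc m)
  have t: "X (A j (ops_power A m (n - j) v)) = A j (ops_power A m (n - j) (X v))
      + (if k \<le> n - j \<and> m > 0 then scl (of_nat m * a) (A j (ops_power A (m - 1) (n - j - k) v)) else 0)
      + (if j = k then scl a (ops_power A m (n - k) v) else 0)" for j
    unfolding comm Suc by (auto simp: lin_add[OF lin] lin_scl[OF lin] lin_zero[OF lin])
  have s: "(\<Sum>j\<le>n. if k \<le> n - j \<and> m > 0 then scl (of_nat m * a) (A j (ops_power A (m - 1) (n - j - k) v)) else 0)
      = (if k \<le> n then scl (of_nat m * a) (ops_power A m (n - k) v) else 0)"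
  proof (cases "k \<le> n \<and> m > 0")
    case True
    then obtain m' where m: "m = Suc m'" by (cases m) auto
    have "(\<Sum>j\<le>n. if k \<le> n - j \<and> m > 0 then scl (of_nat m * a) (A j (ops_power A (m - 1) (n - j - k) v)) else 0)
        = (\<Sum>j\<le>n - k. scl (of_nat m * a) (A j (ops_power A m' (n - k - j) v)))"
      by (rule sum.mono_neutral_cong_right) (use True in \<open>auto simp: m add.commute\<close>)
    then show ?thesis using True by (simp add: m ops_mult_def fock.scale_sum_right)
  next
    case False
    then show ?thesis by (auto intro!: sum.neutral)
  qed
  have "X (ops_power A (Suc m) n v) = (\<Sum>j\<le>n. X (A j (ops_power A m (n - j) v)))"
    by (simp add: ops_mult_def lin_sum[OF X])
  also have "\<dots> = ops_power A (Suc m) n (X v)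
     + (if k \<le> n then scl (of_nat m * a) (ops_power A m (n - k) v) else 0)
     + (if k \<le> n then scl a (ops_power A m (n - k) v) else 0)"
    unfolding t sum.distrib s by (simp add: ops_mult_def)
  finally show ?case
    by (auto simp: distrib_right fock.scale_left_distrib add.assoc add.commute)
qed

text \<open>Summing the derivation rule for the powers gives [X, exp A(z)] = a z^k exp A(z).\<close>

lemma ops_exp_comm:
  assumes lin: "\<And>n. lin (A n)" and X: "lin X" and A0: "\<And>v. A 0 v = 0" and "k > 0"
    and comm: "\<And>j v. X (A j v) = A j (X v) + (if j = k then scl a v else 0)"
  shows "X (ops_exp A n v) = ops_exp A n (X v) + (if k \<le> n then scl a (ops_exp A (n - k) v) else 0)"
proof -
  have "X (ops_exp A n v) = ops_exp A n (X v)
      + (\<Sum>m\<le>n. scl (1 / fact m) (if k \<le> n \<and> m > 0 then scl (of_nat m * a) (ops_power A (m - 1) (n - k) v) else 0))"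
    unfolding ops_exp_def lin_sum[OF X] lin_scl[OF X] ops_power_comm[where A = A and X = X, OF lin X comm]
    by (simp add: fock.scale_right_distrib sum.distrib)
  also have "(\<Sum>m\<le>n. scl (1 / fact m) (if k \<le> n \<and> m > 0 then scl (of_nat m * a) (ops_power A (m - 1) (n - k) v) else 0))
      = (if k \<le> n then scl a (ops_exp A (n - k) v) else 0)"
  proof (cases "k \<le> n")
    case True
    then obtain n' where n: "n = Suc n'" using \<open>k > 0\<close> by (cases n) auto
    have "(\<Sum>m\<le>n. scl (1 / fact m) (if k \<le> n \<and> m > 0 then scl (of_nat m * a) (ops_power A (m - 1) (n - k) v) else 0))
        = (\<Sum>m\<le>n'. scl (1 / fact (Suc m) * (of_nat (Suc m) * a)) (ops_power A m (n - k) v))"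
      unfolding n sum.atMost_Suc_shift using True n by simp
    also have "\<dots> = (\<Sum>m\<le>n'. scl a (scl (1 / fact m) (ops_power A m (n - k) v)))"
      by (intro sum.cong refl) (simp add: field_simps del: of_nat_Suc)
    \<comment> \<open>\<open>ops_exp\<close> truncates at the order of the coefficient. Powers with
      \<open>m > n - k\<close> contribute nothing to order \<open>n - k\<close>, because A has no
      constant term.\<close>
    also have "\<dots> = (\<Sum>m\<le>n - k. scl a (scl (1 / fact m) (ops_power A m (n - k) v)))"
      by (rule sum.mono_neutral_right)
         (use n \<open>k > 0\<close> in \<open>auto simp: not_le ops_power_low[where A = A, OF lin A0] simp del: ops_power.simps\<close>)
    finally show ?thesis using True by (simp add: ops_exp_def fock.scale_sum_right)
  qed simp
  finally show ?thesis .
qed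

lemma ops_exp_comm_zero:
  assumes lin: "\<And>n. lin (A n)" and X: "lin X" and A0: "\<And>v. A 0 v = 0"
    and comm: "\<And>j v. X (A j v) = A j (X v)"
  shows "X (ops_exp A n v) = ops_exp A n (X v)"
  using ops_exp_comm[where A = A and X = X and k = 1 and a = 0, OF lin X A0] by (simp add: comm)

lemma ops_power_mem:
  assumes "fock.subspace U" and "\<And>k v. v \<in> U \<Longrightarrow> A k v \<in> U" and "v \<in> U"
  shows "ops_power A m n v \<in> U"
  using assms
  by (induction m arbitrary: n) (auto simp: ops_mult_def fock.subspace_0 intro!: fock.subspace_sum)

text \<open>For \<open>n > 0\<close> every nonzero term contains at least one factor A, and the
  outermost one lands in U'. With U' smaller than U this makes annihilation exponentials lower a
  filtration.\<close>

lemma ops_exp_mem: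
  assumes U: "fock.subspace U" "fock.subspace U'" "U' \<subseteq> U" and A: "\<And>k v. v \<in> U \<Longrightarrow> A k v \<in> U'"
    and v: "v \<in> U" and "n > 0"
  shows "ops_exp A n v \<in> U'"
proof -
  have "A k v \<in> U" if "v \<in> U" for k v using that A U(3) by blast
  then have p: "ops_power A m k v \<in> U" for m k by (intro ops_power_mem U v)
  have "ops_power A m n v \<in> U'" for m
    using \<open>n > 0\<close> p A U(2)
    by (cases m) (auto simp: ops_mult_def fock.subspace_0 intro!: fock.subspace_sum)
  then show ?thesis
    unfolding ops_exp_def by (intro fock.subspace_sum fock.subspace_scale U(2))
qed

text \<open>The sign s is -1 for creation series and 1 for annihilation series.\<close>

lemma ops_power_wts:
  assumes "\<And>k v W. v \<in> wts W \<Longrightarrow> A k v \<in> wts {w. w + s * int k \<in> W}" and "v \<in> wts W"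
  shows "ops_power A m n v \<in> wts {w. w + s * int n \<in> W}"
proof (induction m arbitrary: n)
  case 0
  show ?case using assms(2) by (auto simp: wts_zero)
next
  case (Suc m)
  have "A k (ops_power A m (n - k) v) \<in> wts {w. w + s * int n \<in> W}" if "k \<le> n" for k
    by (rule wts_mono[OF assms(1)[OF Suc]])
       (use that in \<open>auto simp: of_nat_diff algebra_simps\<close>)
  then show ?case by (auto simp: ops_mult_def intro!: wts_sum)
qed

lemma ops_exp_wts:
  assumes "\<And>k v W. v \<in> wts W \<Longrightarrow> A k v \<in> wts {w. w + s * int k \<in> W}" and "v \<in> wts W"
  shows "ops_exp A n v \<in> wts {w. w + s * int n \<in> W}"
  unfolding ops_exp_def by (intro wts_sum wts_scl ops_power_wts assms)

lemma lin_creation: "lin (creation_series \<phi> n)"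
proof (cases "n = 0")
  case False
  then show ?thesis
    unfolding creation_series_def[abs_def] by (simp only: if_False) (intro lin_scl_fun lin_heis)
qed (simp add: creation_series_def[abs_def] lin_const_zero)

lemma lin_annihilation: "lin (annihilation_series \<phi> n)"
proof (cases "n = 0")
  case False
  then show ?thesis
    unfolding annihilation_series_def[abs_def] by (simp only: if_False) (intro lin_scl_fun lin_heis)
qed (simp add: annihilation_series_def[abs_def] lin_const_zero)

abbreviation "creat \<phi> \<equiv> ops_exp (creation_series \<phi>)"
abbreviation "annih \<phi> \<equiv> ops_exp (annihilation_series \<phi>)"

lemma lin_creat: "lin (creat \<phi> n)" and lin_annih: "lin (annih \<phi> n)"
  by (rule lin_ops_exp lin_creation lin_annihilation)+

lemma heis_creat_pos:
  assumes "k > 0"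
  shows "heis \<delta> (int k) (creat \<phi> n v) = creat \<phi> n (heis \<delta> (int k) v)
     + (if k \<le> n then scl (hform \<delta> \<phi>) (creat \<phi> (n - k) v) else 0)"
  by (rule ops_exp_comm[OF lin_creation lin_heis])
     (use assms in \<open>auto simp: creation_series_def heis_scl lin_minus[OF lin_heis] heis_swap[of \<delta> "int k" \<phi>]
        fock.scale_right_distrib\<close>)

lemma heis_creat_nonpos:
  assumes "k \<le> 0"
  shows "heis \<delta> k (creat \<phi> n v) = creat \<phi> n (heis \<delta> k v)"
  by (rule ops_exp_comm_zero[OF lin_creation lin_heis])
     (use assms in \<open>auto simp: creation_series_def heis_scl lin_minus[OF lin_heis] heis_swap[of \<delta> k \<phi>]\<close>)

lemma heis_annih_neg:
  assumes "k > 0"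
  shows "heis \<delta> (- int k) (annih \<phi> n v) = annih \<phi> n (heis \<delta> (- int k) v)
     + (if k \<le> n then scl (hform \<delta> \<phi>) (annih \<phi> (n - k) v) else 0)"
  by (rule ops_exp_comm[OF lin_annihilation lin_heis])
     (use assms in \<open>auto simp: annihilation_series_def heis_scl lin_minus[OF lin_heis] heis_swap[of \<delta> "- int k" \<phi>]
        fock.scale_right_distrib fock.scale_minus_left fock.scale_right_diff_distrib\<close>)

lemma heis_annih_nonneg:
  assumes "k \<ge> 0"
  shows "heis \<delta> k (annih \<phi> n v) = annih \<phi> n (heis \<delta> k v)"
  by (rule ops_exp_comm_zero[OF lin_annihilation lin_heis])
     (use assms in \<open>auto simp: annihilation_series_def heis_scl lin_minus[OF lin_heis] heis_swap[of \<delta> k \<phi>]\<close>)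

lemma creation_series_wts: "v \<in> wts W \<Longrightarrow> creation_series \<phi> k v \<in> wts {w. w + - 1 * int k \<in> W}"
  unfolding creation_series_def by (cases "k = 0") (auto intro!: wts_zero wts_scl intro: wts_mono[OF heis_wts])

lemma annihilation_series_wts: "v \<in> wts W \<Longrightarrow> annihilation_series \<phi> k v \<in> wts {w. w + 1 * int k \<in> W}"
  unfolding annihilation_series_def
  by (cases "k = 0") (auto intro!: wts_zero wts_scl intro: wts_mono[OF heis_wts] simp del: fock.scale_minus_left)

lemma creat_wts: "v \<in> wts W \<Longrightarrow> creat \<phi> k v \<in> wts {w. w - int k \<in> W}"
  using ops_exp_wts[OF creation_series_wts] by simp

lemma annih_wts: "v \<in> wts W \<Longrightarrow> annih \<phi> k v \<in> wts {w. w + int k \<in> W}"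
  using ops_exp_wts[OF annihilation_series_wts] by simp

lemma annih_vanish: "v \<in> wts {..N} \<Longrightarrow> int k > N \<Longrightarrow> annih \<phi> k v = 0"
  by (rule wts_neg[OF annih_wts]) auto

lemma creat_Fock: "v \<in> Fock_module \<gamma> \<Longrightarrow> creat \<phi> n v \<in> Fock_module \<gamma>"
  and annih_Fock: "v \<in> Fock_module \<gamma> \<Longrightarrow> annih \<phi> n v \<in> Fock_module \<gamma>"
  by (cases "n = 0", simp,
      rule ops_exp_mem[OF Fock_module_subspace Fock_module_subspace subset_refl],
      auto simp: creation_series_def annihilation_series_def intro!: Fock_intros simp del: fock.scale_minus_left)+

section \<open>The shift and the modes of Y(e^\<phi>,z)\<close>

lemma lin_shift: "lin (exp_shift \<phi>)"
  unfolding exp_shift_def by (rule lin_lin_ext)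

lemma exp_shift_single [simp]: "exp_shift \<phi> (Poly_Mapping.single (M, \<gamma>) x) = Poly_Mapping.single (M, \<gamma> + \<phi>) x"
  by (simp add: exp_shift_def)

lemma exp_shift_fexp: "exp_shift \<phi> (fexp \<gamma>) = fexp (\<gamma> + \<phi>)"
  by (simp add: fexp_def)

lemma exp_shift_inverse: "exp_shift (- \<phi>) (exp_shift \<phi> v) = v"
  by (rule fock_additive_eqI[where v = v]) (simp_all add: lin_add[OF lin_shift])

lemma exp_shift_Fock:
  assumes "v \<in> Fock_module \<gamma>"
  shows "exp_shift \<phi> v \<in> Fock_module (\<gamma> + \<phi>)"
  by (rule lin_mem_subspaceI[OF lin_shift Fock_module_subspace])
     (use assms in \<open>auto simp: Fock_module_def split: if_splits\<close>)

lemma exp_shift_wts: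
  assumes "v \<in> wts W"
  shows "exp_shift \<phi> v \<in> wts W"
  by (rule lin_mem_subspaceI[OF lin_shift wts_subspace]) (use assms in \<open>auto simp: wts_def split: if_splits\<close>)

lemma heis_exp_shift:
  "heis \<delta> n (exp_shift \<phi> v) = exp_shift \<phi> (heis \<delta> n v) + (if n = 0 then scl (hform \<delta> \<phi>) (exp_shift \<phi> v) else 0)"
proof (rule fock_additive_eqI[where v = v])
  fix M \<gamma> x
  have g: "heis (gen_vec g) n (exp_shift \<phi> (Poly_Mapping.single (M, \<gamma>) x)) =
     exp_shift \<phi> (heis (gen_vec g) n (Poly_Mapping.single (M, \<gamma>) x))
     + (if n = 0 then scl (hform (gen_vec g) \<phi>) (exp_shift \<phi> (Poly_Mapping.single (M, \<gamma>) x)) else 0)" for g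
    by (auto simp: heis_gen_single hform_def algebra_simps simp flip: single_add)
  show "heis \<delta> n (exp_shift \<phi> (Poly_Mapping.single (M, \<gamma>) x)) =
     exp_shift \<phi> (heis \<delta> n (Poly_Mapping.single (M, \<gamma>) x))
     + (if n = 0 then scl (hform \<delta> \<phi>) (exp_shift \<phi> (Poly_Mapping.single (M, \<gamma>) x)) else 0)"
    unfolding heis_eq_gen[of \<delta>] g lin_add[OF lin_shift] lin_scl[OF lin_shift]
    by (auto simp: fock.scale_right_distrib hform_def algebra_simps fock.scale_left_diff_distrib
          simp flip: single_add)
qed (simp_all add: heis_add lin_add[OF lin_shift] fock.scale_right_distrib add_ac)

text \<open>On $M(1,\gamma)$ this is the residue of $z^{q - 1 - \langle\phi,\gamma\rangle} Y(e^\phi, z)$; so it is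
  the screening operator if $\phi$ is \<open>phi cLI\<close> and $\langle\phi,\gamma\rangle = q - 1$.\<close>

definition vtx :: "cartan \<Rightarrow> int \<Rightarrow> fock \<Rightarrow> fock" where
  "vtx \<phi> q v = Sum_any (\<lambda>i::nat. if int i + q \<ge> 0 then creat \<phi> i (annih \<phi> (nat (int i + q)) (exp_shift \<phi> v)) else 0)"

lemma vtx_sum:
  assumes "v \<in> wts {..N}" "int K > N - q"
  shows "vtx \<phi> q v = (\<Sum>i<K. if int i + q \<ge> 0 then creat \<phi> i (annih \<phi> (nat (int i + q)) (exp_shift \<phi> v)) else 0)"
  unfolding vtx_def
  by (rule Sum_any_nat_bounded)
     (use assms in \<open>auto simp: annih_vanish[OF exp_shift_wts[OF assms(1)]] lin_zero[OF lin_creat]\<close>)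

lemma lin_vtx: "lin (vtx \<phi> q)"
proof (rule linI)
  fix u v
  obtain N where N: "u \<in> wts {..N}" using wts_bounded by blast
  obtain N' where N': "v \<in> wts {..N'}" using wts_bounded by blast
  define M where "M = max N N'"
  have u: "u \<in> wts {..M}" and v: "v \<in> wts {..M}"
    by (auto simp: M_def intro: wts_mono[OF N] wts_mono[OF N'])
  obtain K where K: "int K > M - q" using ex_nat_bound by blast
  show "vtx \<phi> q (u + v) = vtx \<phi> q u + vtx \<phi> q v"
    unfolding vtx_sum[OF u K] vtx_sum[OF v K] vtx_sum[OF wts_add[OF u v] K] sum.distrib[symmetric]
    by (intro sum.cong) (simp_all add: lin_add[OF lin_creat] lin_add[OF lin_annih] lin_add[OF lin_shift])
next
  fix a v
  obtain N where v: "v \<in> wts {..N}" using wts_bounded by blast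
  obtain K where K: "int K > N - q" using ex_nat_bound by blast
  show "vtx \<phi> q (scl a v) = scl a (vtx \<phi> q v)"
    unfolding vtx_sum[OF v K] vtx_sum[OF wts_scl[OF v] K] fock.scale_sum_right
    by (intro sum.cong) (simp_all add: lin_scl[OF lin_creat] lin_scl[OF lin_annih] lin_scl[OF lin_shift])
qed

lemma vtx_mem:
  assumes "fock.subspace U" "\<And>i j. int j = int i + q \<Longrightarrow> creat \<phi> i (annih \<phi> j (exp_shift \<phi> v)) \<in> U"
  shows "vtx \<phi> q v \<in> U"
proof -
  obtain N where v: "v \<in> wts {..N}" using wts_bounded by blast
  obtain K where K: "int K > N - q" using ex_nat_bound by blast
  show ?thesis
    unfolding vtx_sum[OF v K]
    by (rule fock.subspace_sum[OF assms(1)]) (auto intro: assms(2) fock.subspace_0[OF assms(1)])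
qed

lemma vtx_Fock: "v \<in> Fock_module \<gamma> \<Longrightarrow> vtx \<phi> q v \<in> Fock_module (\<gamma> + \<phi>)"
  by (rule vtx_mem[OF Fock_module_subspace]) (intro creat_Fock annih_Fock exp_shift_Fock)

lemma vtx_wts: "v \<in> wts W \<Longrightarrow> vtx \<phi> q v \<in> wts {w. w + q \<in> W}"
  by (rule vtx_mem[OF wts_subspace], rule wts_mono[OF creat_wts[OF annih_wts[OF exp_shift_wts]]])
     (auto simp: algebra_simps)

text \<open>This is [\<delta>(k), Y(e^\<phi>,z)] = \<langle>\<delta>,\<phi>\<rangle> z^k
  Y(e^\<phi>,z). Only one factor of Y can fail to commute with \<delta>(k): the creation exponential
  for \<open>k > 0\<close>, the shift for \<open>k = 0\<close>, the annihilation exponential for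
  \<open>k < 0\<close>.\<close>

lemma heis_vtx: "heis \<delta> k (vtx \<phi> q v) = vtx \<phi> q (heis \<delta> k v) + scl (hform \<delta> \<phi>) (vtx \<phi> (q + k) v)"
proof -
  obtain N0 where N0: "v \<in> wts {..N0}" using wts_bounded by blast
  define N where "N = N0 + \<bar>k\<bar>"
  have v: "v \<in> wts {..N}" and w: "heis \<delta> k v \<in> wts {..N}"
    by (auto simp: N_def intro: wts_mono[OF N0] wts_mono[OF heis_wts[OF N0]])
  obtain K where K: "int K > N - q" "int K > N - (q + k)" using ex_nat_bound by blast
  have lz: "creat \<phi> i (if P then u else 0) = (if P then creat \<phi> i u else 0)"
    "annih \<phi> i (if P then u else 0) = (if P then annih \<phi> i u else 0)" for i P u
    by (simp_all add: lin_zero[OF lin_creat] lin_zero[OF lin_annih])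
  consider "k = 0" | "k > 0" | "k < 0" by linarith
  then show ?thesis
  proof cases
    case 1
    show ?thesis
      unfolding vtx_sum[OF v K(1)] vtx_sum[OF v K(2)] vtx_sum[OF w K(1)] lin_sum[OF lin_heis]
        fock.scale_sum_right sum.distrib[symmetric]
      by (intro sum.cong refl)
         (auto simp: 1 heis_creat_nonpos heis_annih_nonneg heis_exp_shift lin_add[OF lin_creat]
           lin_add[OF lin_annih] lin_scl[OF lin_creat] lin_scl[OF lin_annih])
  next
    case 2
    then obtain m where k: "k = int m" "m > 0" using zero_less_imp_eq_int by blast
    let ?f = "\<lambda>i. if int i + (q + k) \<ge> 0 then creat \<phi> i (annih \<phi> (nat (int i + (q + k))) (exp_shift \<phi> v)) else 0"
    \<comment> \<open>The creation exponential lowers i by m, so the sum is cut at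
      \<open>K + m\<close> in order that the reindexed sum ends at K.\<close>
    have K': "int (K + m) > N - q" using K by simp
    have "heis \<delta> k (vtx \<phi> q v) = vtx \<phi> q (heis \<delta> k v) +
       (\<Sum>i<K + m. if m \<le> i then scl (hform \<delta> \<phi>) (?f (i - m)) else 0)"
      unfolding vtx_sum[OF v K'] vtx_sum[OF w K'] lin_sum[OF lin_heis] sum.distrib[symmetric]
      by (intro sum.cong refl)
         (use k in \<open>auto simp: heis_creat_pos heis_annih_nonneg heis_exp_shift of_nat_diff
            algebra_simps\<close>)
    also have "(\<Sum>i<K + m. if m \<le> i then scl (hform \<delta> \<phi>) (?f (i - m)) else 0)
        = (\<Sum>i\<in>{0 + m..<K + m}. scl (hform \<delta> \<phi>) (?f (i - m)))"
      by (rule sum.mono_neutral_cong_right) auto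
    also have "\<dots> = scl (hform \<delta> \<phi>) (\<Sum>i<K. ?f i)"
      unfolding sum.shift_bounds_nat_ivl atLeast0LessThan fock.scale_sum_right add_diff_cancel_right' ..
    finally show ?thesis unfolding vtx_sum[OF v K(2)] .
  next
    case 3
    then obtain m where k: "k = - int m" "m > 0"
      by (metis neg_less_0_iff_less zero_less_imp_eq_int minus_minus)
    have *: "nat (int i + (q - int m)) = nat (int i + q) - m" for i by linarith
    show ?thesis
      unfolding vtx_sum[OF v K(1)] vtx_sum[OF v K(2)] vtx_sum[OF w K(1)] lin_sum[OF lin_heis]
        fock.scale_sum_right sum.distrib[symmetric]
      by (intro sum.cong refl)
         (use k in \<open>auto simp: heis_creat_nonpos heis_annih_neg heis_exp_shift lin_add[OF lin_creat]
           lin_scl[OF lin_creat] lz *\<close>)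
  qed
qed

lemma vtx_fexp_zero: "vtx \<phi> 0 (fexp \<gamma>) = fexp (\<gamma> + \<phi>)"
proof -
  have "fexp \<gamma> \<in> wts {..0}" by (rule wts_mono[OF fexp_wts]) auto
  from vtx_sum[OF this, of 0 1] show ?thesis by (simp add: exp_shift_fexp)
qed

lemma vtx_fexp_pos: "q > 0 \<Longrightarrow> vtx \<phi> q (fexp \<gamma>) = 0"
  by (rule wts_neg[OF vtx_wts[OF fexp_wts]]) auto

lemma vtx_fexp_neg: "vtx \<phi> (- int n) (fexp \<gamma>) = creat \<phi> n (fexp (\<gamma> + \<phi>))"
proof -
  have e: "fexp \<delta> \<in> wts {..0}" for \<delta> by (rule wts_mono[OF fexp_wts]) auto
  have "vtx \<phi> (- int n) (fexp \<gamma>) = (\<Sum>i<Suc n. if i = n then creat \<phi> n (fexp (\<gamma> + \<phi>)) else 0)"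
    by (subst vtx_sum[OF e, of _ "Suc n"], simp, intro sum.cong refl) (auto simp: exp_shift_fexp)
  then show ?thesis by simp
qed

section \<open>Commutators of vertex operator modes with Virasoro modes\<close>

lemma hform_add_right: "hform \<delta> (\<gamma> + \<gamma>') = hform \<delta> \<gamma> + hform \<delta> \<gamma>'"
  by (simp add: hform_def algebra_simps)

lemma hform_commute: "hform \<delta> \<gamma> = hform \<gamma> \<delta>"
  by (simp add: hform_def mult.commute)

text \<open>Because \<phi> is isotropic, L(n) kills every product of two or more creation modes of
  \<phi> with total degree n on e^\<gamma>; only the linear term \<phi>(-n)/n of the exponential is
  left.\<close>

lemma vir_pos_creat_fexp:
  assumes "n > 0" and iso: "hform \<phi> \<phi> = 0"
  shows "vir \<rho> (int n) (creat \<phi> n (fexp \<gamma>)) =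
    scl (hform \<phi> \<gamma> - of_nat (n + 1) * hform \<rho> \<phi>) (fexp \<gamma>)"
proof -
  let ?P = "ops_power (creation_series \<phi>)"
  have 1: "vir \<rho> (int n) (?P 1 n (fexp \<gamma>)) = scl (hform \<phi> \<gamma> - of_nat (n + 1) * hform \<rho> \<phi>) (fexp \<gamma>)"
  proof -
    have "?P 1 n (fexp \<gamma>) = creation_series \<phi> n (fexp \<gamma>)"
      by (simp add: ops_mult_def sum.delta if_distrib[where f = "creation_series \<phi> _"]
          lin_zero[OF lin_creation] cong: if_cong)
    also have "\<dots> = scl (1 / of_nat n) (heis \<phi> (- int n) (fexp \<gamma>))"
      using assms(1) by (simp add: creation_series_def)
    finally show ?thesis
      using assms(1)
      by (simp add: lin_scl[OF lin_vir] vir_pos_heis_fexp field_simps power2_eq_square)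
  qed
  have 2: "vir \<rho> (int n) (?P (Suc (Suc m)) n (fexp \<gamma>)) = 0" for m
  proof -
    have "vir \<rho> (int n) (creation_series \<phi> j (?P (Suc m) (n - j) (fexp \<gamma>))) = 0" if "j \<le> n" for j
    proof -
      let ?u = "?P (Suc m) (n - j) (fexp \<gamma>)"
      consider "j = 0" | "j = n" | "0 < j" "j < n" using \<open>j \<le> n\<close> by linarith
      then show ?thesis
      proof cases
        case 1
        then show ?thesis by (simp add: creation_series_def lin_zero[OF lin_vir])
      next
        case 2
        have "?u = 0"
          using 2 by (intro ops_power_low[where A = "creation_series \<phi>", OF lin_creation])
             (simp_all add: creation_series_def)
        then show ?thesis by (simp add: lin_zero[OF lin_creation] lin_zero[OF lin_vir])
      next
        case 3
        \<comment> \<open>L(n) \<phi>(-j) \<open>?u\<close> splits into \<phi>(-j) L(n)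
          \<open>?u\<close>, where L(n) \<open>?u\<close> has negative weight, and a multiple of
          \<phi>(n-j) \<open>?u\<close>, which vanishes because \<phi>(n-j) commutes with the
          factors of \<open>?u\<close> and kills e^\<gamma>.\<close>
        have "?u \<in> wts {w. w + - 1 * int (n - j) \<in> {0}}"
          by (rule ops_power_wts[OF creation_series_wts fexp_wts])
        then have v0: "vir \<rho> (int n) ?u = 0"
          using 3 by (intro wts_neg[OF vir_wts]) auto
        have "heis \<phi> (int (n - j)) ?u = ?P (Suc m) (n - j) (heis \<phi> (int (n - j)) (fexp \<gamma>))"
          using ops_power_comm[where A = "creation_series \<phi>" and X = "heis \<phi> (int (n - j))" and k = 0 and a = 0
              and v = "fexp \<gamma>" and m = "Suc m" and n = "n - j", OF lin_creation lin_heis]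
          by (simp add: creation_series_def heis_scl heis_swap[of \<phi> "int (n - j)" \<phi>] iso)
        also have "\<dots> = 0"
          using 3 by (simp add: heis_fexp lin_zero[OF lin_ops_power] lin_creation del: ops_power.simps)
        finally have h0: "heis \<phi> (int n - int j) ?u = 0" using 3 by (simp add: of_nat_diff)
        have "vir \<rho> (int n) (heis \<phi> (- int j) ?u) = 0"
          unfolding vir_comm using 3 by (simp add: v0 h0 del: ops_power.simps)
        then show ?thesis
          using 3 by (simp add: creation_series_def lin_scl[OF lin_vir] del: ops_power.simps)
      qed
    qed
    then show ?thesis
      by (subst ops_power.simps) (simp add: ops_mult_def lin_sum[OF lin_vir] del: ops_power.simps)
  qed
  have "vir \<rho> (int n) (creat \<phi> n (fexp \<gamma>)) = (\<Sum>m\<le>n. scl (1 / fact m) (vir \<rho> (int n) (?P m n (fexp \<gamma>))))"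
    by (simp add: ops_exp_def lin_sum[OF lin_vir] lin_scl[OF lin_vir])
  also have "\<dots> = (\<Sum>m\<in>{1}. scl (1 / fact m) (vir \<rho> (int n) (?P m n (fexp \<gamma>))))"
  proof (rule sum.mono_neutral_right)
    show "\<forall>m\<in>{..n} - {1}. scl (1 / fact m) (vir \<rho> (int n) (?P m n (fexp \<gamma>))) = 0"
    proof
      fix m assume "m \<in> {..n} - {1}"
      then have "m \<noteq> Suc 0" by simp
      then consider "m = 0" | m' where "m = Suc (Suc m')" by (metis old.nat.exhaust)
      then show "scl (1 / fact m) (vir \<rho> (int n) (?P m n (fexp \<gamma>))) = 0"
        using 2 assms(1) by cases (simp_all add: lin_zero[OF lin_vir] del: ops_power.simps(2))
    qed
  qed (use assms in auto)
  finally show ?thesis using 1 by simp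
qed

context
  fixes \<phi> \<rho> \<gamma> :: cartan and p :: int
  assumes iso: "hform \<phi> \<phi> = 0" and rho_phi: "hform \<rho> \<phi> = - 1" and phi_gam: "hform \<phi> \<gamma> = of_int p - 1"
begin

text \<open>Since e^\<phi> has conformal weight \<open>\<langle>\<phi>,\<phi>\<rangle>/2 -
  \<langle>\<rho>,\<phi>\<rangle> = 1\<close>, the expected commutator [L(n), Y(e^\<phi>,z)] is the
  derivative of z^(n+1) Y(e^\<phi>,z). As \<open>vtx \<phi> q\<close> is the coefficient of
  z^(p-1-q), the derivative becomes the factor \<open>- (q - p)\<close>, which vanishes at the
  residue \<open>q = p\<close>.\<close>

definition scr_defect :: "int \<Rightarrow> int \<Rightarrow> fock \<Rightarrow> fock" where
  "scr_defect n q v = vir \<rho> n (vtx \<phi> q v) - vtx \<phi> q (vir \<rho> n v) + scl (of_int (q - p)) (vtx \<phi> (q + n) v)"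

lemma lin_scr_defect: "lin (scr_defect n q)"
  unfolding scr_defect_def[abs_def] by (intro lin_plus lin_minus_fun lin_scl_fun lin_vtx
      lin_comp[OF lin_vir lin_vtx] lin_comp[OF lin_vtx lin_vir])

text \<open>Heisenberg modes mix the defects of different indices, so their vanishing has to be
  proved for all q together.\<close>

lemma scr_defect_heis:
  "scr_defect n q (heis \<delta> k v) = heis \<delta> k (scr_defect n q v) - scl (hform \<delta> \<phi>) (scr_defect n (q + k) v)"
proof -
  have s: "vtx \<phi> x (heis \<delta> k u) = heis \<delta> k (vtx \<phi> x u) - scl (hform \<delta> \<phi>) (vtx \<phi> (x + k) u)" for x k u
    using heis_vtx[of \<delta> k \<phi> x u] by simp
  have i: "vtx \<phi> x (if P then u else 0) = (if P then vtx \<phi> x u else 0)" for x P u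
    by (simp add: lin_zero[OF lin_vtx])
  show ?thesis
    unfolding scr_defect_def vir_comm s lin_diff[OF lin_vtx] lin_scl[OF lin_vtx] lin_diff[OF lin_vir]
      lin_scl[OF lin_vir] heis_add lin_diff[OF lin_heis] heis_scl i
    by (intro poly_mapping_eqI, simp only: lookup_add lookup_minus lookup_scl lookup_if)
       (simp add: algebra_simps)
qed

text \<open>Only here does the weight allow a multiple of the vacuum. For \<open>n > 0\<close> just
  the linear part of the exponential counts; for \<open>n < 0\<close> the quadratic part of L(n)
  e^\<gamma> contributes a multiple of \<open>\<langle>\<phi>,\<phi>\<rangle> = 0\<close>.\<close>

lemma scr_defect_fexp_diag: "scr_defect n (- n) (fexp \<gamma>) = 0"
proof -
  consider "n = 0" | "n > 0" | "n < 0" by linarith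
  then show ?thesis
  proof cases
    case 1
    then show ?thesis
      by (simp add: scr_defect_def vtx_fexp_zero vir_fexp_zero lin_scl[OF lin_vtx]
           flip: fock.scale_left_diff_distrib fock.scale_left_distrib)
         (use iso rho_phi phi_gam in \<open>simp add: hform_add_right hform_commute[of "\<gamma> + \<phi>"] hform_commute[of \<gamma> \<phi>] add_divide_distrib diff_divide_distrib\<close>)
  next
    case 2
    then obtain m where n: "n = int m" "m > 0" using zero_less_imp_eq_int by blast
    show ?thesis
      unfolding n scr_defect_def vtx_fexp_neg vir_pos_creat_fexp[OF n(2) iso]
      by (simp add: vir_fexp_pos n vtx_fexp_zero lin_zero[OF lin_vtx] flip: fock.scale_left_distrib)
         (use iso rho_phi phi_gam in \<open>simp add: hform_add_right\<close>)
  next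
    case 3
    define k where "k = nat (- n - 1)"
    have n: "n = - int (Suc k)" using 3 by (simp add: k_def)
    have s: "vtx \<phi> x (heis \<delta> k u) = heis \<delta> k (vtx \<phi> x u) - scl (hform \<delta> \<phi>) (vtx \<phi> (x + k) u)" for x \<delta> k u
      using heis_vtx[of \<delta> k \<phi> x u] by simp
    have h: "vtx \<phi> (- n) (heis \<delta> n (fexp \<gamma>)) = scl (- hform \<delta> \<phi>) (fexp (\<gamma> + \<phi>))" for \<delta>
      unfolding s using 3 by (simp add: vtx_fexp_pos vtx_fexp_zero)
    have "vtx \<phi> (- n) (heis \<delta> x (heis \<delta> y (fexp \<gamma>))) = scl (hform \<delta> \<phi> ^ 2) (fexp (\<gamma> + \<phi>))"
      if "x < 0" "y < 0" "x + y = n" for x y \<delta>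
    proof -
      have e: "- n + x = - y" "- n + y = - x" using that by auto
      show ?thesis
        unfolding s e using 3 that
        by (simp add: vtx_fexp_pos vtx_fexp_zero lin_diff[OF lin_heis] power2_eq_square fock.scale_minus_left)
    qed
    then have q: "vtx \<phi> (- n) (quad x y (fexp \<gamma>)) = 0" if "x < 0" "y < 0" "x + y = n" for x y
      unfolding quad_def lin_diff[OF lin_vtx] using that iso
      by (simp add: hform_def power2_eq_square)
    have q0: "(\<Sum>j<k. vtx \<phi> (- n) (quad (- int j - 1) (int j - int k) (fexp \<gamma>))) = 0"
      by (intro sum.neutral ballI q) (auto simp: n)
    have "vtx \<phi> (- n) (vir \<rho> n (fexp \<gamma>)) = scl (- hform \<gamma> \<phi> - of_nat k * hform \<rho> \<phi>) (fexp (\<gamma> + \<phi>))"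
      unfolding n vir_fexp_neg lin_add[OF lin_vtx] lin_scl[OF lin_vtx] lin_sum[OF lin_vtx]
      unfolding n[symmetric] h q0
      by (simp add: fock.scale_left_diff_distrib)
    then show ?thesis
      using 3 rho_phi phi_gam
      by (simp add: scr_defect_def vtx_fexp_pos vtx_fexp_zero lin_zero[OF lin_vir] hform_commute[of \<gamma> \<phi>]
           flip: fock.scale_left_distrib fock.scale_left_diff_distrib fock.scale_minus_left)
         (simp add: n)
  qed
qed

text \<open>Descending induction on \<open>q\<close>: by \<open>scr_defect_heis\<close> the vector is killed by the positive modes,
  hence a multiple of the vacuum, whose weight is wrong unless \<open>q = - n\<close>.\<close>

lemma scr_defect_fexp: "scr_defect n q (fexp \<gamma>) = 0"
proof (induction "nat (1 - n - q)" arbitrary: q rule: less_induct)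
  case less
  have w: "scr_defect n q (fexp \<gamma>) \<in> wts {- n - q}"
    unfolding scr_defect_def
    by (intro wts_add wts_diff wts_scl; rule wts_mono)
       (rule vir_wts[OF vtx_wts[OF fexp_wts]] vtx_wts[OF vir_wts[OF fexp_wts]] vtx_wts[OF fexp_wts], force)+
  show ?case
  proof (cases "q + n > 0")
    case True
    show ?thesis by (rule wts_neg[OF w]) (use True in auto)
  next
    case False
    have F: "scr_defect n q (fexp \<gamma>) \<in> Fock_module (\<gamma> + \<phi>)"
      unfolding scr_defect_def by (intro Fock_intros vir_Fock vtx_Fock)
    have "heis \<delta> k (scr_defect n q (fexp \<gamma>)) = 0" if "k > 0" for \<delta> k
    proof -
      have "scr_defect n (q + k) (fexp \<gamma>) = 0"
        by (rule less) (use that False in auto)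
      then show ?thesis
        using scr_defect_heis[of n q \<delta> k "fexp \<gamma>"] that by (simp add: heis_fexp lin_zero[OF lin_scr_defect])
    qed
    then have e: "scr_defect n q (fexp \<gamma>) =
        scl (Poly_Mapping.lookup (scr_defect n q (fexp \<gamma>)) ({#}, \<gamma> + \<phi>)) (fexp (\<gamma> + \<phi>))"
      by (rule Fock_vacuum[OF F])
    show ?thesis
    proof (cases "q = - n")
      case True
      then show ?thesis by (simp add: scr_defect_fexp_diag)
    next
      case False
      have "Poly_Mapping.lookup (scr_defect n q (fexp \<gamma>)) ({#}, \<gamma> + \<phi>) = 0"
        by (rule lookup_wts[OF w]) (use False in auto)
      then show ?thesis using e by simp
    qed
  qed
qed

lemma vir_vtx_comm:
  assumes "v \<in> Fock_module \<gamma>"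
  shows "vir \<rho> n (vtx \<phi> q v) = vtx \<phi> q (vir \<rho> n v) - scl (of_int (q - p)) (vtx \<phi> (q + n) v)"
proof -
  have "\<forall>q. scr_defect n q v = 0"
    using assms
    by (induction rule: Fock_module_induct)
       (simp_all add: scr_defect_fexp scr_defect_heis lin_add[OF lin_scr_defect] lin_scl[OF lin_scr_defect])
  then have "scr_defect n q v = 0" ..
  then show ?thesis by (simp add: scr_defect_def algebra_simps)
qed

end

section \<open>The screening operator as a mode\<close>

lemma z_phi0_Fock:
  assumes "v \<in> Fock_module \<gamma>" "hform \<phi> \<gamma> = of_int l"
  shows "z_phi0 \<phi> m v = (if m = l then v else 0)"
  by (rule Fock_module_additive_eqI[OF assms(1)])
     (use assms(2) in \<open>auto simp: z_phi0_def\<close>)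

text \<open>On M(1,\<gamma>) the factor with exponent \<phi>(0) is z^(p-1), so the residue forces
  \<open>j = i + p\<close> and the double sum collapses to one diagonal.\<close>

lemma screening_eq_vtx:
  assumes v: "v \<in> Fock_module \<gamma>" and l: "hform (phi cLI) \<gamma> = of_int p - 1"
  shows "screening cLI v = vtx (phi cLI) p v"
proof -
  let ?\<phi> = "phi cLI"
  obtain N where N: "v \<in> wts {..N}" using wts_bounded by blast
  obtain K where K: "int K > N - p" using ex_nat_bound by blast
  let ?g = "\<lambda>(i, j). creat ?\<phi> i (annih ?\<phi> j (exp_shift ?\<phi> (z_phi0 ?\<phi> (int j - int i - 1) v)))"
  let ?A = "{i. i < K \<and> int i + p \<ge> 0}"
  let ?h = "\<lambda>i. (i, nat (int i + p))"
  have l': "hform ?\<phi> \<gamma> = of_int (p - 1)" using l by simp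
  have g: "?g (i, j) = (if int j = int i + p then creat ?\<phi> i (annih ?\<phi> j (exp_shift ?\<phi> v)) else 0)" for i j
    unfolding prod.case z_phi0_Fock[OF v l']
    by (auto simp: lin_zero[OF lin_shift] lin_zero[OF lin_annih] lin_zero[OF lin_creat])
  have "screening cLI v = Sum_any ?g"
    unfolding screening_def ..
  also have "\<dots> = sum ?g (?h ` ?A)"
  proof (rule Sum_any.expand_superset)
    show "{a. ?g a \<noteq> 0} \<subseteq> ?h ` ?A"
    proof
      fix a assume a: "a \<in> {a. ?g a \<noteq> 0}"
      obtain i j where ij: "a = (i, j)" by (cases a)
      have j: "int j = int i + p" and nz: "annih ?\<phi> j (exp_shift ?\<phi> v) \<noteq> 0"
        using a unfolding ij mem_Collect_eq g by (auto simp: lin_zero[OF lin_creat] split: if_splits)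
      have "int j \<le> N"
        using nz annih_vanish[OF exp_shift_wts[OF N], of j ?\<phi> ?\<phi>] by (meson not_le)
      with j K have "i \<in> ?A" "j = nat (int i + p)" by auto
      then show "a \<in> ?h ` ?A" using ij by blast
    qed
  qed simp
  also have "\<dots> = (\<Sum>i\<in>?A. ?g (?h i))"
    by (rule sum.reindex_cong[of ?h]) (auto simp: inj_on_def)
  also have "\<dots> = (\<Sum>i<K. if int i + p \<ge> 0 then creat ?\<phi> i (annih ?\<phi> (nat (int i + p)) (exp_shift ?\<phi> v)) else 0)"
    unfolding g by (rule sum.mono_neutral_cong_left) auto
  finally show ?thesis unfolding vtx_sum[OF N K] .
qed

section \<open>Filtrations by degree\<close>

text \<open>\<open>fil A B \<gamma> m\<close> describes the vectors of degree less than \<open>m\<close> in the modes from \<open>B\<close>, with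
  polynomials in the modes from \<open>A\<close> as coefficients. The shift by one makes level \<open>0\<close> the zero
  space, so that truncated subtraction of levels causes no harm.\<close>

inductive fil :: "(cartan \<times> int) set \<Rightarrow> (cartan \<times> int) set \<Rightarrow> cartan \<Rightarrow> nat \<Rightarrow> fock \<Rightarrow> bool"
  for A B \<gamma> where
  fil_zero: "fil A B \<gamma> m 0"
| fil_vac: "fil A B \<gamma> (Suc m) (fexp \<gamma>)"
| fil_add: "fil A B \<gamma> m u \<Longrightarrow> fil A B \<gamma> m v \<Longrightarrow> fil A B \<gamma> m (u + v)"
| fil_scl: "fil A B \<gamma> m v \<Longrightarrow> fil A B \<gamma> m (scl a v)"
| fil_low: "(\<delta>, n) \<in> A \<Longrightarrow> fil A B \<gamma> m v \<Longrightarrow> fil A B \<gamma> m (heis \<delta> n v)"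
| fil_raise: "(\<delta>, n) \<in> B \<Longrightarrow> fil A B \<gamma> m v \<Longrightarrow> fil A B \<gamma> (Suc m) (heis \<delta> n v)"

lemma fil_subspace: "fock.subspace {v. fil A B \<gamma> m v}"
  by (simp add: fock.subspace_def fil_zero fil_add fil_scl)

lemma fil_diff: "fil A B \<gamma> m u \<Longrightarrow> fil A B \<gamma> m v \<Longrightarrow> fil A B \<gamma> m (u - v)"
  using fock.subspace_diff[OF fil_subspace] by simp

lemma fil_neg: "fil A B \<gamma> m v \<Longrightarrow> fil A B \<gamma> m (- v)"
  using fil_diff[OF fil_zero] by simp

lemma fil_sum: "(\<And>i. i \<in> I \<Longrightarrow> fil A B \<gamma> m (f i)) \<Longrightarrow> fil A B \<gamma> m (\<Sum>i\<in>I. f i)"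
  using fock.subspace_sum[OF fil_subspace, of I f] by simp

lemma fil_level_zero: "fil A B \<gamma> 0 v \<Longrightarrow> v = 0"
proof -
  have "fil A B \<gamma> m v \<Longrightarrow> m = 0 \<Longrightarrow> v = 0" for m
    by (induction rule: fil.induct) auto
  then show "fil A B \<gamma> 0 v \<Longrightarrow> v = 0" by blast
qed

lemma fil_level_zero_iff [simp]: "fil A B \<gamma> 0 v \<longleftrightarrow> v = 0"
  using fil_level_zero fil_zero by blast

lemma fil_Suc: "fil A B \<gamma> m v \<Longrightarrow> fil A B \<gamma> (Suc m) v"
  by (induction rule: fil.induct) (auto intro: fil.intros)

lemma fil_mono: "fil A B \<gamma> m v \<Longrightarrow> m \<le> m' \<Longrightarrow> fil A B \<gamma> m' v"
  by (rule lift_Suc_mono_le[of "\<lambda>m. {v. fil A B \<gamma> m v}", THEN subsetD, simplified])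
     (auto intro: fil_Suc)

lemma fil_Fock: "fil A B \<gamma> m v \<Longrightarrow> v \<in> Fock_module \<gamma>"
  by (induction rule: fil.induct) (auto intro: Fock_intros)

text \<open>A positive mode kills the vacuum and acts as a derivation. As it commutes with the modes
  from A, it can only remove a mode from B, which costs one degree.\<close>

lemma fil_lower:
  assumes k: "k > 0" and comm: "\<And>\<delta>' n. (\<delta>', n) \<in> A \<Longrightarrow> k + n = 0 \<Longrightarrow> hform \<delta> \<delta>' = 0"
  shows "fil A B \<gamma> m v \<Longrightarrow> fil A B \<gamma> (m - 1) (heis \<delta> k v)"
proof (induction rule: fil.induct)
  case (fil_low \<delta>' n m v)
  then have "heis \<delta> k (heis \<delta>' n v) = heis \<delta>' n (heis \<delta> k v)"
    using comm by (simp add: heis_swap[of \<delta> k])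
  then show ?case using fil_low fil.fil_low by metis
next
  case (fil_raise \<delta>' n m v)
  show ?case
  proof (cases m)
    case (Suc m')
    then have "fil A B \<gamma> m (heis \<delta>' n (heis \<delta> k v))"
      using fil.fil_raise[OF fil_raise(1,3)] by simp
    then show ?thesis
      using fil_raise(2) by (auto simp: heis_swap[of \<delta> k] intro!: fil_add intro: fil_scl)
  qed (use fil_raise in simp)
qed (use k in \<open>auto simp: heis_fexp heis_add heis_scl intro: fil.intros\<close>)

lemma fil_mono_sets:
  assumes "A \<subseteq> A'" "B \<subseteq> B'"
  shows "fil A B \<gamma> m v \<Longrightarrow> fil A' B' \<gamma> m v"
  by (induction rule: fil.induct) (use assms in \<open>auto intro: fil.intros\<close>)

lemma fil_exp_shift:
  assumes "\<And>\<delta> n. (\<delta>, n) \<in> A \<union> B \<Longrightarrow> n \<noteq> 0"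
  shows "fil A B \<gamma> m v \<Longrightarrow> fil A B (\<gamma> + \<phi>) m (exp_shift \<phi> v)"
proof (induction rule: fil.induct)
  case (fil_low \<delta> n m v)
  then have "n \<noteq> 0" using assms by blast
  then have "exp_shift \<phi> (heis \<delta> n v) = heis \<delta> n (exp_shift \<phi> v)"
    by (simp add: heis_exp_shift)
  then show ?case using fil_low fil.fil_low by metis
next
  case (fil_raise \<delta> n m v)
  then have "n \<noteq> 0" using assms by blast
  then have "exp_shift \<phi> (heis \<delta> n v) = heis \<delta> n (exp_shift \<phi> v)"
    by (simp add: heis_exp_shift)
  then show ?case using fil_raise fil.fil_raise by metis
qed (auto simp: lin_zero[OF lin_shift] lin_add[OF lin_shift] lin_scl[OF lin_shift] exp_shift_fexp
      intro: fil.intros)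

section \<open>Euler operators and reduction to degree zero\<close>

context
  fixes A :: "(cartan \<times> int) set" and \<gamma> b b' :: cartan and S :: "nat set"
  assumes S: "0 \<notin> S" and A: "\<And>\<delta> n. (\<delta>, n) \<in> A \<Longrightarrow> n < 0"
    and A_comm: "\<And>\<delta> n k. (\<delta>, n) \<in> A \<Longrightarrow> k \<in> S \<Longrightarrow> int k + n = 0 \<Longrightarrow> hform b' \<delta> = 0"
    and dual: "hform b' b = 2"
begin

abbreviation (input) "Bset \<equiv> {(b, - int k) |k. k \<in> S}"

text \<open>The Euler operator summing x_k d/dx_k over the variables x_k = b(-k): since
  \<open>hform b' b = 2\<close>, the mode b'(k) acts as 2k d/dx_k, whence the normalisation. A given
  vector involves only finitely many variables, so finite T suffice.\<close>

definition euler :: "nat set \<Rightarrow> fock \<Rightarrow> fock" where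
  "euler T v = (\<Sum>k\<in>T. scl (1 / (2 * of_nat k)) (heis b (- int k) (heis b' (int k) v)))"

lemma lin_euler: "lin (euler T)"
  unfolding euler_def[abs_def] by (intro lin_sum_fun lin_scl_fun lin_comp[OF lin_heis lin_heis])

lemma euler_low:
  assumes "(\<delta>, n) \<in> A" "T \<subseteq> S"
  shows "euler T (heis \<delta> n v) = heis \<delta> n (euler T v)"
proof -
  have "heis b (- int k) (heis b' (int k) (heis \<delta> n v)) = heis \<delta> n (heis b (- int k) (heis b' (int k) v))"
    if "k \<in> T" for k
  proof -
    have "k \<in> S" "n < 0" using that assms A by auto
    then show ?thesis
      using A_comm[OF assms(1) \<open>k \<in> S\<close>]
      by (simp add: heis_swap[of b' "int k" \<delta>] heis_swap[of b "- int k" \<delta>])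
  qed
  then show ?thesis by (simp add: euler_def lin_sum[OF lin_heis] heis_scl)
qed

lemma euler_raise:
  assumes "finite T" "T \<subseteq> S" "l \<in> T"
  shows "euler T (heis b (- int l) v) = heis b (- int l) (euler T v) + heis b (- int l) v"
proof -
  have "scl (1 / (2 * of_nat k)) (heis b (- int k) (heis b' (int k) (heis b (- int l) v)))
      = heis b (- int l) (scl (1 / (2 * of_nat k)) (heis b (- int k) (heis b' (int k) v)))
        + (if k = l then heis b (- int l) v else 0)"
    if "k \<in> T" for k
  proof -
    have "k \<noteq> 0" using that assms(2) S by (metis subsetD)
    then show ?thesis
      by (auto simp: heis_swap[of b' "int k" b] heis_swap[of b "- int k" b "- int l"] heis_add heis_scl dual
          fock.scale_right_distrib)
  qed
  then show ?thesis
    using assms by (simp add: euler_def lin_sum[OF lin_heis] sum.distrib)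
qed

text \<open>Level m means degree at most \<open>m - 1\<close>, hence the factor
  \<open>of_nat (m - 1)\<close>. Claiming this for all finite T beyond T0, rather than for one T,
  lets the summands of a vector share a common T.\<close>

lemma euler_grade:
  "fil A Bset \<gamma> m v \<Longrightarrow> \<exists>T0. finite T0 \<and> T0 \<subseteq> S \<and>
     (\<forall>T. finite T \<and> T0 \<subseteq> T \<and> T \<subseteq> S \<longrightarrow> fil A Bset \<gamma> (m - 1) (euler T v - scl (of_nat (m - 1)) v))"
proof (induction rule: fil.induct)
  case (fil_zero m)
  show ?case by (rule exI[of _ "{}"]) (auto simp: lin_zero[OF lin_euler] fil.fil_zero)
next
  case (fil_vac m)
  have "euler T (fexp \<gamma>) = 0" if "T \<subseteq> S" for T
  proof -
    have "int k > 0" if "k \<in> T" for k using that \<open>T \<subseteq> S\<close> S by (metis gr0I of_nat_0_less_iff subsetD)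
    then show ?thesis by (simp add: euler_def heis_fexp)
  qed
  moreover have "fil A Bset \<gamma> m (scl (of_nat m) (fexp \<gamma>))"
    by (cases m) (auto intro: fil.fil_scl fil.fil_vac)
  from fil_diff[OF fil.fil_zero this] have "fil A Bset \<gamma> m (- scl (of_nat m) (fexp \<gamma>))" by simp
  ultimately show ?case by (intro exI[of _ "{}"]) auto
next
  case (fil_add m u v)
  obtain T0 where T0: "finite T0" "T0 \<subseteq> S"
    and u: "\<forall>T. finite T \<and> T0 \<subseteq> T \<and> T \<subseteq> S \<longrightarrow> fil A Bset \<gamma> (m - 1) (euler T u - scl (of_nat (m - 1)) u)"
    using fil_add.IH(1) by (elim exE conjE)
  obtain T1 where T1: "finite T1" "T1 \<subseteq> S"
    and v: "\<forall>T. finite T \<and> T1 \<subseteq> T \<and> T \<subseteq> S \<longrightarrow> fil A Bset \<gamma> (m - 1) (euler T v - scl (of_nat (m - 1)) v)"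
    using fil_add.IH(2) by (elim exE conjE)
  have e: "euler T (u + v) - scl (of_nat (m - 1)) (u + v) =
      (euler T u - scl (of_nat (m - 1)) u) + (euler T v - scl (of_nat (m - 1)) v)" for T
    by (simp add: lin_add[OF lin_euler] fock.scale_right_distrib)
  show ?case
    unfolding e by (rule exI[of _ "T0 \<union> T1"]) (use T0 T1 u v in \<open>auto intro!: fil.fil_add\<close>)
next
  case (fil_scl m v a)
  have e: "euler T (scl a v) - scl (of_nat (m - 1)) (scl a v) = scl a (euler T v - scl (of_nat (m - 1)) v)" for T
    by (simp add: lin_scl[OF lin_euler] fock.scale_right_diff_distrib mult.commute)
  obtain T0 where T: "finite T0" "T0 \<subseteq> S"
    and v: "\<forall>T. finite T \<and> T0 \<subseteq> T \<and> T \<subseteq> S \<longrightarrow> fil A Bset \<gamma> (m - 1) (euler T v - scl (of_nat (m - 1)) v)"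
    using fil_scl.IH by (elim exE conjE)
  show ?case
    unfolding e by (rule exI[of _ T0]) (use T v in \<open>auto intro!: fil.fil_scl\<close>)
next
  case (fil_low \<delta> n m v)
  obtain T0 where T: "finite T0" "T0 \<subseteq> S"
    and v: "\<forall>T. finite T \<and> T0 \<subseteq> T \<and> T \<subseteq> S \<longrightarrow> fil A Bset \<gamma> (m - 1) (euler T v - scl (of_nat (m - 1)) v)"
    using fil_low.IH by (elim exE conjE)
  have e: "euler T (heis \<delta> n v) - scl (of_nat (m - 1)) (heis \<delta> n v) = heis \<delta> n (euler T v - scl (of_nat (m - 1)) v)"
    if "T \<subseteq> S" for T
    using fil_low(1) that by (simp add: euler_low lin_diff[OF lin_heis] heis_scl)
  show ?case
  proof (rule exI[of _ T0], intro conjI allI impI T)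
    fix T assume "finite T \<and> T0 \<subseteq> T \<and> T \<subseteq> S"
    then show "fil A Bset \<gamma> (m - 1) (euler T (heis \<delta> n v) - scl (of_nat (m - 1)) (heis \<delta> n v))"
      using v e fil.fil_low[OF fil_low(1)] by simp
  qed
next
  case (fil_raise \<delta> n m v)
  then obtain l where l: "\<delta> = b" "n = - int l" "l \<in> S" by blast
  obtain T0 where T: "finite T0" "T0 \<subseteq> S"
    and v: "\<forall>T. finite T \<and> T0 \<subseteq> T \<and> T \<subseteq> S \<longrightarrow> fil A Bset \<gamma> (m - 1) (euler T v - scl (of_nat (m - 1)) v)"
    using fil_raise.IH by (elim exE conjE)
  show ?case
  proof (cases m)
    case 0
    then have "v = 0" using fil_raise(2) by simp
    then show ?thesis by (intro exI[of _ "{}"]) (auto simp: lin_zero[OF lin_euler] fil.fil_zero)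
  next
    case (Suc m')
    have e: "euler T (heis \<delta> n v) - scl (of_nat (Suc m - 1)) (heis \<delta> n v) = heis \<delta> n (euler T v - scl (of_nat (m - 1)) v)"
      if "finite T" "insert l T0 \<subseteq> T" "T \<subseteq> S" for T
      using that by (simp add: l euler_raise lin_diff[OF lin_heis] heis_scl Suc fock.scale_left_distrib)
    show ?thesis
    proof (rule exI[of _ "insert l T0"], intro conjI allI impI)
      fix T assume asm: "finite T \<and> insert l T0 \<subseteq> T \<and> T \<subseteq> S"
      then have "fil A Bset \<gamma> (Suc (m - 1)) (heis \<delta> n (euler T v - scl (of_nat (m - 1)) v))"
        by (intro fil.fil_raise[OF fil_raise(1)] v[rule_format]) auto
      then show "fil A Bset \<gamma> (Suc m - 1) (euler T (heis \<delta> n v) - scl (of_nat (Suc m - 1)) (heis \<delta> n v))"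
        using e asm Suc by simp
    qed (use T l in auto)
  qed
qed

text \<open>A vector of level \<open>m + 1 > 1\<close> killed by all dual modes is killed by the Euler operator, which
  is multiplication by \<open>m\<close> modulo level \<open>m\<close>; so it has level \<open>m\<close>.\<close>

lemma fil_reduce:
  assumes N: "fock.subspace N"
    and closed: "\<And>m v k. v \<in> N \<Longrightarrow> fil A Bset \<gamma> m v \<Longrightarrow> k \<in> S \<Longrightarrow> heis b' (int k) v \<in> N"
  shows "v \<in> N \<Longrightarrow> v \<noteq> 0 \<Longrightarrow> fil A Bset \<gamma> m v \<Longrightarrow> \<exists>w\<in>N. w \<noteq> 0 \<and> fil A Bset \<gamma> 1 w"
proof (induction m arbitrary: v)
  case (Suc m)
  show ?case
  proof (cases m)
    case 0
    then show ?thesis using Suc.prems by (intro bexI[of _ v]) auto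
  next
    case (Suc m')
    show ?thesis
    proof (cases "\<exists>k\<in>S. heis b' (int k) v \<noteq> 0")
      case True
      then obtain k where k: "k \<in> S" "heis b' (int k) v \<noteq> 0" by blast
      have "int k > 0" using k S by (metis gr0I of_nat_0_less_iff)
      then have "fil A Bset \<gamma> (Suc m - 1) (heis b' (int k) v)"
        using Suc.prems(3) A_comm k(1) by (intro fil_lower) blast+
      then show ?thesis
        using Suc.IH[of "heis b' (int k) v"] closed[OF Suc.prems(1,3) k(1)] k(2) by simp
    next
      case False
      then have e: "euler T v = 0" if "T \<subseteq> S" for T using that by (auto simp: euler_def subset_iff)
      obtain T0 where T0: "finite T0" "T0 \<subseteq> S"
        "fil A Bset \<gamma> (Suc m - 1) (euler T0 v - scl (of_nat (Suc m - 1)) v)"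
        using euler_grade[OF Suc.prems(3)] by blast
      then have "fil A Bset \<gamma> m (scl (- 1 / of_nat m) (- scl (of_nat m) v))"
        by (intro fil_scl) (simp add: e)
      moreover have "(of_nat m :: complex) \<noteq> 0"
        using \<open>m = Suc m'\<close> by (simp only: of_nat_eq_0_iff)
      ultimately have "fil A Bset \<gamma> m v" by simp
      then show ?thesis using Suc.IH Suc.prems by blast
    qed
  qed
qed simp

end

section \<open>The screening operator and the filtration\<close>

definition light_modes :: "(cartan \<times> int) set" where
  "light_modes = {((1, 1), - int n) |n. n > 0}"

definition dual_modes :: "(cartan \<times> int) set" where
  "dual_modes = {((1, -1), - int n) |n. n > 0}"

abbreviation Fil :: "cartan \<Rightarrow> nat \<Rightarrow> fock \<Rightarrow> bool" where
  "Fil \<equiv> fil light_modes dual_modes"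

lemma light_modesI: "n > 0 \<Longrightarrow> ((1, 1), - int n) \<in> light_modes"
  and dual_modesI: "n > 0 \<Longrightarrow> ((1, -1), - int n) \<in> dual_modes"
  by (auto simp: light_modes_def dual_modes_def)

lemma Fil_light: "n > 0 \<Longrightarrow> Fil \<gamma> m v \<Longrightarrow> Fil \<gamma> m (heis (1, 1) (- int n) v)"
  and Fil_dual: "n > 0 \<Longrightarrow> Fil \<gamma> m v \<Longrightarrow> Fil \<gamma> (Suc m) (heis (1, -1) (- int n) v)"
  by (auto intro: fil_low fil_raise light_modesI dual_modesI)

lemma Fil_light_pos: "k > 0 \<Longrightarrow> Fil \<gamma> m v \<Longrightarrow> Fil \<gamma> (m - 1) (heis (1, 1) k v)"
  by (rule fil_lower) (auto simp: light_modes_def hform_def)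

lemma Fil_exp_shift: "Fil \<gamma> m v \<Longrightarrow> Fil (\<gamma> + \<phi>) m (exp_shift \<phi> v)"
  by (rule fil_exp_shift) (auto simp: light_modes_def dual_modes_def)

lemma heis_light_dual:
  "heis \<delta> n v = scl ((fst \<delta> + snd \<delta>) / 2) (heis (1, 1) n v) + scl ((fst \<delta> - snd \<delta>) / 2) (heis (1, -1) n v)"
  unfolding heis_eq_gen[of \<delta>] heis_eq_gen[of "(1, 1)"] heis_eq_gen[of "(1, -1)"]
  by (intro poly_mapping_eqI) (simp add: lookup_add lookup_minus field_simps)

lemma Fil_ex: "v \<in> Fock_module \<gamma> \<Longrightarrow> \<exists>m. Fil \<gamma> m v"
proof (induction rule: Fock_module_induct)
  case vac
  show ?case using fil_vac by blast
next
  case (add u v)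
  then obtain m m' where "Fil \<gamma> m u" "Fil \<gamma> m' v" by blast
  then have "Fil \<gamma> (max m m') u" "Fil \<gamma> (max m m') v" by (auto intro: fil_mono)
  then show ?case by (blast intro: fil_add)
next
  case (scl a v)
  then show ?case by (blast intro: fil_scl)
next
  case (heis \<delta> n v)
  then obtain m where "Fil \<gamma> m v" by blast
  then show ?case
    using heis(1) unfolding heis_light_dual[of \<delta>]
    by (intro exI[of _ "Suc m"] fil_add fil_scl Fil_dual fil_Suc[OF Fil_light])
qed

lemma heis_phi: "heis (phi cLI) n v = scl (- 1 / cLI) (heis (1, 1) n v)"
  using heis_linear_scl[of "- 1 / cLI" "(1, 1)" n v] by (simp add: phi_def)

lemma Fil_creat:
  assumes "Fil \<gamma> m v"
  shows "Fil \<gamma> m (creat (phi cLI) i v)"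
proof (cases "i = 0")
  case False
  have "creat (phi cLI) i v \<in> {v. Fil \<gamma> m v}"
    by (rule ops_exp_mem[OF fil_subspace fil_subspace subset_refl])
       (use assms False in \<open>auto simp: creation_series_def heis_phi fil_zero intro!: fil_scl Fil_light
          simp del: fock.scale_minus_left scale_minus_left\<close>)
  then show ?thesis by simp
qed (use assms in simp)

lemma Fil_annih:
  assumes "Fil \<gamma> m v" "j > 0"
  shows "Fil \<gamma> (m - 1) (annih (phi cLI) j v)"
proof -
  have "annih (phi cLI) j v \<in> {v. Fil \<gamma> (m - 1) v}"
    by (rule ops_exp_mem[OF fil_subspace[where m = m] fil_subspace[where m = "m - 1"]])
       (use assms in \<open>auto simp: annihilation_series_def heis_phi fil_zero
          intro!: fil_scl Fil_light_pos intro: fil_mono simp del: fock.scale_minus_left One_nat_def\<close>)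
  then show ?thesis by simp
qed

text \<open>For \<open>q > 0\<close> each term has \<open>j = i + q > 0\<close>, so at least one
  positive mode of c occurs; creation modes and the shift keep the level.\<close>

lemma Fil_vtx:
  assumes "Fil \<gamma> m v" "q > 0"
  shows "Fil (\<gamma> + phi cLI) (m - 1) (vtx (phi cLI) q v)"
proof -
  have "vtx (phi cLI) q v \<in> {v. Fil (\<gamma> + phi cLI) (m - 1) v}"
    by (rule vtx_mem[OF fil_subspace]) (use assms in \<open>auto intro!: Fil_creat Fil_annih Fil_exp_shift simp del: One_nat_def\<close>)
  then show ?thesis by simp
qed

text \<open>The term \<open>i = j = 0\<close> is the bare shift; all others contain a positive mode
  of c and lose a level.\<close>

lemma Fil_vtx_zero:
  assumes "Fil \<gamma> m v"
  shows "Fil (\<gamma> + phi cLI) (m - 1) (vtx (phi cLI) 0 v - exp_shift (phi cLI) v)"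
proof -
  obtain N where v: "v \<in> wts {..N}" using wts_bounded by blast
  obtain K where "int K > N" using ex_nat_bound by blast
  then have K: "int (Suc K) > N - 0" by simp
  have "vtx (phi cLI) 0 v - exp_shift (phi cLI) v =
      (\<Sum>i<K. creat (phi cLI) (Suc i) (annih (phi cLI) (Suc i) (exp_shift (phi cLI) v)))"
    unfolding vtx_sum[OF v K] sum.lessThan_Suc_shift by (simp del: of_nat_Suc)
  then show ?thesis
    by (auto intro!: fil_sum Fil_creat Fil_annih Fil_exp_shift assms simp del: One_nat_def)
qed

lemma exp_shift_vtx: "exp_shift \<psi> (vtx \<phi> q v) = vtx \<phi> q (exp_shift \<psi> v)"
proof -
  have c: "exp_shift \<psi> (creat \<phi> i u) = creat \<phi> i (exp_shift \<psi> u)" for i u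
    by (rule ops_exp_comm_zero[OF lin_creation lin_shift])
       (auto simp: creation_series_def lin_scl[OF lin_shift] lin_zero[OF lin_shift] heis_exp_shift)
  have a: "exp_shift \<psi> (annih \<phi> i u) = annih \<phi> i (exp_shift \<psi> u)" for i u
    by (rule ops_exp_comm_zero[OF lin_annihilation lin_shift])
       (auto simp: annihilation_series_def lin_scl[OF lin_shift] lin_zero[OF lin_shift] heis_exp_shift
          lin_minus[OF lin_shift])
  have s: "exp_shift \<psi> (exp_shift \<phi> u) = exp_shift \<phi> (exp_shift \<psi> u)" for u
    by (rule fock_additive_eqI[where v = u]) (simp_all add: lin_add[OF lin_shift] add_ac)
  obtain N where v: "v \<in> wts {..N}" using wts_bounded by blast
  obtain K where K: "int K > N - q" using ex_nat_bound by blast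
  show ?thesis
    unfolding vtx_sum[OF v K] vtx_sum[OF exp_shift_wts[OF v] K] lin_sum[OF lin_shift]
    by (intro sum.cong refl) (simp add: c a s lin_zero[OF lin_shift])
qed

lemma exp_shift_iter: "(exp_shift \<phi> ^^ n) (exp_shift \<phi> v) = exp_shift \<phi> ((exp_shift \<phi> ^^ n) v)"
  by (simp add: funpow_swap1)

definition translate :: "cartan \<Rightarrow> nat \<Rightarrow> cartan \<Rightarrow> cartan" where
  "translate \<phi> n \<gamma> = (fst \<gamma> + of_nat n * fst \<phi>, snd \<gamma> + of_nat n * snd \<phi>)"

lemma translate_0 [simp]: "translate \<phi> 0 \<gamma> = \<gamma>"
  and translate_Suc: "translate \<phi> (Suc n) \<gamma> = translate \<phi> n \<gamma> + \<phi>"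
  and translate_Suc': "translate \<phi> (Suc n) \<gamma> = translate \<phi> n (\<gamma> + \<phi>)"
  by (simp_all add: translate_def prod_eq_iff algebra_simps)

lemma Fil_unshift: "Fil (translate \<phi> n \<gamma>) m ((exp_shift \<phi> ^^ n) v) \<Longrightarrow> Fil \<gamma> m v"
proof (induction n arbitrary: v)
  case (Suc n)
  from Fil_exp_shift[OF Suc.prems, of "- \<phi>"] show ?case
    by (intro Suc.IH) (simp add: exp_shift_inverse translate_Suc)
qed simp

lemma exp_shift_iter_fexp: "(exp_shift \<phi> ^^ n) (fexp \<gamma>) = fexp (translate \<phi> n \<gamma>)"
  by (induction n) (simp_all add: exp_shift_fexp translate_Suc)

section \<open>Powers of Q on powers of d(-p)\<close>

locale hv_realization =
  fixes cL cLI :: complex and p :: nat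
  assumes cLI: "cLI \<noteq> 0" and p_pos: "p > 0"
begin

abbreviation "\<phi> \<equiv> phi cLI"
abbreviation "\<rho> \<equiv> (lam cL cLI, mu cL cLI)"
abbreviation "Q \<equiv> vtx \<phi> (int p)"
abbreviation "X \<equiv> heis (1, -1) (- int p)"
abbreviation "\<kappa> \<equiv> 2 / cLI"
abbreviation "act \<equiv> hv_act cL cLI"

text \<open>The hypothesis on h_I, solved for \<open>r - s\<close>. It is stable under adding
  \<phi>, whose coordinates are equal, so it holds along the whole chain \<gamma> + n
  \<phi>.\<close>

definition level :: "cartan \<Rightarrow> bool" where
  "level \<gamma> \<longleftrightarrow> fst \<gamma> - snd \<gamma> = cLI * (1 - of_nat p)"

lemma phi_iso: "hform \<phi> \<phi> = 0"
  by (simp add: phi_def hform_def)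

lemma rho_phi: "hform \<rho> \<phi> = - 1"
  using cLI by (simp add: phi_def hform_def lam_def mu_def field_simps)

lemma light_phi: "hform (1, 1) \<phi> = 0"
  by (simp add: phi_def hform_def)

lemma level_phi: "level \<gamma> \<Longrightarrow> hform \<phi> \<gamma> = of_int (int p) - 1"
  using cLI by (auto simp: level_def hform_def phi_def field_simps)

lemma level_light: "level \<gamma> \<Longrightarrow> hform (1, 1) \<gamma> = cLI * (1 - of_nat p)"
  by (simp add: level_def hform_def)

lemma level_add: "level \<gamma> \<Longrightarrow> level (\<gamma> + \<phi>)"
  by (simp add: level_def phi_def)

lemma level_translate: "level \<gamma> \<Longrightarrow> level (translate \<phi> n \<gamma>)"
  by (induction n) (simp_all add: translate_Suc level_add)

lemma lin_Q: "lin Q" and lin_X: "lin X" and lin_Qn: "lin (Q ^^ n)" and lin_Xn: "lin (X ^^ n)"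
  by (intro lin_vtx lin_heis lin_funpow)+

lemma Q_act:
  assumes "level \<gamma>" "v \<in> Fock_module \<gamma>"
  shows "Q (act x v) = act x (Q v)"
proof (cases x)
  case (L_gen n)
  have "vir \<rho> n (Q v) = Q (vir \<rho> n v)"
    using vir_vtx_comm[OF phi_iso rho_phi level_phi[OF assms(1)] assms(2), of n "int p"] by simp
  then show ?thesis using L_gen by (simp only: hv_act_L)
next
  case (I_gen n)
  have "heis (1, 1) n (Q v) = Q (heis (1, 1) n v)"
    by (simp add: heis_vtx light_phi)
  then show ?thesis using I_gen by (simp only: hv_act_I)
qed (simp_all add: lin_scl[OF lin_Q] lin_zero[OF lin_Q])

lemma Qn_Fock: "v \<in> Fock_module \<gamma> \<Longrightarrow> (Q ^^ n) v \<in> Fock_module (translate \<phi> n \<gamma>)"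
  by (induction n) (simp_all add: translate_Suc vtx_Fock)

lemma Qn_act:
  assumes "level \<gamma>" "v \<in> Fock_module \<gamma>"
  shows "(Q ^^ n) (act x v) = act x ((Q ^^ n) v)"
  using assms
  by (induction n) (simp_all add: Q_act[OF level_translate Qn_Fock] del: hv_act.simps)

lemma screening_Q: "level \<gamma> \<Longrightarrow> v \<in> Fock_module \<gamma> \<Longrightarrow> screening cLI v = Q v"
  by (rule screening_eq_vtx) (auto dest: level_phi)

lemma screening_Qn: "level \<gamma> \<Longrightarrow> v \<in> Fock_module \<gamma> \<Longrightarrow> (screening cLI ^^ n) v = (Q ^^ n) v"
  by (induction n) (simp_all add: screening_Q[OF level_translate Qn_Fock])

lemma Fil_Q: "Fil \<gamma> m v \<Longrightarrow> Fil (\<gamma> + \<phi>) (m - 1) (Q v)"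
  using p_pos by (intro Fil_vtx) auto

lemma Fil_Qn: "Fil \<gamma> m v \<Longrightarrow> Fil (translate \<phi> n \<gamma>) (m - n) ((Q ^^ n) v)"
proof (induction n)
  case (Suc n)
  from Fil_Q[OF Suc.IH[OF Suc.prems]] show ?case by (simp add: translate_Suc)
qed simp

lemma Fil_X: "Fil \<gamma> m v \<Longrightarrow> Fil \<gamma> (Suc m) (X v)"
  using p_pos by (rule Fil_dual)

lemma Fil_Xn: "Fil \<gamma> m v \<Longrightarrow> Fil \<gamma> (m + n) ((X ^^ n) v)"
  by (induction n) (simp_all add: Fil_X)

text \<open>The bracket with d(-p) moves the mode index from p to 0, where the vertex operator is
  the shift up to lower level; \<open>\<kappa>\<close> is
  \<open>- hform (1, -1) \<phi>\<close>.\<close>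

lemma Q_X: "Q (X v) = X (Q v) + scl \<kappa> (vtx \<phi> 0 v)"
  using heis_vtx[of "(1, -1)" "- int p" \<phi> "int p" v]
  by (simp add: phi_def hform_def fock.scale_minus_left algebra_simps)

lemma exp_shift_X: "exp_shift \<psi> ((X ^^ n) v) = (X ^^ n) (exp_shift \<psi> v)"
proof -
  have "exp_shift \<psi> (X u) = X (exp_shift \<psi> u)" for u
    using p_pos by (simp add: heis_exp_shift)
  then show ?thesis by (induction n) simp_all
qed

lemma exp_shift_Q: "exp_shift \<psi> (Q v) = Q (exp_shift \<psi> v)"
  by (rule exp_shift_vtx)

text \<open>Modulo lower level, Q acts on powers of X as \<open>\<kappa>\<close> d/dX combined with
  the shift, provided that the coefficient g is killed by Q. Both terms have level
  \<open>k + j + 1\<close>, and the error is one lower.\<close>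

lemma Q_Xn:
  assumes "Fil \<gamma> (Suc k) g" "Q g = 0"
  shows "Fil (\<gamma> + \<phi>) (k + j) (Q ((X ^^ Suc j) g) - scl (of_nat (Suc j) * \<kappa>) ((X ^^ j) (exp_shift \<phi> g)))"
proof (induction j)
  case 0
  have e: "Q ((X ^^ Suc 0) g) - scl (of_nat (Suc 0) * \<kappa>) ((X ^^ 0) (exp_shift \<phi> g))
      = scl \<kappa> (vtx \<phi> 0 g - exp_shift \<phi> g)"
    by (simp add: Q_X assms lin_zero[OF lin_X] fock.scale_right_diff_distrib)
  show ?case unfolding e using fil_scl[OF Fil_vtx_zero[OF assms(1)]] by simp
next
  case (Suc j)
  let ?u = "(X ^^ Suc j) g"
  have e: "Q ((X ^^ Suc (Suc j)) g) - scl (of_nat (Suc (Suc j)) * \<kappa>) ((X ^^ Suc j) (exp_shift \<phi> g))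
      = X (Q ?u - scl (of_nat (Suc j) * \<kappa>) ((X ^^ j) (exp_shift \<phi> g))) + scl \<kappa> (vtx \<phi> 0 ?u - exp_shift \<phi> ?u)"
  proof -
    have "scl (of_nat (Suc (Suc j)) * \<kappa>) w = scl \<kappa> w + scl (of_nat (Suc j) * \<kappa>) w" for w
      unfolding of_nat_Suc[of "Suc j"] by (simp only: distrib_right mult_1 fock.scale_left_distrib)
    then show ?thesis
      unfolding exp_shift_X lin_diff[OF lin_X] lin_scl[OF lin_X]
      by (simp add: Q_X fock.scale_right_diff_distrib del: of_nat_Suc)
  qed
  have "Fil \<gamma> (Suc (k + Suc j)) ?u"
    using Fil_Xn[OF assms(1), of "Suc j"] by simp
  from fil_scl[OF Fil_vtx_zero[OF this]] Fil_X[OF Suc]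
  show ?case unfolding e by (intro fil_add) simp_all
qed

text \<open>Iterating the derivative gives \<open>\<kappa> ^ n * fact n\<close>. For g = e^\<gamma>
  one has \<open>k = 0\<close>, and as level 0 is the zero space the congruence becomes an equation;
  this yields \<open>Qn_cosing\<close>.\<close>

lemma Qn_Xn:
  assumes "Fil \<gamma> (Suc k) g" "Q g = 0"
  shows "Fil (translate \<phi> n \<gamma>) k ((Q ^^ n) ((X ^^ n) g) - scl (\<kappa> ^ n * fact n) ((exp_shift \<phi> ^^ n) g))"
  using assms
proof (induction n arbitrary: g \<gamma>)
  case (Suc n)
  let ?g = "exp_shift \<phi> g" and ?c = "of_nat (Suc n) * \<kappa>"
  define err where "err = Q ((X ^^ Suc n) g) - scl ?c ((X ^^ n) ?g)"
  have "Fil (\<gamma> + \<phi>) (k + n) err" unfolding err_def by (rule Q_Xn[OF Suc.prems])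
  from Fil_Qn[OF this, of n] have 1: "Fil (translate \<phi> (Suc n) \<gamma>) k ((Q ^^ n) err)"
    by (simp add: translate_Suc')
  have "Fil (\<gamma> + \<phi>) (Suc k) ?g" "Q ?g = 0"
    using Fil_exp_shift[OF Suc.prems(1)] Suc.prems(2) exp_shift_Q[of \<phi> g] by (auto simp: lin_zero[OF lin_shift])
  from fil_scl[OF Suc.IH[OF this], of ?c]
  have 2: "Fil (translate \<phi> (Suc n) \<gamma>) k
      (scl ?c ((Q ^^ n) ((X ^^ n) ?g) - scl (\<kappa> ^ n * fact n) ((exp_shift \<phi> ^^ n) ?g)))"
    by (simp add: translate_Suc')
  have "(Q ^^ Suc n) ((X ^^ Suc n) g) = (Q ^^ n) (scl ?c ((X ^^ n) ?g) + err)"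
    by (simp add: err_def funpow_swap1 del: of_nat_Suc)
  also have "\<dots> = scl ?c ((Q ^^ n) ((X ^^ n) ?g)) + (Q ^^ n) err"
    by (simp only: lin_add[OF lin_Qn] lin_scl[OF lin_Qn])
  finally have e: "(Q ^^ Suc n) ((X ^^ Suc n) g) - scl (\<kappa> ^ Suc n * fact (Suc n)) ((exp_shift \<phi> ^^ Suc n) g)
      = scl ?c ((Q ^^ n) ((X ^^ n) ?g) - scl (\<kappa> ^ n * fact n) ((exp_shift \<phi> ^^ n) ?g)) + (Q ^^ n) err"
    by (simp add: fock.scale_right_diff_distrib exp_shift_iter mult_ac del: of_nat_Suc)
  show ?case unfolding e using 1 2 by (rule fil_add[rotated])
qed (simp add: fil_zero)

lemma Fil_fexp: "Fil \<gamma> (Suc 0) (fexp \<gamma>)"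
  by (rule fil_vac)

lemma Q_fexp: "Q (fexp \<gamma>) = 0"
  using p_pos by (simp add: vtx_fexp_pos)

definition cosing :: "cartan \<Rightarrow> nat \<Rightarrow> fock" where
  "cosing \<gamma> n = scl (1 / (\<kappa> ^ n * fact n)) ((X ^^ n) (fexp \<gamma>))"

lemma cosing_Fock: "cosing \<gamma> n \<in> Fock_module \<gamma>"
  unfolding cosing_def
  using fil_Fock[OF Fil_Xn[OF Fil_fexp]] by (intro Fock_scl)

lemma Qn_cosing: "(Q ^^ n) (cosing \<gamma> n) = fexp (translate \<phi> n \<gamma>)"
proof -
  have "(Q ^^ n) ((X ^^ n) (fexp \<gamma>)) = scl (\<kappa> ^ n * fact n) (fexp (translate \<phi> n \<gamma>))"
    using Qn_Xn[OF Fil_fexp Q_fexp, where n = n and \<gamma> = \<gamma>] by (simp add: exp_shift_iter_fexp)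
  then show ?thesis using cLI by (simp add: cosing_def lin_scl[OF lin_Qn])
qed

end

section \<open>Submodules of the kernel\<close>

definition polys :: "nat \<Rightarrow> (cartan \<times> int) set" where
  "polys n = {((1, 1), - int k) |k. 0 < k \<and> k \<le> n}"

lemma fil_light_kill:
  assumes "A \<subseteq> light_modes" "B \<subseteq> light_modes" "k > 0"
  shows "fil A B \<gamma> m v \<Longrightarrow> heis (1, 1) k v = 0"
proof (induction rule: fil.induct)
  case (fil_low \<delta> n m v)
  then have "\<delta> = (1, 1)" using assms by (auto simp: light_modes_def)
  then show ?case using fil_low by (simp add: heis_swap[of _ k] hform_def)
next
  case (fil_raise \<delta> n m v)
  then have "\<delta> = (1, 1)" using assms by (auto simp: light_modes_def)
  then show ?case using fil_raise by (simp add: heis_swap[of _ k] hform_def)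
qed (use assms in \<open>simp_all add: heis_fexp heis_add heis_scl\<close>)

lemma Fil_one_polys:
  assumes "Fil \<gamma> 1 v"
  shows "\<exists>n. fil (polys n) {} \<gamma> 1 v"
proof -
  have "Fil \<gamma> m v \<Longrightarrow> m = 1 \<Longrightarrow> \<exists>n. fil (polys n) {} \<gamma> 1 v" for m
  proof (induction rule: fil.induct)
    case (fil_add m u v)
    then obtain n n' where "fil (polys n) {} \<gamma> 1 u" "fil (polys n') {} \<gamma> 1 v" by blast
    moreover have "polys n \<subseteq> polys (max n n')" "polys n' \<subseteq> polys (max n n')"
      by (auto simp: polys_def)
    ultimately have "fil (polys (max n n')) {} \<gamma> 1 u" "fil (polys (max n n')) {} \<gamma> 1 v"
      using fil_mono_sets[OF _ order_refl] by blast+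
    then show ?case using fil.fil_add by blast
  next
    case (fil_low \<delta> k m v)
    then obtain n where n: "fil (polys n) {} \<gamma> 1 v" by blast
    from fil_low(1) obtain j where j: "j > 0" "\<delta> = (1, 1)" "k = - int j" by (auto simp: light_modes_def)
    have "fil (polys (max n j)) {} \<gamma> 1 v"
      by (rule fil_mono_sets[OF _ _ n]) (auto simp: polys_def)
    moreover have "(\<delta>, k) \<in> polys (max n j)" using j by (auto simp: polys_def)
    ultimately show ?case by (blast intro: fil.fil_low)
  next
    case (fil_vac m)
    show ?case using fil.fil_vac[of "polys 0" "{}" \<gamma> 0] by auto
  next
    case (fil_scl m v a)
    then show ?case using fil.fil_scl by blast
  next
    case (fil_zero m)
    show ?case using fil.fil_zero by blast
  next
    case (fil_raise \<delta> n m v)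
    then have "v = 0" by simp
    then show ?case using fil.fil_zero by auto
  qed
  then show ?thesis using assms by blast
qed

text \<open>The top variable c(-(n+1)) is regraded as the degree variable, so that
  \<open>fil_reduce\<close> applies again, now with d(n+1) as the dual mode.\<close>

lemma polys_split:
  "fil (polys (Suc n)) {} \<gamma> m v \<Longrightarrow> \<exists>j. fil (polys n) {((1, 1), - int k) |k. k \<in> {Suc n}} \<gamma> j v"
  (is "_ \<Longrightarrow> \<exists>j. fil ?A ?B \<gamma> j v")
proof (induction rule: fil.induct)
  case (fil_add m u v)
  then obtain j j' where "fil ?A ?B \<gamma> j u" "fil ?A ?B \<gamma> j' v" by blast
  then have "fil ?A ?B \<gamma> (max j j') u" "fil ?A ?B \<gamma> (max j j') v" by (auto intro: fil_mono)
  then show ?case by (blast intro: fil.fil_add)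
next
  case (fil_low \<delta> k m v)
  then obtain j where j: "fil ?A ?B \<gamma> j v" by blast
  have "(\<delta>, k) \<in> ?A \<or> (\<delta>, k) \<in> ?B" using fil_low(1) by (auto simp: polys_def le_Suc_eq)
  then show ?case using fil.fil_low[OF _ j] fil.fil_raise[OF _ j] by blast
qed (blast intro: fil.intros)+

lemma polys_unsplit:
  assumes "fil (polys n) B \<gamma> 1 v"
  shows "fil (polys n) {} \<gamma> 1 v"
proof -
  have "fil (polys n) B \<gamma> m v \<Longrightarrow> m = 1 \<Longrightarrow> fil (polys n) {} \<gamma> m v" for m
    by (induction rule: fil.induct) (auto intro: fil.intros)
  then show ?thesis using assms by blast
qed

lemma polys_zero: "fil (polys 0) {} \<gamma> m v \<Longrightarrow> \<exists>a. v = scl a (fexp \<gamma>)"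
proof (induction rule: fil.induct)
  case (fil_zero m)
  show ?case by (rule exI[of _ 0]) simp
next
  case (fil_vac m)
  show ?case by (rule exI[of _ 1]) simp
next
  case (fil_add m u v)
  then show ?case by (metis fock.scale_left_distrib)
next
  case (fil_scl m v a)
  then show ?case by (metis fock.scale_scale)
qed (auto simp: polys_def)

context hv_realization
begin

text \<open>Both sides act as derivations on polynomials in c(-1), ..., c(-n) and kill the vacuum.
  L(n) turns c(-k) with \<open>k < n\<close> into a positive mode of c, which acts as zero, and
  c(-n) into the scalar \<open>n * c_{L,I} * (1 - p) - (n^2 + n) * c_{L,I}\<close>, which is
  \<open>- n * c_{L,I} * (p + n)\<close>; d(n) turns c(-n) into 2n.\<close>

lemma vir_on_polys:
  assumes "level \<gamma>" "A \<subseteq> polys n" "B \<subseteq> polys n" "n > 0"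
  shows "fil A B \<gamma> m v \<Longrightarrow> vir \<rho> (int n) v = scl (- cLI * of_nat (p + n) / 2) (heis (1, -1) (int n) v)"
proof (induction rule: fil.induct)
  case (fil_vac m)
  then show ?case using assms(4) by (simp add: vir_fexp_pos heis_fexp)
next
  have light: "polys n \<subseteq> light_modes" by (auto simp: polys_def light_modes_def)
  have step: "vir \<rho> (int n) (heis (1, 1) (- int k) v) =
      scl (- cLI * of_nat (p + n) / 2) (heis (1, -1) (int n) (heis (1, 1) (- int k) v))"
    if k: "0 < k" "k \<le> n" and v: "fil A B \<gamma> m v"
      and IH: "vir \<rho> (int n) v = scl (- cLI * of_nat (p + n) / 2) (heis (1, -1) (int n) v)" for k m v
  proof (cases "k = n")
    case True
    have e: "vir \<rho> (int n) (heis (1, 1) (- int n) v) = heis (1, 1) (- int n) (vir \<rho> (int n) v)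
       + scl (of_nat n) (scl (cLI * (1 - of_nat p)) v) - scl (of_int (int n ^ 2 + int n) * cLI) v"
      by (simp add: vir_comm hform_rho_light heis_zero_mode[OF fil_Fock[OF v]] level_light[OF assms(1)])
    show ?thesis
      unfolding True e IH heis_swap[of "(1, -1)" "int n"] heis_scl
      by (intro poly_mapping_eqI)
         (simp add: lookup_add lookup_minus hform_def field_simps power2_eq_square)
  next
    case False
    have "heis (1, 1) (int n - int k) v = 0"
      by (rule fil_light_kill[OF _ _ _ v]) (use assms light k False in auto)
    then show ?thesis
      using False k by (simp add: vir_comm IH heis_scl lin_minus[OF lin_heis] heis_swap[of "(1, -1)" "int n"])
  qed
  {
    case (fil_low \<delta> k m v)
    then obtain j where "\<delta> = (1, 1)" "k = - int j" "0 < j" "j \<le> n" using assms by (auto simp: polys_def)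
    then show ?case using step fil_low by blast
  next
    case (fil_raise \<delta> k m v)
    then obtain j where "\<delta> = (1, 1)" "k = - int j" "0 < j" "j \<le> n" using assms by (auto simp: polys_def)
    then show ?case using step fil_raise by blast
  }
qed (simp_all add: lin_zero[OF lin_vir] lin_add[OF lin_vir] lin_scl[OF lin_vir] heis_add heis_scl
      fock.scale_right_distrib mult.commute)

text \<open>After the modes of d are gone, the variables c(-k) are removed from the top index
  downwards, since L(n) is compared with d(n) on polynomials in c(-1), ..., c(-n).\<close>

lemma vacuum_in_submodule:
  assumes lev: "level \<gamma>" and N: "fock.subspace N" "N \<subseteq> Fock_module \<gamma>" "N \<noteq> {0}"
    and light: "\<And>n v. n > 0 \<Longrightarrow> v \<in> N \<Longrightarrow> heis (1, 1) (int n) v \<in> N"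
    and vir: "\<And>n v. n > 0 \<Longrightarrow> v \<in> N \<Longrightarrow> vir \<rho> (int n) v \<in> N"
  shows "fexp \<gamma> \<in> N"
proof -
  obtain v where v: "v \<in> N" "v \<noteq> 0" using N fock.subspace_0 by blast
  then obtain m where m: "Fil \<gamma> m v" using N(2) Fil_ex by blast
  have S: "dual_modes = {((1, -1), - int k) |k. k \<in> {0<..}}" by (auto simp: dual_modes_def)
  have lm: "n < 0" "hform (1, 1) \<delta> = 0" if "(\<delta>, n) \<in> light_modes" for \<delta> n
    using that by (auto simp: light_modes_def hform_def)
  have "\<exists>w\<in>N. w \<noteq> 0 \<and> fil light_modes {((1, -1), - int k) |k. k \<in> {0<..}} \<gamma> 1 w"
  proof (rule fil_reduce[where b' = "(1, 1)" and m = m and v = v])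
    show "fil light_modes {((1, -1), - int k) |k. k \<in> {0<..}} \<gamma> m v" using m unfolding S .
    show "hform (1, 1) (1, -1) = 2" by (simp add: hform_def)
  qed (use v N(1) light lm in auto)
  then obtain w where w: "w \<in> N" "w \<noteq> 0" "Fil \<gamma> 1 w" unfolding S[symmetric] by blast
  then obtain n where n: "fil (polys n) {} \<gamma> 1 w" using Fil_one_polys by blast
  from n w(1,2) show ?thesis
  proof (induction n arbitrary: w)
    case 0
    then obtain a where a: "w = scl a (fexp \<gamma>)" using polys_zero by blast
    then have e: "fexp \<gamma> = scl (1 / a) w" using 0 by auto
    show ?case unfolding e using 0 by (intro fock.subspace_scale[OF N(1)])
  next
    case (Suc n)
    let ?B = "{((1, 1), - int k) |k. k \<in> {Suc n}}"
    obtain j where j: "fil (polys n) ?B \<gamma> j w" using polys_split[OF Suc.prems(1)] by blast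
    have "heis (1, -1) (int k) u \<in> N" if u: "u \<in> N" "fil (polys n) ?B \<gamma> l u" "k \<in> {Suc n}" for u l k
    proof -
      let ?c = "- cLI * of_nat (p + Suc n) / 2"
      have "vir \<rho> (int (Suc n)) u = scl ?c (heis (1, -1) (int (Suc n)) u)"
        by (rule vir_on_polys[OF lev _ _ _ u(2)]) (auto simp: polys_def simp del: of_nat_Suc)
      then have e: "heis (1, -1) (int (Suc n)) u = scl (1 / ?c) (vir \<rho> (int (Suc n)) u)"
        using cLI by (simp del: of_nat_Suc of_nat_add)
      have "vir \<rho> (int (Suc n)) u \<in> N" using u by (intro vir) auto
      then have "heis (1, -1) (int (Suc n)) u \<in> N" unfolding e by (rule fock.subspace_scale[OF N(1)])
      then show ?thesis using u(3) by simp
    qed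
    then have "\<exists>w\<in>N. w \<noteq> 0 \<and> fil (polys n) ?B \<gamma> 1 w"
      by (intro fil_reduce[where b' = "(1, -1)" and m = j and v = w])
         (use Suc.prems j N(1) in \<open>auto simp: polys_def hform_def\<close>)
    then show ?case using Suc.IH polys_unsplit by blast
  qed
qed

text \<open>The part of \<open>L(-(k+1))\<close> that does not raise the degree in the modes of \<open>d\<close>.\<close>

definition residue_op :: "nat \<Rightarrow> fock \<Rightarrow> fock" where
  "residue_op k v = vir \<rho> (- int (Suc k)) v - scl (cLI * (of_nat (Suc k) - of_nat p) / 2) (heis (1, -1) (- int (Suc k)) v)
     - scl (1/2) (\<Sum>j<k. quad (- int j - 1) (int j - int k) v)"

lemma lin_residue_op: "lin (residue_op k)"
  unfolding residue_op_def[abs_def]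
  by (intro lin_minus_fun lin_scl_fun lin_sum_fun lin_vir lin_heis lin_quad)

text \<open>The subtracted terms commute with creation modes, so the residue inherits the derivation
  rule of L(-(k+1)). This rule turns modes of c into modes of c and modes of d into modes of
  d.\<close>

lemma residue_op_heis:
  assumes "j > 0"
  shows "residue_op k (heis \<delta> (- int j) v) =
    heis \<delta> (- int j) (residue_op k v) + scl (of_nat j) (heis \<delta> (- int (Suc k + j)) v)"
proof -
  have q: "quad (- int i - 1) (int i - int k) (heis \<delta> (- int j) v) = heis \<delta> (- int j) (quad (- int i - 1) (int i - int k) v)"
    if "i < k" for i
    using that assms by (simp add: quad_comm)
  have e: "- int (Suc k) + - int j = - int (Suc k + j)" by simp
  show ?thesis
    using assms
    unfolding residue_op_def vir_comm heis_swap[of "(1, -1)"] e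
    by (simp add: q lin_diff[OF lin_heis] heis_scl lin_sum[OF lin_heis] del: of_nat_Suc of_nat_add)
qed

text \<open>The constant \<open>c_{L,I} * (k + 1 - p) / 2\<close> originates here: it is the
  d-coordinate of \<gamma> + k \<rho>, by \<open>level \<gamma>\<close> and
  \<open>lam - mu = c_{L,I}\<close>. What remains is the c-coordinate.\<close>

lemma residue_op_fexp:
  assumes "level \<gamma>"
  shows "\<exists>a. residue_op k (fexp \<gamma>) = scl a (heis (1, 1) (- int (Suc k)) (fexp \<gamma>))"
proof -
  have 1: "(fst \<gamma> - snd \<gamma>) / 2 + of_nat k * ((lam cL cLI - mu cL cLI) / 2) = cLI * (of_nat (Suc k) - of_nat p) / 2"
  proof -
    have "fst \<gamma> = snd \<gamma> + cLI * (1 - of_nat p)" using assms by (simp add: level_def algebra_simps)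
    then show ?thesis by (simp only: lam_def mu_def of_nat_Suc) (simp add: field_simps)
  qed
  have "residue_op k (fexp \<gamma>) = heis \<gamma> (- int (Suc k)) (fexp \<gamma>) + scl (of_nat k) (heis \<rho> (- int (Suc k)) (fexp \<gamma>))
      - scl (cLI * (of_nat (Suc k) - of_nat p) / 2) (heis (1, -1) (- int (Suc k)) (fexp \<gamma>))"
    unfolding residue_op_def vir_fexp_neg by simp
  also have "\<dots> = scl ((fst \<gamma> + snd \<gamma>) / 2 + of_nat k * ((lam cL cLI + mu cL cLI) / 2)) (heis (1, 1) (- int (Suc k)) (fexp \<gamma>))"
    unfolding heis_light_dual[of \<gamma>] heis_light_dual[of \<rho>] 1[symmetric]
    by (intro poly_mapping_eqI, simp only: lookup_add lookup_minus lookup_scl fst_conv snd_conv)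
       (simp add: field_simps)
  finally show ?thesis by blast
qed

lemma Fil_residue_op:
  assumes "level \<gamma>"
  shows "Fil \<gamma> m v \<Longrightarrow> Fil \<gamma> m (residue_op k v)"
proof (induction rule: fil.induct)
  case (fil_vac m)
  then show ?case using residue_op_fexp[OF assms, of k] by (auto intro!: fil_scl Fil_light fil.fil_vac simp del: of_nat_Suc)
next
  case (fil_low \<delta> n m v)
  then obtain j where j: "j > 0" "\<delta> = (1, 1)" "n = - int j" by (auto simp: light_modes_def)
  show ?case
    unfolding j residue_op_heis[OF j(1)]
    using fil_low j by (intro fil_add fil_scl Fil_light) auto
next
  case (fil_raise \<delta> n m v)
  then obtain j where j: "j > 0" "\<delta> = (1, -1)" "n = - int j" by (auto simp: dual_modes_def)
  show ?case
    unfolding j residue_op_heis[OF j(1)]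
    using fil_raise j by (intro fil_add fil_scl Fil_dual) auto
qed (auto simp: lin_zero[OF lin_residue_op] lin_add[OF lin_residue_op] lin_scl[OF lin_residue_op]
      intro: fil.intros)

lemma quad_neg: 
  assumes "i < k"
  shows "quad (- int i - 1) (int i - int k) v =
    scl (1/2) (heis (1, 1) (- int (Suc i)) (heis (1, -1) (- int (k - i)) v)
      + heis (1, 1) (- int (k - i)) (heis (1, -1) (- int (Suc i)) v))"
proof -
  have e: "- int i - 1 = - int (Suc i)" "int i - int k = - int (k - i)" using assms by auto
  show ?thesis
    unfolding e quad_light_dual using assms by (simp add: heis_swap[of "(1, -1)" "- int (Suc i)"] del: of_nat_Suc)
qed

lemma vir_neg_decomp: "vir \<rho> (- int (Suc k)) v = residue_op k v
    + scl (cLI * (of_nat (Suc k) - of_nat p) / 2) (heis (1, -1) (- int (Suc k)) v)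
    + scl (1/2) (\<Sum>j<k. quad (- int j - 1) (int j - int k) v)"
  by (simp add: residue_op_def)

lemma Fil_vir_neg:
  assumes "level \<gamma>" "Fil \<gamma> m v" "n > 0"
  shows "Fil \<gamma> (Suc m) (vir \<rho> (- int n) v)"
proof -
  obtain k where n: "n = Suc k" using assms(3) by (cases n) auto
  have q: "Fil \<gamma> (Suc m) (quad (- int j - 1) (int j - int k) v)" if "j \<in> {..<k}" for j
    using that by (subst quad_neg) (auto intro!: fil_scl fil_add Fil_light Fil_dual assms(2) simp del: of_nat_Suc of_nat_diff)
  show ?thesis
    unfolding n vir_neg_decomp
    by (intro fil_add fil_scl fil_sum Fil_dual fil_Suc[OF Fil_residue_op] assms q) auto
qed

text \<open>The commutator of L(-n) with X is p times d(-(n+p)): it trades one mode of d for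
  another, whereas L(-n) itself may raise the degree. So the difference is one level below its two
  terms.\<close>

lemma vir_neg_Xn:
  assumes "level \<gamma>" "Fil \<gamma> m v" "n > 0"
  shows "Fil \<gamma> (m + j) (vir \<rho> (- int n) ((X ^^ j) v) - (X ^^ j) (vir \<rho> (- int n) v))"
proof (induction j)
  case (Suc j)
  let ?u = "(X ^^ j) v"
  have "vir \<rho> (- int n) (X ?u) = X (vir \<rho> (- int n) ?u) + scl (of_nat p) (heis (1, -1) (- int (n + p)) ?u)"
    using assms(3) p_pos by (simp add: vir_comm)
  then have "vir \<rho> (- int n) ((X ^^ Suc j) v) - (X ^^ Suc j) (vir \<rho> (- int n) v)
      = X (vir \<rho> (- int n) ?u - (X ^^ j) (vir \<rho> (- int n) v)) + scl (of_nat p) (heis (1, -1) (- int (n + p)) ?u)"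
    by (simp add: lin_diff[OF lin_X])
  moreover have "Fil \<gamma> (Suc (m + j)) (heis (1, -1) (- int (n + p)) ?u)"
    using assms by (intro Fil_dual Fil_Xn) auto
  ultimately show ?case
    using Fil_X[OF Suc] by (auto intro!: fil_add fil_scl)
qed (simp add: fil_zero)

section \<open>Generation of the kernel by the vacuum\<close>

context
  fixes \<gamma> :: cartan and N :: "fock set"
  assumes lev: "level \<gamma>" and N: "fock.subspace N" and vac: "fexp \<gamma> \<in> N"
    and N_light: "\<And>n v. n > 0 \<Longrightarrow> v \<in> N \<Longrightarrow> heis (1, 1) (- int n) v \<in> N"
    and N_vir: "\<And>n v. n > 0 \<Longrightarrow> v \<in> N \<Longrightarrow> vir \<rho> (- int n) v \<in> N"
begin

text \<open>In top degree v is a polynomial in X with coefficients from N, and f collects the lower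
  degrees. The levels \<open>m - j\<close> keep every summand within level m.\<close>

definition spanned :: "nat \<Rightarrow> fock \<Rightarrow> bool" where
  "spanned m v \<longleftrightarrow> (\<exists>g f. (\<forall>j. g j \<in> N \<and> Fil \<gamma> (m - j) (g j)) \<and> Fil \<gamma> (m - 1) f
     \<and> v = (\<Sum>j<m. (X ^^ j) (g j)) + f)"

lemma spannedI:
  assumes "\<And>j. g j \<in> N" "\<And>j. Fil \<gamma> (m - j) (g j)" "Fil \<gamma> (m - 1) f" "v = (\<Sum>j<m. (X ^^ j) (g j)) + f"
  shows "spanned m v"
  unfolding spanned_def using assms by blast

lemma spanned_low: "Fil \<gamma> (m - 1) v \<Longrightarrow> spanned m v"
  by (rule spannedI[of "\<lambda>_. 0"]) (auto simp: fil_zero lin_zero[OF lin_Xn] fock.subspace_0[OF N])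

lemma spanned_add:
  assumes "spanned m u" "spanned m v"
  shows "spanned m (u + v)"
proof -
  obtain g f where g: "\<And>j. g j \<in> N \<and> Fil \<gamma> (m - j) (g j)" "Fil \<gamma> (m - 1) f" "u = (\<Sum>j<m. (X ^^ j) (g j)) + f"
    using assms(1) unfolding spanned_def by blast
  obtain g' f' where g': "\<And>j. g' j \<in> N \<and> Fil \<gamma> (m - j) (g' j)" "Fil \<gamma> (m - 1) f'" "v = (\<Sum>j<m. (X ^^ j) (g' j)) + f'"
    using assms(2) unfolding spanned_def by blast
  show ?thesis
    by (rule spannedI[of "\<lambda>j. g j + g' j" _ "f + f'"])
       (use g g' N in \<open>auto simp: lin_add[OF lin_Xn] sum.distrib intro: fil_add fock.subspace_add\<close>)
qed

lemma spanned_scl: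
  assumes "spanned m v"
  shows "spanned m (scl a v)"
proof -
  obtain g f where g: "\<And>j. g j \<in> N \<and> Fil \<gamma> (m - j) (g j)" "Fil \<gamma> (m - 1) f" "v = (\<Sum>j<m. (X ^^ j) (g j)) + f"
    using assms unfolding spanned_def by blast
  show ?thesis
    by (rule spannedI[of "\<lambda>j. scl a (g j)" _ "scl a f"])
       (use g N in \<open>auto simp: lin_scl[OF lin_Xn] fock.scale_sum_right fock.scale_right_distrib
          intro: fil_scl fock.subspace_scale\<close>)
qed

lemma spanned_sum: "(\<And>i. i \<in> I \<Longrightarrow> spanned m (f i)) \<Longrightarrow> spanned m (\<Sum>i\<in>I. f i)"
  by (induction I rule: infinite_finite_induct) (auto intro: spanned_add spanned_low fil_zero)

lemma spanned_light:
  assumes "spanned m v" "n > 0"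
  shows "spanned m (heis (1, 1) (- int n) v)"
proof -
  obtain g f where g: "\<And>j. g j \<in> N \<and> Fil \<gamma> (m - j) (g j)" "Fil \<gamma> (m - 1) f" "v = (\<Sum>j<m. (X ^^ j) (g j)) + f"
    using assms unfolding spanned_def by blast
  have "heis (1, 1) (- int n) ((X ^^ j) u) = (X ^^ j) (heis (1, 1) (- int n) u)" for j u
  proof (induction j)
    case (Suc j)
    then show ?case using assms(2) by (simp add: heis_swap[of "(1, 1)" "- int n" "(1, -1)" "- int p"])
  qed simp
  then show ?thesis
    by (intro spannedI[of "\<lambda>j. heis (1, 1) (- int n) (g j)" _ "heis (1, 1) (- int n) f"])
       (use g assms(2) in \<open>auto simp: heis_add lin_sum[OF lin_heis] intro!: N_light Fil_light\<close>)
qed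

lemma spanned_X:
  assumes "spanned m v"
  shows "spanned (Suc m) (X v)"
proof -
  obtain g f where g: "\<And>j. g j \<in> N \<and> Fil \<gamma> (m - j) (g j)" "Fil \<gamma> (m - 1) f" "v = (\<Sum>j<m. (X ^^ j) (g j)) + f"
    using assms unfolding spanned_def by blast
  let ?g = "\<lambda>j. case j of 0 \<Rightarrow> 0 | Suc i \<Rightarrow> g i"
  show ?thesis
  proof (rule spannedI[of ?g _ "X f"])
    show "Fil \<gamma> (Suc m - 1) (X f)"
    proof (cases m)
      case 0
      then show ?thesis using g(2) by simp
    next
      case (Suc m')
      then show ?thesis using Fil_X[OF g(2)] by simp
    qed
    show "X v = (\<Sum>j<Suc m. (X ^^ j) (?g j)) + X f"
      unfolding sum.lessThan_Suc_shift by (simp add: g(3) heis_add lin_sum[OF lin_heis])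
  qed (use g(1) fock.subspace_0[OF N] in \<open>auto simp: fil_zero split: nat.split\<close>)
qed

lemma spanned_vir:
  assumes "spanned m v" "n > 0"
  shows "spanned (Suc m) (vir \<rho> (- int n) v)"
proof -
  obtain g f where g: "\<And>j. g j \<in> N \<and> Fil \<gamma> (m - j) (g j)" "Fil \<gamma> (m - 1) f" "v = (\<Sum>j<m. (X ^^ j) (g j)) + f"
    using assms unfolding spanned_def by blast
  let ?V = "vir \<rho> (- int n)"
  let ?f = "(\<Sum>j<m. ?V ((X ^^ j) (g j)) - (X ^^ j) (?V (g j))) + ?V f"
  let ?g = "\<lambda>j. if j < m then ?V (g j) else 0"
  show ?thesis
  proof (rule spannedI[of ?g _ ?f])
    show "?g j \<in> N" for j using g(1) assms(2) N_vir fock.subspace_0[OF N] by simp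
    show "Fil \<gamma> (Suc m - j) (?g j)" for j
      using Fil_vir_neg[OF lev _ assms(2), of "m - j" "g j"] g(1) by (simp add: fil_zero Suc_diff_le)
    show "Fil \<gamma> (Suc m - 1) ?f"
    proof (intro fil_add fil_sum)
      fix j assume "j \<in> {..<m}"
      then show "Fil \<gamma> (Suc m - 1) (?V ((X ^^ j) (g j)) - (X ^^ j) (?V (g j)))"
        using vir_neg_Xn[OF lev _ assms(2), of "m - j" "g j" j] g(1) by simp
    next
      show "Fil \<gamma> (Suc m - 1) (?V f)"
      proof (cases m)
        case 0
        then show ?thesis using g(2) by (simp add: lin_zero[OF lin_vir])
      next
        case (Suc m')
        then show ?thesis using Fil_vir_neg[OF lev g(2) assms(2)] by simp
      qed
    qed
    show "?V v = (\<Sum>j<Suc m. (X ^^ j) (?g j)) + ?f"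
      by (simp add: g(3) lin_add[OF lin_vir] lin_sum[OF lin_vir] sum_subtractf lin_zero[OF lin_Xn])
  qed
qed

text \<open>For \<open>n \<noteq> p\<close> the decomposition of L(-n) can be solved for d(-n), as
  its coefficient is nonzero; for \<open>n = p\<close> the mode is X itself. The quadratic part of
  L(-n) involves d(-i) with \<open>i < n\<close>, hence the strong induction.\<close>

lemma spanned_dual:
  assumes "Fil \<gamma> m v" "spanned m v" "n > 0"
  shows "spanned (Suc m) (heis (1, -1) (- int n) v)"
  using assms(3)
proof (induction n rule: less_induct)
  case (less n)
  then obtain k where n: "n = Suc k" by (cases n) auto
  show ?case
  proof (cases "n = p")
    case True
    then show ?thesis using spanned_X[OF assms(2)] by simp
  next
    case False
    let ?c = "cLI * (of_nat (Suc k) - of_nat p) / 2"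
    have c: "?c \<noteq> 0" using False cLI n by (simp del: of_nat_Suc)
    have e: "heis (1, -1) (- int n) v = scl (1 / ?c) (vir \<rho> (- int (Suc k)) v + scl (-1) (residue_op k v)
        + scl (- 1 / 2) (\<Sum>j<k. quad (- int j - 1) (int j - int k) v))"
      using c unfolding vir_neg_decomp n by (simp del: of_nat_Suc)
    have "spanned (Suc m) (quad (- int j - 1) (int j - int k) v)" if "j < k" for j
      unfolding quad_neg[OF that] using that n
      by (intro spanned_scl spanned_add spanned_light less.IH) auto
    moreover have "spanned (Suc m) (residue_op k v)"
      using Fil_residue_op[OF lev assms(1)] by (intro spanned_low) simp
    ultimately show ?thesis
      unfolding e by (intro spanned_scl spanned_add spanned_sum spanned_vir[OF assms(2)]) auto
  qed
qed

lemma spanned_all: "Fil \<gamma> m v \<Longrightarrow> spanned m v"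
proof (induction rule: fil.induct)
  case (fil_zero m)
  show ?case by (rule spanned_low) (rule fil.fil_zero)
next
  case (fil_vac m)
  let ?g = "\<lambda>j. if j = 0 then fexp \<gamma> else 0"
  have s: "(\<Sum>j<Suc m. (X ^^ j) (?g j)) = fexp \<gamma>"
    unfolding sum.lessThan_Suc_shift by (simp add: lin_zero[OF lin_X] lin_zero[OF lin_Xn])
  show ?case
    by (rule spannedI[of ?g _ 0]) (auto simp: s[simplified] vac fock.subspace_0[OF N] intro: fil.fil_zero fil.fil_vac)
next
  case (fil_low \<delta> n m v)
  then show ?case using spanned_light by (auto simp: light_modes_def)
next
  case (fil_raise \<delta> n m v)
  then show ?case using spanned_dual by (auto simp: dual_modes_def)
qed (auto intro: spanned_add spanned_scl)

text \<open>The highest power of X is removed by applying Q^J, which annihilates the whole sum. On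
  X^J g_J it gives a nonzero multiple of the shifted g_J modulo level \<open>k = m - J - 1\<close>,
  and it sends all other summands into that level. So g_J itself has level k, and its summand can be
  absorbed into the remainder f.\<close>

lemma ker_in_submodule_step:
  assumes ker: "\<And>u. u \<in> N \<Longrightarrow> Q u = 0"
    and IH: "\<And>u. Fil \<gamma> (m - 1) u \<Longrightarrow> Q u = 0 \<Longrightarrow> u \<in> N"
    and g: "\<And>j. g j \<in> N" "\<And>j. Fil \<gamma> (m - j) (g j)"
  shows "J \<le> m \<Longrightarrow> Fil \<gamma> (m - 1) f \<Longrightarrow> Q ((\<Sum>j<J. (X ^^ j) (g j)) + f) = 0 \<Longrightarrow>
    (\<Sum>j<J. (X ^^ j) (g j)) + f \<in> N"
proof (induction J arbitrary: f)
  case 0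
  then show ?case using IH by simp
next
  case (Suc J)
  let ?v = "(\<Sum>j<Suc J. (X ^^ j) (g j)) + f"
  obtain k where k: "m - J = Suc k" using Suc.prems(1) by (cases "m - J") auto
  show ?case
  proof (cases "J = 0")
    case True
    then have v: "?v = g 0 + f" by simp
    then have "Q f = 0" using Suc.prems(3) ker[OF g(1)] by (simp add: lin_add[OF lin_Q])
    then show ?thesis unfolding v using IH[OF Suc.prems(2)] g(1) N by (simp add: fock.subspace_add)
  next
    case False
    let ?G = "translate \<phi> J \<gamma>"
    have lower: "Fil ?G k ((Q ^^ J) ((X ^^ j) (g j)))" if "j < J" for j
    proof -
      have kj: "Fil \<gamma> (Suc (k + (J - j))) (g j)"
        using g(2)[of j] k that by (rule_tac fil_mono) auto
      have "Fil (translate \<phi> j \<gamma>) (k + (J - j)) ((Q ^^ j) ((X ^^ j) (g j)) - scl (\<kappa> ^ j * fact j) ((exp_shift \<phi> ^^ j) (g j)))"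
        by (rule Qn_Xn[OF kj ker[OF g(1)]])
      from Fil_Qn[OF this, of "J - j"]
      have "Fil ?G k ((Q ^^ (J - j)) ((Q ^^ j) ((X ^^ j) (g j)) - scl (\<kappa> ^ j * fact j) ((exp_shift \<phi> ^^ j) (g j))))"
        using that by (simp add: translate_def of_nat_diff algebra_simps)
      moreover have "(Q ^^ (J - j)) ((exp_shift \<phi> ^^ j) (g j)) = 0"
      proof -
        \<comment> \<open>Shifts commute with Q, so the shifted coefficient stays in the kernel, and
          the remaining \<open>J - j > 0\<close> powers of Q remove the main term.\<close>
        have "Q ((exp_shift \<phi> ^^ i) (g j)) = 0" for i
          by (induction i) (simp_all add: ker[OF g(1)] lin_zero[OF lin_shift] flip: exp_shift_Q)
        then have "(Q ^^ Suc (J - Suc j)) ((exp_shift \<phi> ^^ j) (g j)) = 0"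
          unfolding funpow_Suc_right o_apply by (simp add: lin_zero[OF lin_Qn])
        then show ?thesis using that by (simp add: Suc_diff_Suc)
      qed
      moreover have "(Q ^^ (J - j)) ((Q ^^ j) u) = (Q ^^ J) u" for u
        using that by (simp flip: funpow_add[THEN fun_cong, unfolded o_apply])
      ultimately show ?thesis
        by (simp add: lin_diff[OF lin_Qn] lin_scl[OF lin_Qn])
    qed
    have "Fil ?G (m - 1 - J) ((Q ^^ J) f)" by (rule Fil_Qn[OF Suc.prems(2)])
    then have f: "Fil ?G k ((Q ^^ J) f)" using k by (auto intro: fil_mono)
    obtain J' where J': "J = Suc J'" using False by (cases J) auto
    have "(Q ^^ J) ?v = 0"
      unfolding J' funpow_Suc_right o_apply using Suc.prems(3)[unfolded J'] by (simp add: lin_zero[OF lin_Qn])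
    then have "(Q ^^ J) ((X ^^ J) (g J)) + ((\<Sum>j<J. (Q ^^ J) ((X ^^ j) (g j))) + (Q ^^ J) f) = 0"
      by (simp add: lin_add[OF lin_Qn] lin_sum[OF lin_Qn] add_ac)
    then have eq: "(Q ^^ J) ((X ^^ J) (g J)) = - ((\<Sum>j<J. (Q ^^ J) ((X ^^ j) (g j))) + (Q ^^ J) f)"
      by (rule eq_neg_iff_add_eq_0[THEN iffD2])
    have "Fil ?G k ((\<Sum>j<J. (Q ^^ J) ((X ^^ j) (g j))) + (Q ^^ J) f)"
      by (intro fil_add fil_sum f) (simp add: lower)
    then have QX: "Fil ?G k ((Q ^^ J) ((X ^^ J) (g J)))"
      unfolding eq by (rule fil_neg)
    have "Fil \<gamma> (Suc k) (g J)" using g(2)[of J] k by simp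
    from fil_diff[OF QX Qn_Xn[OF this ker[OF g(1)], of J]]
    have "Fil ?G k (scl (\<kappa> ^ J * fact J) ((exp_shift \<phi> ^^ J) (g J)))" by simp
    from fil_scl[OF this, of "1 / (\<kappa> ^ J * fact J)"]
    have "Fil ?G k ((exp_shift \<phi> ^^ J) (g J))" using cLI by simp
    then have "Fil \<gamma> k (g J)" by (rule Fil_unshift)
    from Fil_Xn[OF this, of J] have "Fil \<gamma> (m - 1) ((X ^^ J) (g J) + f)"
      using k Suc.prems(2) by (intro fil_add) (auto intro: fil_mono)
    from Suc.IH[OF _ this] Suc.prems show ?thesis by (simp add: add_ac)
  qed
qed

lemma ker_in_submodule:
  assumes ker: "\<And>u. u \<in> N \<Longrightarrow> Q u = 0"
  shows "Fil \<gamma> m v \<Longrightarrow> Q v = 0 \<Longrightarrow> v \<in> N"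
proof (induction m arbitrary: v)
  case 0
  then show ?case using fock.subspace_0[OF N] by simp
next
  case (Suc m)
  obtain g f where g: "\<And>j. g j \<in> N \<and> Fil \<gamma> (Suc m - j) (g j)" and f: "Fil \<gamma> (Suc m - 1) f"
    and v: "v = (\<Sum>j<Suc m. (X ^^ j) (g j)) + f"
    using spanned_all[OF Suc.prems(1)] unfolding spanned_def by blast
  show ?case
    unfolding v
    by (rule ker_in_submodule_step[OF ker, where m = "Suc m"])
       (use Suc g f v in auto)
qed

end

end

section \<open>Uniqueness of the irreducible highest weight module\<close>

context hv_module
begin

text \<open>The index n is the total degree of the word; it fixes the L(0)-eigenvalue
  \<open>h + n\<close>.\<close>

inductive neg_word :: "'v \<Rightarrow> nat \<Rightarrow> 'v \<Rightarrow> bool" for v where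
  neg_word_nil: "neg_word v 0 v"
| neg_word_L: "k > 0 \<Longrightarrow> neg_word v n u \<Longrightarrow> neg_word v (n + k) (act (L_gen (- int k)) u)"
| neg_word_I: "k > 0 \<Longrightarrow> neg_word v n u \<Longrightarrow> neg_word v (n + k) (act (I_gen (- int k)) u)"

abbreviation neg_span :: "'v \<Rightarrow> 'v set" where
  "neg_span v \<equiv> span {u. \<exists>n. neg_word v n u}"

lemma act_zero [simp]: "act x 0 = 0"
  using act_add[of 0 0 x] subspace_0[OF carrier_subspace] by simp

lemma act_span:
  assumes "S \<subseteq> V" "\<And>u. u \<in> S \<Longrightarrow> act x u \<in> span T" "u \<in> span S"
  shows "act x u \<in> span T"
proof -
  have SV: "span S \<subseteq> V" by (rule span_minimal[OF assms(1) carrier_subspace])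
  have "act x u \<in> span T \<and> u \<in> V"
    using assms(3)
  proof (induction rule: span_induct_alt)
    case base
    show ?case using span_zero subspace_0[OF carrier_subspace] by simp
  next
    case (step c y z)
    then have "y \<in> V" "act x y \<in> span T" using assms by auto
    then show ?case
      using step by (simp add: act_add act_scale span_add span_scale subspace_scale[OF carrier_subspace]
          subspace_add[OF carrier_subspace])
  qed
  then show ?thesis ..
qed

context
  fixes v h hI cL cI cLI
  assumes v: "v \<in> V"
    and central: "act CL v = sc cL v" "act CI v = sc cI v" "act CLI v = sc cLI v"
    and pos: "\<And>n. n > 0 \<Longrightarrow> act (L_gen n) v = 0 \<and> act (I_gen n) v = 0"
    and weight: "act (L_gen 0) v = sc h v" "act (I_gen 0) v = sc hI v"
begin

lemma neg_word_carrier: "neg_word v n u \<Longrightarrow> u \<in> V"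
  by (induction rule: neg_word.induct) (auto intro: v act_closed)

lemma neg_words_carrier: "{u. \<exists>n. neg_word v n u} \<subseteq> V"
  using neg_word_carrier by blast

lemma neg_span_neg:
  assumes "k > 0" "u \<in> neg_span v"
  shows "act (L_gen (- int k)) u \<in> neg_span v" "act (I_gen (- int k)) u \<in> neg_span v"
  by (rule act_span[OF neg_words_carrier _ assms(2)],
      use assms(1) neg_word.intros in \<open>blast intro: span_base\<close>)+

text \<open>Induction on the word for all x at once: moving x past the first letter leaves that
  letter on \<open>act x u\<close> and the bracket, which is again a combination of generators
  acting on u.\<close>

lemma act_neg_word: "neg_word v n u \<Longrightarrow> \<forall>x. act x u \<in> neg_span v"
proof (induction rule: neg_word.induct)
  case neg_word_nil
  have 0: "v \<in> neg_span v" by (blast intro: span_base neg_word.neg_word_nil)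
  show ?case
  proof
    fix x
    have "act (L_gen n) v \<in> neg_span v \<and> act (I_gen n) v \<in> neg_span v" for n
    proof -
      consider "n > 0" | "n = 0" | "n < 0" by linarith
      then show ?thesis
      proof cases
        case 3
        then obtain k where "n = - int k" "k > 0"
          by (metis neg_less_0_iff_less zero_less_imp_eq_int minus_minus)
        then show ?thesis using neg_span_neg[OF _ 0, of k] by simp
      qed (auto simp: pos weight span_zero intro: span_scale 0)
    qed
    then show "act x v \<in> neg_span v"
      by (cases x) (auto simp: central intro: span_scale 0)
  qed
next
  case (neg_word_L k n u)
  show ?case
  proof
    fix x
    let ?y = "L_gen (- int k)"
    have u: "u \<in> V" by (rule neg_word_carrier[OF neg_word_L(2)])
    have "act x (act ?y u) = act ?y (act x u) +
      (\<Sum>z\<in>Poly_Mapping.keys (hv_bracket x ?y). sc (Poly_Mapping.lookup (hv_bracket x ?y) z) (act z u))"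
      using act_bracket[OF u, of x ?y] by (simp add: algebra_simps)
    then show "act x (act ?y u) \<in> neg_span v"
      using neg_word_L by (auto intro!: span_add span_sum span_scale neg_span_neg)
  qed
next
  case (neg_word_I k n u)
  show ?case
  proof
    fix x
    let ?y = "I_gen (- int k)"
    have u: "u \<in> V" by (rule neg_word_carrier[OF neg_word_I(2)])
    have "act x (act ?y u) = act ?y (act x u) +
      (\<Sum>z\<in>Poly_Mapping.keys (hv_bracket x ?y). sc (Poly_Mapping.lookup (hv_bracket x ?y) z) (act z u))"
      using act_bracket[OF u, of x ?y] by (simp add: algebra_simps)
    then show "act x (act ?y u) \<in> neg_span v"
      using neg_word_I by (auto intro!: span_add span_sum span_scale neg_span_neg)
  qed
qed

lemma neg_span_submodule: "hv_submodule sc V act (neg_span v)"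
  unfolding hv_submodule_def
proof (intro conjI allI ballI)
  show "neg_span v \<subseteq> V" by (rule span_minimal[OF neg_words_carrier carrier_subspace])
  show "subspace (neg_span v)" by (rule subspace_span)
  show "act x u \<in> neg_span v" if "u \<in> neg_span v" for x u
    by (rule act_span[OF neg_words_carrier _ that]) (use act_neg_word in blast)
qed

lemma neg_word_weight: "neg_word v n u \<Longrightarrow> act (L_gen 0) u = sc (h + of_nat n) u"
proof (induction rule: neg_word.induct)
  case neg_word_nil
  then show ?case using weight by simp
next
  case (neg_word_L k n u)
  have u: "u \<in> V" by (rule neg_word_carrier[OF neg_word_L(2)])
  have "act (L_gen 0) (act (L_gen (- int k)) u) - act (L_gen (- int k)) (act (L_gen 0) u) =
      sc (of_nat k) (act (L_gen (- int k)) u)"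
    using neg_word_L(1) unfolding act_bracket[OF u] hv_bracket.simps ext_sum_simps by simp
  then show ?case
    unfolding neg_word_L(3) act_scale[OF u] by (simp add: diff_eq_eq scale_left_distrib add_ac)
next
  case (neg_word_I k n u)
  have u: "u \<in> V" by (rule neg_word_carrier[OF neg_word_I(2)])
  have "act (L_gen 0) (act (I_gen (- int k)) u) - act (I_gen (- int k)) (act (L_gen 0) u) =
      sc (of_nat k) (act (I_gen (- int k)) u)"
    using neg_word_I(1) unfolding act_bracket[OF u] hv_bracket.simps ext_sum_simps by simp
  then show ?case
    unfolding neg_word_I(3) act_scale[OF u] by (simp add: diff_eq_eq scale_left_distrib add_ac)
qed

lemma neg_word_0: "neg_word v 0 u \<Longrightarrow> u = v"
  by (erule neg_word.cases) auto

text \<open>The product of the operators \<open>L(0) - (h + j)\<close> for \<open>1 \<le> j \<le> N\<close> kills the words of degree between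
  \<open>1\<close> and \<open>N\<close>, but is injective on the highest weight space.\<close>

primrec weight_filter :: "nat \<Rightarrow> 'v \<Rightarrow> 'v" where
  "weight_filter 0 u = u"
| "weight_filter (Suc N) u = act (L_gen 0) (weight_filter N u) - sc (h + of_nat (Suc N)) (weight_filter N u)"

lemma weight_filter_carrier: "u \<in> V \<Longrightarrow> weight_filter N u \<in> V"
  by (induction N) (auto intro!: subspace_diff[OF carrier_subspace] subspace_scale[OF carrier_subspace] act_closed)

lemma weight_filter_add:
  "u \<in> V \<Longrightarrow> u' \<in> V \<Longrightarrow> weight_filter N (u + u') = weight_filter N u + weight_filter N u'"
  by (induction N) (simp_all add: act_add weight_filter_carrier scale_right_distrib algebra_simps)

lemma weight_filter_scale:
  "u \<in> V \<Longrightarrow> weight_filter N (sc a u) = sc a (weight_filter N u)"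
  by (induction N) (simp_all add: act_scale weight_filter_carrier scale_right_diff_distrib scale_left_commute)

lemma weight_filter_eigen:
  assumes "u \<in> V" "act (L_gen 0) u = sc (h + a) u"
  shows "weight_filter N u = sc (\<Prod>j<N. a - of_nat (Suc j)) u"
proof (induction N)
  case (Suc N)
  then show ?case
    using assms
    by (simp add: act_scale flip: scale_left_diff_distrib del: of_nat_Suc)
       (simp add: algebra_simps)
qed simp

lemma weight_filter_mono: "weight_filter N u = 0 \<Longrightarrow> N \<le> M \<Longrightarrow> weight_filter M u = 0"
  by (induction M) (auto simp: le_Suc_eq)

lemma neg_span_decomp:
  assumes "y \<in> neg_span v"
  shows "\<exists>c N z. z \<in> V \<and> y = sc c v + z \<and> weight_filter N z = 0"
  using assms
proof (induction rule: span_induct_alt)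
  case base
  have "0 = sc 0 v + 0 \<and> weight_filter 0 0 = 0" by simp
  then show ?case using subspace_0[OF carrier_subspace] by blast
next
  case (step a u y)
  then obtain n c N z where n: "neg_word v n u" and z: "z \<in> V" "y = sc c v + z" "weight_filter N z = 0"
    by auto
  show ?case
  proof (cases "n = 0")
    case True
    then have "sc a u + y = sc (a + c) v + z" using neg_word_0 n z by (auto simp: scale_left_distrib add.assoc)
    then show ?thesis using z by blast
  next
    case False
    have u: "u \<in> V" by (rule neg_word_carrier[OF n])
    obtain n' where n': "n = Suc n'" using False by (cases n) auto
    have "(\<Prod>j<n. of_nat n - of_nat (Suc j) :: complex) = 0"
      by (rule prod_zero) (auto simp: n' intro!: bexI[of _ n'])
    then have "weight_filter n u = 0"
      using weight_filter_eigen[OF u neg_word_weight[OF n]] by simp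
    then have "weight_filter (max n N) u = 0" "weight_filter (max n N) z = 0"
      using weight_filter_mono z(3) by (meson max.cobounded1 max.cobounded2)+
    then have "weight_filter (max n N) (sc a u + z) = 0"
      using u z(1) by (simp add: weight_filter_add weight_filter_scale subspace_scale[OF carrier_subspace])
    moreover have "sc a u + y = sc c v + (sc a u + z)" using z(2) by (simp add: algebra_simps)
    moreover have "sc a u + z \<in> V"
      using u z(1) by (intro subspace_add[OF carrier_subspace] subspace_scale[OF carrier_subspace])
    ultimately show ?thesis by blast
  qed
qed

text \<open>The part z of y that the filter kills is itself an eigenvector for h, so the filter
  multiplies it by the product of the nonzero numbers -1, ..., -N. Hence
  \<open>z = 0\<close>.\<close>

lemma neg_span_weight_space:
  assumes "y \<in> neg_span v" "act (L_gen 0) y = sc h y"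
  shows "\<exists>c. y = sc c v"
proof -
  obtain c N z where z: "z \<in> V" "y = sc c v + z" "weight_filter N z = 0"
    using neg_span_decomp[OF assms(1)] by blast
  have cv: "sc c v \<in> V" using v by (intro subspace_scale[OF carrier_subspace])
  have "act (L_gen 0) (sc c v) + act (L_gen 0) z = sc h (sc c v) + sc h z"
    using assms(2) unfolding z(2) act_add[OF cv z(1)] scale_right_distrib .
  moreover have "act (L_gen 0) (sc c v) = sc h (sc c v)"
    using v weight by (simp add: act_scale mult.commute)
  ultimately have "act (L_gen 0) z = sc (h + 0) z" by simp
  from weight_filter_eigen[OF z(1) this, of N] z(3)
  have "(\<Prod>j<N. 0 - of_nat (Suc j) :: complex) = 0 \<or> z = 0" by simp
  moreover have "(\<Prod>j<N. 0 - of_nat (Suc j) :: complex) \<noteq> 0"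
    by (simp only: prod_zero_iff finite_lessThan diff_0 neg_equal_0_iff_equal of_nat_eq_0_iff) simp
  ultimately show ?thesis using z(2) by auto
qed

end

end

lemma vector_space_prod:
  assumes "vector_space sc" "vector_space sc'"
  shows "vector_space (\<lambda>a (x, y). (sc a x, sc' a y))"
proof -
  interpret a: vector_space sc by fact
  interpret b: vector_space sc' by fact
  show ?thesis
    by unfold_locales
       (auto simp: a.scale_right_distrib b.scale_right_distrib a.scale_left_distrib b.scale_left_distrib)
qed

lemma hv_module_prod:
  assumes "hv_module sc V act" "hv_module sc' V' act'"
  shows "hv_module (\<lambda>a (x, y). (sc a x, sc' a y)) (V \<times> V') (\<lambda>z (x, y). (act z x, act' z y))"
proof -
  interpret a: hv_module sc V act by fact
  interpret b: hv_module sc' V' act' by fact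
  interpret p: vector_space "\<lambda>a (x, y). (sc a x, sc' a y)"
    by (rule vector_space_prod) unfold_locales
  show ?thesis
  proof (unfold_locales, goal_cases)
    case 1
    show ?case
      using a.carrier_subspace b.carrier_subspace
      by (auto simp: p.subspace_def a.subspace_def b.subspace_def zero_prod_def)
  next
    case (2 v x)
    then show ?case by (auto intro: a.act_closed b.act_closed)
  next
    case (3 v w x)
    then show ?case by (auto simp: a.act_add b.act_add)
  next
    case (4 v x c)
    then show ?case by (auto simp: a.act_scale b.act_scale)
  next
    case (5 v x y)
    have "fst (\<Sum>z\<in>A. case v of (u, w) \<Rightarrow> (f z u, g z w)) = (\<Sum>z\<in>A. f z (fst v))"
      "snd (\<Sum>z\<in>A. case v of (u, w) \<Rightarrow> (f z u, g z w)) = (\<Sum>z\<in>A. g z (snd v))" for A f g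
      by (simp_all add: fst_sum snd_sum case_prod_beta)
    then show ?case
      using 5 a.act_bracket[of "fst v" x y] b.act_bracket[of "snd v" x y]
      by (auto simp: prod_eq_iff fst_sum snd_sum case_prod_beta)
  qed
qed

text \<open>The submodule of the product generated by the pair of highest weight vectors is the graph of an
  isomorphism.\<close>

lemma irreducible_hw_unique:
  assumes 1: "is_irreducible_hw_module cL cI cLI h hI sc V act"
    and 2: "is_irreducible_hw_module cL cI cLI h hI sc' V' act'"
  shows "hv_isomorphic sc V act sc' V' act'"
proof -
  interpret a: hv_module sc V act using 1 by (simp add: is_irreducible_hw_module_def)
  interpret b: hv_module sc' V' act' using 2 by (simp add: is_irreducible_hw_module_def)
  let ?sc = "\<lambda>a (x, y). (sc a x, sc' a y)" and ?act = "\<lambda>z (x, y). (act z x, act' z y)"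
  interpret p: hv_module ?sc "V \<times> V'" ?act
    by (rule hv_module_prod) unfold_locales
  obtain v where v: "v \<in> V" "v \<noteq> 0" "\<And>n. n > 0 \<Longrightarrow> act (L_gen n) v = 0 \<and> act (I_gen n) v = 0"
    "act (L_gen 0) v = sc h v" "act (I_gen 0) v = sc hI v"
    "act CL v = sc cL v" "act CI v = sc cI v" "act CLI v = sc cLI v"
    using 1 unfolding is_irreducible_hw_module_def by blast
  obtain w where w: "w \<in> V'" "w \<noteq> 0" "\<And>n. n > 0 \<Longrightarrow> act' (L_gen n) w = 0 \<and> act' (I_gen n) w = 0"
    "act' (L_gen 0) w = sc' h w" "act' (I_gen 0) w = sc' hI w"
    "act' CL w = sc' cL w" "act' CI w = sc' cI w" "act' CLI w = sc' cLI w"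
    using 2 unfolding is_irreducible_hw_module_def by blast
  define U where "U = p.neg_span (v, w)"
  have sub: "hv_submodule ?sc (V \<times> V') ?act U"
    unfolding U_def
    by (rule p.neg_span_submodule[where h = h and hI = hI and cL = cL and cI = cI and cLI = cLI])
       (use v w in \<open>auto simp: zero_prod_def\<close>)
  have U: "U \<subseteq> V \<times> V'" "p.subspace U" "\<And>z x y. (x, y) \<in> U \<Longrightarrow> (act z x, act' z y) \<in> U"
    using sub unfolding hv_submodule_def by auto
  have vw: "(v, w) \<in> U" unfolding U_def by (blast intro: p.span_base p.neg_word_nil)
  have U0: "(0, 0) \<in> U" using p.subspace_0[OF U(2)] by (simp add: zero_prod_def)
  have Uadd: "(x, y) \<in> U \<Longrightarrow> (x', y') \<in> U \<Longrightarrow> (x + x', y + y') \<in> U" for x y x' y'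
    using p.subspace_add[OF U(2)] by fastforce
  have Udiff: "(x, y) \<in> U \<Longrightarrow> (x', y') \<in> U \<Longrightarrow> (x - x', y - y') \<in> U" for x y x' y'
    using p.subspace_diff[OF U(2), of "(x, y)" "(x', y')"] by simp
  have Uscale: "(x, y) \<in> U \<Longrightarrow> (sc c x, sc' c y) \<in> U" for x y c
    using p.subspace_scale[OF U(2)] by fastforce
  have wspace: "\<exists>c. (x, y) = (sc c v, sc' c w)"
    if "(x, y) \<in> U" "act (L_gen 0) x = sc h x" "act' (L_gen 0) y = sc' h y" for x y
  proof -
    have "\<exists>c. (x, y) = ?sc c (v, w)"
      by (rule p.neg_span_weight_space[where h = h and hI = hI and cL = cL and cI = cI and cLI = cLI])
         (use v w that in \<open>auto simp: zero_prod_def U_def\<close>)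
    then show ?thesis by simp
  qed
  have irr: "N = {0} \<or> N = V" if "hv_submodule sc V act N" for N
    using 1 that by (simp add: is_irreducible_hw_module_def hv_irreducible_def)
  have irr': "N = {0} \<or> N = V'" if "hv_submodule sc' V' act' N" for N
    using 2 that by (simp add: is_irreducible_hw_module_def hv_irreducible_def)
  \<comment> \<open>Vectors of U with L(0)-eigenvalue h in both components are multiples of
    \<open>(v, w)\<close>, so v cannot occur with second component 0. By irreducibility no other
    nonzero vector does. With the symmetric case this makes both projections of U injective.\<close>
  have "hv_submodule sc V act {x. (x, 0) \<in> U}"
    using U U0 Uadd[of _ 0 _ 0] Uscale[of _ 0] U(3)[of _ 0]
    by (auto simp: hv_submodule_def a.subspace_def)
  moreover have "v \<notin> {x. (x, 0) \<in> U}"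
    using wspace[of v 0] v w by auto
  ultimately have left: "x = 0" if "(x, 0) \<in> U" for x
    using irr[of "{x. (x, 0) \<in> U}"] that v(1) by auto
  have "hv_submodule sc' V' act' {y. (0, y) \<in> U}"
    using U U0 Uadd[of 0 _ 0 _] Uscale[of 0] U(3)[of 0]
    by (auto simp: hv_submodule_def b.subspace_def)
  moreover have "w \<notin> {y. (0, y) \<in> U}"
    using wspace[of 0 w] v w by auto
  ultimately have right: "y = 0" if "(0, y) \<in> U" for y
    using irr'[of "{y. (0, y) \<in> U}"] that w(1) by auto
  have "hv_submodule sc V act (fst ` U)"
    unfolding hv_submodule_def a.subspace_def
  proof (intro conjI ballI allI)
    show "fst ` U \<subseteq> V" using U(1) by auto
    show "0 \<in> fst ` U" using image_eqI[OF _ U0, of 0 fst] by simp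
    fix x assume "x \<in> fst ` U"
    then obtain y where xy: "(x, y) \<in> U" by force
    show "sc c x \<in> fst ` U" for c by (rule image_eqI[OF _ Uscale[OF xy, of c]]) simp
    show "act z x \<in> fst ` U" for z by (rule image_eqI[OF _ U(3)[OF xy, of z]]) simp
    fix x' assume "x' \<in> fst ` U"
    then obtain y' where xy': "(x', y') \<in> U" by force
    show "x + x' \<in> fst ` U" using image_eqI[OF _ Uadd[OF xy xy'], of "x + x'" fst] by simp
  qed
  then have fstU: "fst ` U = V" using irr[of "fst ` U"] image_eqI[OF _ vw, of v fst] v(2) by auto
  have "hv_submodule sc' V' act' (snd ` U)"
    unfolding hv_submodule_def b.subspace_def
  proof (intro conjI ballI allI)
    show "snd ` U \<subseteq> V'" using U(1) by auto
    show "0 \<in> snd ` U" using image_eqI[OF _ U0, of 0 snd] by simp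
    fix y assume "y \<in> snd ` U"
    then obtain x where xy: "(x, y) \<in> U" by force
    show "sc' c y \<in> snd ` U" for c by (rule image_eqI[OF _ Uscale[OF xy, of c]]) simp
    show "act' z y \<in> snd ` U" for z by (rule image_eqI[OF _ U(3)[OF xy, of z]]) simp
    fix y' assume "y' \<in> snd ` U"
    then obtain x' where xy': "(x', y') \<in> U" by force
    show "y + y' \<in> snd ` U" using image_eqI[OF _ Uadd[OF xy xy'], of "y + y'" snd] by simp
  qed
  then have sndU: "snd ` U = V'" using irr'[of "snd ` U"] image_eqI[OF _ vw, of w snd] w(2) by auto
  have uniq: "y = y'" if "(x, y) \<in> U" "(x, y') \<in> U" for x y y'
    using right[of "y - y'"] Udiff[OF that] by simp
  have uniq': "x = x'" if "(x, y) \<in> U" "(x', y) \<in> U" for x x' y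
    using left[of "x - x'"] Udiff[OF that] by simp
  define f where "f x = (THE y. (x, y) \<in> U)" for x
  have f: "f x = y" if "(x, y) \<in> U" for x y
    unfolding f_def using that uniq by blast
  have fU: "(x, f x) \<in> U" if "x \<in> V" for x
  proof -
    have "x \<in> fst ` U" using that fstU by simp
    then obtain y where "(x, y) \<in> U" by force
    then show ?thesis using f by simp
  qed
  have "bij_betw f V V'"
  proof (rule bij_betwI')
    show "f x = f y \<longleftrightarrow> x = y" if "x \<in> V" "y \<in> V" for x y
      using uniq' fU that by metis
    show "f x \<in> V'" if "x \<in> V" for x using fU[OF that] U(1) by blast
    show "\<exists>x\<in>V. y = f x" if "y \<in> V'" for y
    proof -
      have "y \<in> snd ` U" using that sndU by simp
      then obtain x where "(x, y) \<in> U" by force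
      then show ?thesis using f U(1) by blast
    qed
  qed
  moreover have "f (x + y) = f x + f y" if "x \<in> V" "y \<in> V" for x y
    by (rule f) (intro Uadd fU that)
  moreover have "f (sc c x) = sc' c (f x)" if "x \<in> V" for x c
    by (rule f) (intro Uscale fU that)
  moreover have "f (act z x) = act' z (f x)" if "x \<in> V" for x z
    by (rule f) (intro U(3) fU that)
  ultimately show ?thesis unfolding hv_isomorphic_def by blast
qed

section \<open>Generators of the Fock module\<close>

lemma Sum_any_mem:
  assumes "fock.subspace U" "\<And>j. f j \<in> U"
  shows "Sum_any f \<in> U"
  unfolding Sum_any.expand_set by (rule fock.subspace_sum[OF assms(1)]) (rule assms(2))

lemma nop_Fock: "v \<in> Fock_module \<gamma> \<Longrightarrow> nop xs m v \<in> Fock_module \<gamma>"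
proof (induction xs m v rule: nop.induct)
  case (2 g k xs m v)
  show ?case
    unfolding nop.simps
    by (intro Fock_add Sum_any_mem[OF Fock_module_subspace] Fock_scl heis_Fock_module "2.IH" "2.prems")
qed (simp add: Fock_zero)

lemma vop_Fock: "v \<in> Fock_module \<gamma> \<Longrightarrow> vop u m v \<in> Fock_module \<gamma>"
  unfolding vop_def by (intro Fock_sum Fock_scl nop_Fock)

lemma coset_eq:
  assumes "fock.subspace N" "u - v \<in> N"
  shows "coset N u = coset N v"
proof -
  have "\<exists>n'\<in>N. u + n = v + n'" if "n \<in> N" for n
    using fock.subspace_add[OF assms that] by (intro bexI[of _ "u - v + n"]) auto
  moreover have "\<exists>n'\<in>N. v + n = u + n'" if "n \<in> N" for n
    using fock.subspace_diff[OF assms(1) that assms(2)] by (intro bexI[of _ "n - (u - v)"]) auto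
  ultimately show ?thesis by (auto simp: coset_def image_iff)
qed

lemma coset_zero: "fock.subspace N \<Longrightarrow> v \<in> N \<Longrightarrow> coset N v = N"
  using coset_eq[of N v 0] by (simp add: coset_def)

lemma coset_lift_coset:
  assumes N: "fock.subspace N" and f: "lin f" "\<And>n. n \<in> N \<Longrightarrow> f n \<in> N"
  shows "coset_lift N f (coset N v) = coset N (f v)"
proof -
  have "coset N (f w) = coset N (f v)" if w: "w \<in> coset N v" for w
  proof -
    obtain n where "w = v + n" "n \<in> N" using w by (auto simp: coset_def)
    then show ?thesis by (intro coset_eq[OF N]) (simp add: lin_add[OF f(1)] f(2))
  qed
  then have "coset_lift N f (coset N v) = (\<Union>w\<in>coset N v. coset N (f v))"
    unfolding coset_lift_def by (rule SUP_cong[OF refl])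
  moreover have "v \<in> coset N v" using image_eqI[OF _ fock.subspace_0[OF N], of v "(+) v"] by (simp add: coset_def)
  ultimately show ?thesis by (metis SUP_const empty_iff)
qed

section \<open>Kernels of the powers of Q\<close>

context hv_realization
begin

definition kerQ :: "cartan \<Rightarrow> nat \<Rightarrow> fock set" where
  "kerQ \<gamma> n = {v \<in> Fock_module \<gamma>. (Q ^^ n) v = 0}"

lemma kerQ_subspace: "fock.subspace (kerQ \<gamma> n)"
  unfolding fock.subspace_def kerQ_def
  by (auto simp: Fock_intros lin_zero[OF lin_Qn] lin_add[OF lin_Qn] lin_scl[OF lin_Qn])

lemma kerQ_act: "level \<gamma> \<Longrightarrow> v \<in> kerQ \<gamma> n \<Longrightarrow> act x v \<in> kerQ \<gamma> n"
  by (auto simp: kerQ_def Qn_act hv_act_Fock lin_zero[OF lin_hv_act] simp del: hv_act.simps)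

lemma kerQ_submodule: "level \<gamma> \<Longrightarrow> hv_submodule scl (Fock_module \<gamma>) act (kerQ \<gamma> n)"
  unfolding hv_submodule_def
  by (intro conjI allI ballI kerQ_subspace kerQ_act) (auto simp: kerQ_def)

lemma kerQ_one: "kerQ \<gamma> (Suc 0) = {v \<in> Fock_module \<gamma>. Q v = 0}"
  by (simp add: kerQ_def)

lemma kerQ_screening: "level \<gamma> \<Longrightarrow> {v \<in> Fock_module \<gamma>. screening cLI v = 0} = kerQ \<gamma> 1"
  by (auto simp: kerQ_one screening_Q[of \<gamma>])

lemma fexp_in_kerQ: "fexp \<gamma> \<in> kerQ \<gamma> 1"
  by (simp add: kerQ_one fexp_in_Fock Q_fexp)

lemma submodule_with_vacuum:
  assumes "level \<gamma>" "hv_submodule scl (kerQ \<gamma> 1) act N" "fexp \<gamma> \<in> N"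
  shows "N = kerQ \<gamma> 1"
proof
  have N: "N \<subseteq> kerQ \<gamma> 1" "fock.subspace N" "\<And>x v. v \<in> N \<Longrightarrow> act x v \<in> N"
    using assms(2) by (auto simp: hv_submodule_def)
  show "N \<subseteq> kerQ \<gamma> 1" by fact
  show "kerQ \<gamma> 1 \<subseteq> N"
  proof
    fix v assume v: "v \<in> kerQ \<gamma> 1"
    then have "v \<in> Fock_module \<gamma>" by (simp add: kerQ_def)
    then obtain m where m: "Fil \<gamma> m v" using Fil_ex by blast
    show "v \<in> N"
    proof (rule ker_in_submodule[OF assms(1) N(2) assms(3) _ _ _ m])
      show "heis (1, 1) (- int n) u \<in> N" if "u \<in> N" for n u
        using N(3)[OF that, of "I_gen (- int n)"] by (simp only: hv_act_I)
      show "vir \<rho> (- int n) u \<in> N" if "u \<in> N" for n u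
        using N(3)[OF that, of "L_gen (- int n)"] by (simp only: hv_act_L)
      show "Q u = 0" if "u \<in> N" for u using N(1) that by (auto simp: kerQ_one)
      show "Q v = 0" using v by (simp add: kerQ_one)
    qed
  qed
qed

lemma nonzero_submodule_vacuum:
  assumes "level \<gamma>" "hv_submodule scl (kerQ \<gamma> 1) act N" "N \<noteq> {0}"
  shows "fexp \<gamma> \<in> N"
proof -
  have N: "N \<subseteq> kerQ \<gamma> 1" "fock.subspace N" "\<And>x v. v \<in> N \<Longrightarrow> act x v \<in> N"
    using assms(2) by (auto simp: hv_submodule_def)
  show ?thesis
  proof (rule vacuum_in_submodule[OF assms(1) N(2) _ assms(3)])
    show "N \<subseteq> Fock_module \<gamma>" using N(1) by (auto simp: kerQ_def)
    show "heis (1, 1) (int n) u \<in> N" if "u \<in> N" for n u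
      using N(3)[OF that, of "I_gen (int n)"] by (simp only: hv_act_I)
    show "vir \<rho> (int n) u \<in> N" if "u \<in> N" for n u
      using N(3)[OF that, of "L_gen (int n)"] by (simp only: hv_act_L)
  qed
qed

lemma act_fexp:
  "n > 0 \<Longrightarrow> act (L_gen n) (fexp \<gamma>) = 0" "n > 0 \<Longrightarrow> act (I_gen n) (fexp \<gamma>) = 0"
  "act (L_gen 0) (fexp \<gamma>) = scl (Delta cL cLI (fst \<gamma>) (snd \<gamma>)) (fexp \<gamma>)"
  "act (I_gen 0) (fexp \<gamma>) = scl (fst \<gamma> - snd \<gamma>) (fexp \<gamma>)"
proof -
  have d: "hform \<gamma> \<gamma> / 2 - hform \<rho> \<gamma> = Delta cL cLI (fst \<gamma>) (snd \<gamma>)"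
    by (simp add: hform_def Delta_def power2_eq_square diff_divide_distrib)
  show "act (L_gen 0) (fexp \<gamma>) = scl (Delta cL cLI (fst \<gamma>) (snd \<gamma>)) (fexp \<gamma>)"
    unfolding hv_act_L vir_fexp_zero d ..
qed (simp_all add: hv_act_L hv_act_I vir_fexp_pos heis_fexp hform_def del: hv_act.simps(1,2))

lemma kerQ_irreducible_hw:
  assumes "level \<gamma>"
  shows "is_irreducible_hw_module cL 0 cLI (Delta cL cLI (fst \<gamma>) (snd \<gamma>)) (fst \<gamma> - snd \<gamma>) scl (kerQ \<gamma> 1) act"
proof -
  have self: "hv_submodule scl (kerQ \<gamma> 1) act (kerQ \<gamma> 1)"
    using kerQ_subspace kerQ_act[OF assms] by (simp add: hv_submodule_def del: hv_act.simps)
  have "hv_module scl (kerQ \<gamma> 1) act"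
    by (rule hv_module_subspace[OF cLI _ kerQ_subspace kerQ_act[OF assms]]) (auto simp: kerQ_def)
  moreover have "hv_irreducible scl (kerQ \<gamma> 1) act"
    unfolding hv_irreducible_def
    using fexp_in_kerQ fexp_nonzero submodule_with_vacuum[OF assms] nonzero_submodule_vacuum[OF assms]
    by blast
  moreover have "hv_generated scl (kerQ \<gamma> 1) act {fexp \<gamma>} = kerQ \<gamma> 1"
    unfolding hv_generated_def using self fexp_in_kerQ submodule_with_vacuum[OF assms] by blast
  ultimately show ?thesis
    unfolding is_irreducible_hw_module_def
    using fexp_in_kerQ[of \<gamma>] fexp_nonzero[of \<gamma>] act_fexp[where \<gamma> = \<gamma>]
    by (intro conjI bexI[of _ "fexp \<gamma>"]) (simp_all del: hv_act.simps(1,2))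
qed

lemma cosingularI:
  assumes lev: "level \<gamma>" and v: "v \<in> Fock_module \<gamma>" and Qv: "(Q ^^ n) v = fexp \<delta>"
  shows "hv_cosingular scl (Fock_module \<gamma>) act v"
proof -
  let ?N = "kerQ \<gamma> n"
  note N = kerQ_subspace[of \<gamma> n]
  have lift: "coset_lift ?N (act x) (coset ?N v) = coset ?N (act x v)" for x
    by (rule coset_lift_coset[OF N lin_hv_act kerQ_act[OF lev]])
  have lift_scl: "coset_lift ?N (scl a) (coset ?N v) = coset ?N (scl a v)" for a
    by (rule coset_lift_coset[OF N lin_scl_fun[OF lin_id] fock.subspace_scale[OF N]])
  \<comment> \<open>Applying Q^n turns this difference into the same expression for e^\<delta>, so
    the highest weight relations of e^\<delta> hold for v modulo ker Q^n.\<close>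
  have mem: "act x v - scl a v \<in> ?N" if "act x (fexp \<delta>) = scl a (fexp \<delta>)" for x a
    using that v lev
    by (simp add: kerQ_def Fock_intros hv_act_Fock lin_diff[OF lin_Qn] lin_scl[OF lin_Qn] Qn_act Qv del: hv_act.simps)
  have "coset ?N (act x v) = ?N" if "act x (fexp \<delta>) = 0" for x
    using mem[of x 0] that by (intro coset_zero[OF N]) simp
  moreover have "coset ?N (act x v) = coset ?N (scl a v)" if "act x (fexp \<delta>) = scl a (fexp \<delta>)" for x a
    by (rule coset_eq[OF N mem[OF that]])
  moreover have "coset ?N v \<noteq> ?N"
  proof
    assume e: "coset ?N v = ?N"
    have "v \<in> coset ?N v" using image_eqI[OF _ fock.subspace_0[OF N], of v "(+) v"] by (simp add: coset_def)
    then show False using e Qv fexp_nonzero by (simp add: kerQ_def)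
  qed
  ultimately have "hv_singular (\<lambda>a. coset_lift ?N (scl a)) ?N (coset ?N ` Fock_module \<gamma>)
      (\<lambda>x. coset_lift ?N (act x)) (coset ?N v)"
    unfolding hv_singular_def lift lift_scl using v act_fexp[where \<gamma> = \<delta>] by blast
  then show ?thesis
    unfolding hv_cosingular_def using v kerQ_submodule[OF lev] by blast
qed

text \<open>Q^n embeds ker Q^(n+1) / ker Q^n into the kernel of Q on the Fock module at \<gamma> + n
  \<phi>, which its vacuum generates. As N reaches that vacuum under Q^n, it contains ker Q^(n+1)
  modulo ker Q^n.\<close>

lemma Fock_generated:
  assumes lev: "level \<gamma>" and N: "fock.subspace N" "N \<subseteq> Fock_module \<gamma>" "\<And>x v. v \<in> N \<Longrightarrow> act x v \<in> N"
    and gen: "\<And>n. \<exists>v\<in>N. (Q ^^ n) v = fexp (translate \<phi> n \<gamma>)"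
  shows "N = Fock_module \<gamma>"
proof
  have "kerQ \<gamma> n \<subseteq> N" for n
  proof (induction n)
    case 0
    show ?case using fock.subspace_0[OF N(1)] by (auto simp: kerQ_def)
  next
    case (Suc n)
    let ?G = "translate \<phi> n \<gamma>"
    let ?M = "(Q ^^ n) ` N \<inter> kerQ ?G 1"
    have lev': "level ?G" by (rule level_translate[OF lev])
    have "?M = kerQ ?G 1"
    proof (rule submodule_with_vacuum[OF lev'])
      obtain v where "v \<in> N" "fexp ?G = (Q ^^ n) v" using gen[of n] by metis
      then show "fexp ?G \<in> ?M" using fexp_in_kerQ[of ?G] by blast
      show "hv_submodule scl (kerQ ?G 1) act ?M"
        unfolding hv_submodule_def
      proof (intro conjI allI ballI)
        show "fock.subspace ?M"
          by (intro fock.subspace_inter kerQ_subspace module_hom.subspace_image[OF lin_Qn N(1)])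
        fix x v assume "v \<in> ?M"
        then obtain u where u: "u \<in> N" "v = (Q ^^ n) u" "v \<in> kerQ ?G 1" by blast
        then have "act x v = (Q ^^ n) (act x u)" using N(2) lev by (auto simp: Qn_act simp del: hv_act.simps)
        then show "act x v \<in> ?M" using N(3)[OF u(1)] kerQ_act[OF lev' u(3)] by blast
      qed blast
    qed
    show ?case
    proof
      fix v assume v: "v \<in> kerQ \<gamma> (Suc n)"
      then have "(Q ^^ n) v \<in> kerQ ?G 1"
        using Qn_Fock by (auto simp: kerQ_def)
      then obtain u where u: "u \<in> N" "(Q ^^ n) v = (Q ^^ n) u" using \<open>?M = kerQ ?G 1\<close> by blast
      then have "v - u \<in> kerQ \<gamma> n"
        using v N(2) by (auto simp: kerQ_def lin_diff[OF lin_Qn] intro!: Fock_diff)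
      then have "v - u + u \<in> N" using Suc u(1) by (intro fock.subspace_add[OF N(1)]) auto
      then show "v \<in> N" by simp
    qed
  qed
  then show "Fock_module \<gamma> \<subseteq> N"
  proof safe
    fix v assume v: "v \<in> Fock_module \<gamma>"
    \<comment> \<open>Q lowers the level, and level 0 is the zero space, so Q^m kills every vector
      of level m.\<close>
    then obtain m where "Fil \<gamma> m v" using Fil_ex by blast
    from Fil_Qn[OF this, of m] have "v \<in> kerQ \<gamma> m" using v by (simp add: kerQ_def)
    then show "v \<in> N" using \<open>\<And>n. kerQ \<gamma> n \<subseteq> N\<close> by blast
  qed
qed (rule N(2))

text \<open>Closure under the vertex algebra includes closure under the modes of I and \<omega>,
  while the central elements act by scalars; so every \<open>LH_submodule\<close> is stable under H,
  and \<open>Fock_generated\<close> applies to it.\<close>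

lemma LH_generated_Fock:
  assumes lev: "level \<gamma>" and S: "S \<subseteq> Fock_module \<gamma>" "\<And>n. \<exists>v\<in>S. (Q ^^ n) v = fexp (translate \<phi> n \<gamma>)"
  shows "LH_generated cL cLI (Fock_module \<gamma>) S = Fock_module \<gamma>"
proof -
  have "LH_submodule cL cLI (Fock_module \<gamma>) (Fock_module \<gamma>)"
    by (simp add: LH_submodule_def Fock_module_subspace vop_Fock)
  moreover have "N = Fock_module \<gamma>" if N: "LH_submodule cL cLI (Fock_module \<gamma>) N" "S \<subseteq> N" for N
  proof (rule Fock_generated[OF lev])
    show "fock.subspace N" "N \<subseteq> Fock_module \<gamma>" using N by (auto simp: LH_submodule_def)
    then show "act x v \<in> N" if "v \<in> N" for x v
      using N(1) that
      by (cases x) (auto simp: LH_submodule_def LH_alg_def fock.subspace_0 fock.subspace_scale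
          intro: vertex_subalgebra.intros)
    show "\<exists>v\<in>N. (Q ^^ n) v = fexp (translate \<phi> n \<gamma>)" for n using S(2) N(2) by blast
  qed
  ultimately show ?thesis unfolding LH_generated_def using S(1) by blast
qed

end

theorem proposition2p7:
  fixes cL cLI r s h hI :: complex and p :: nat
  assumes "cLI \<noteq> 0"
    and "h = Delta cL cLI r s"
    and "hI = r - s"
    and "p > 0"
    and "hI / cLI - 1 = - of_nat p"
  shows "(\<exists>v :: nat \<Rightarrow> fock.
      (\<forall>n\<ge>1. v n \<in> Frs r s
         \<and> hv_cosingular scl (Frs r s) (hv_act cL cLI) (v n)
         \<and> (screening cLI ^^ n) (v n) = fexp (r - of_nat n / cLI, s - of_nat n / cLI))
      \<and> LH_generated cL cLI (Frs r s) ({fexp (r, s)} \<union> {v n | n. n \<ge> 1}) = Frs r s)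
    \<and> hv_submodule scl (Frs r s) (hv_act cL cLI) {v \<in> Frs r s. screening cLI v = 0}
    \<and> is_irreducible_hw_module cL 0 cLI h hI scl {v \<in> Frs r s. screening cLI v = 0} (hv_act cL cLI)
    \<and> (\<forall>(sc :: complex \<Rightarrow> 'v \<Rightarrow> 'v::ab_group_add) W act.
         is_irreducible_hw_module cL 0 cLI h hI sc W act \<longrightarrow>
         hv_isomorphic sc W act scl {v \<in> Frs r s. screening cLI v = 0} (hv_act cL cLI))"
proof -
  interpret hv_realization cL cLI p by unfold_locales (use assms in auto)
  have lev: "level (r, s)"
    using assms(1,5) by (simp add: level_def field_simps flip: assms(3))
  note ker = kerQ_screening[OF lev]
  have irr: "is_irreducible_hw_module cL 0 cLI h hI scl (kerQ (r, s) 1) (hv_act cL cLI)"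
    using kerQ_irreducible_hw[OF lev] assms(2,3) by simp
  have tr: "translate (phi cLI) n (r, s) = (r - of_nat n / cLI, s - of_nat n / cLI)" for n
    by (simp add: translate_def phi_def)
  let ?S = "{fexp (r, s)} \<union> {cosing (r, s) n |n. n \<ge> 1}"
  have "LH_generated cL cLI (Frs r s) ?S = Frs r s"
  proof (rule LH_generated_Fock[OF lev])
    show "?S \<subseteq> Frs r s" using cosing_Fock fexp_in_Fock by auto
    show "\<exists>v\<in>?S. (vtx (phi cLI) (int p) ^^ n) v = fexp (translate (phi cLI) n (r, s))" for n
    \<comment> \<open>The family of cosingular vectors starts at \<open>n = 1\<close>; for
      \<open>n = 0\<close> the highest weight vector serves.\<close>
    proof (cases "n = 0")
      case False
      then show ?thesis
        using Qn_cosing[where \<gamma> = "(r, s)" and n = n] by (intro bexI[of _ "cosing (r, s) n"]) auto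
    qed simp
  qed
  moreover have "cosing (r, s) n \<in> Frs r s \<and> hv_cosingular scl (Frs r s) (hv_act cL cLI) (cosing (r, s) n)
      \<and> (screening cLI ^^ n) (cosing (r, s) n) = fexp (r - of_nat n / cLI, s - of_nat n / cLI)" for n
    using cosing_Fock cosingularI[OF lev cosing_Fock Qn_cosing] screening_Qn[OF lev cosing_Fock] Qn_cosing tr
    by simp
  ultimately show ?thesis
    unfolding ker using kerQ_submodule[OF lev] irr irreducible_hw_unique[OF _ irr] by blast
qed

end
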